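(* Let $G$ be a countable abelian group, $P$ a semigroup with identity $e$, and $\theta$ an action of $P$ on $G$ by injective group homomorphisms. Let $A=C^*(G)$, let $X=\bigsqcup_{p\in P}X_p$ be the associated product system with $X_p=A\mathbbm{1}_p$, let $\mathfrak{R}=\bigoplus_{p\in P}X_p$ be the associated ring and let $\mathfrak{M}$ be the left $\mathfrak{R}$-module with underlying group $A$ and action $(a\mathbbm{1}_p)\rightharpoonup b=a\theta_p(b)$. Let $\mathfrak{F}_0$ be the free left $\mathfrak{R}$-module of rank $1$ with basis element $[\;]$ and, for $n\ge1$, let $\mathfrak{F}_n$ be the free left $\mathfrak{R}$-module with basis $\{[p_1,\dots,p_n]: p_1,\dots,p_n\in P\}$. Let $\partial_{-1}:\mathfrak{F}_0\to\mathfrak{M}$ and $\partial_{n-1}:\mathfrak{F}_n\to\mathfrak{F}_{n-1}$ ($n\ge 1$) be the $\mathfrak{R}$-module homomorphisms with $\partial_{-1}([\;])=1$, $\partial_0([p])=(\mathbbm{1}_p-1)[\;]$, and for $n\ge2$ $$\partial_{n-1}([p_1,\dots,p_n])=\mathbbm{1}_{p_1}[p_2,\dots,p_n]+\sum_{i=1}^{n-1}(-1)^i[p_1,\dots,p_{i-1},p_ip_{i+1},p_{i+2},\dots,p_n]+(-1)^n[p_1,\dots,p_{n-1}].$$ Then $$\cdots\xrightarrow{\partial_2}\mathfrak{F}_2\xrightarrow{\partial_1}\mathfrak{F}_1\xrightarrow{\partial_0}\mathfrak{F}_0\xrightarrow{\partial_{-1}}\mathfrak{M}\to0$$ is an exact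 complex, i.e. a free resolution of the $\mathfrak{R}$-module $\mathfrak{M}$. Consequently, for all $n\ge0$, $$H^n_\Psi(X)=\operatorname{Ext}^n_{\mathfrak{R}}(\mathfrak{M},\mathfrak{M})\cong\ker(\partial^n)/\operatorname{im}(\partial^{n-1})$$ (with $\operatorname{im}(\partial^{-1}):=0$), where $C^0(P,\mathfrak{M})=\mathfrak{M}$, $C^n(P,\mathfrak{M})$ is the group of all maps $\xi:P^n\to\mathfrak{M}$ for $n\geq 1$, and $\partial^n:C^n(P,\mathfrak{M})\to C^{n+1}(P,\mathfrak{M})$ are given by $\partial^0(a)(p)=\theta_p(a)-a$ and, for $n\ge1$, $$\partial^n(\xi)(p_1,\dots,p_{n+1})=\theta_{p_1}(\xi(p_2,\dots,p_{n+1}))+\sum_{i=1}^n(-1)^i\xi(p_1,\dots,p_{i-1},p_ip_{i+1},p_{i+2},\dots,p_{n+1})+(-1)^{n+1}\xi(p_1,\dots,p_n).$$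
   Context: An action $\theta$ of $P$ on $G$ means $\theta_{pq}=\theta_p\theta_q$ and $\theta_e=\mathrm{id}$; $\theta_p$ also denotes the induced injective unital $*$-endomorphism of the group $C^*$-algebra $A=C^*(G)$. For $p\in P$, $X_p$ is the free left $A$-module of rank one with basis element $\mathbbm{1}_p$ and right action $\mathbbm{1}_pa=\theta_p(a)\mathbbm{1}_p$; $X_e=A$ with $\mathbbm{1}_e=1$. The fibers are multiplied by $(a\mathbbm{1}_p)(b\mathbbm{1}_q)=a\theta_p(b)\mathbbm{1}_{pq}$, and the ring $\mathfrak{R}=\bigoplus_{p\in P}X_p$ (algebraic direct sum) has the biadditive multiplication extending this; its unit is $1=\mathbbm{1}_e$. The map $\Psi:\mathfrak{R}\to A$ is the additive map with $\Psi(a\mathbbm{1}_p)=a$; the action of $\mathfrak{R}$ on $\mathfrak{M}=A$ is $x\rightharpoonup a=\Psi(xa)$. The $n$-th cohomology group of $X$ relative to $\Psi$ is defined as $H^n_\Psi(X):=\operatorname{Ext}^n_{\mathfrak{R}}(\mathfrak{M},\mathfrak{M})$. (The inner products on the fibers play no role here.) *)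

theory Defs
  imports Complex_Main "HOL-Library.Countable" "HOL-Library.Poly_Mapping" "HOL-Library.FuncSet" "HOL-Algebra.AbelCoset" "HOL-Algebra.Module"
begin

section \<open>The group \<open>C\<^sup>*\<close>-algebra of a discrete abelian group\<close>

text \<open>
  The group \<open>G\<close> is a type of class \<^class>\<open>ab_group_add\<close>, written additively, so that the library's
  convolution ring \<^typ>\<open>'g \<Rightarrow>\<^sub>0 complex\<close> is the complex group algebra of \<open>G\<close>; the group element \<open>g\<close>
  is \<^term>\<open>Poly_Mapping.single g (1::complex)\<close>.
\<close>

lemma poly_mapping_decompose:
  "(\<Sum>g\<in>Poly_Mapping.keys x. Poly_Mapping.single g (Poly_Mapping.lookup x g)) = x"
  by (rule poly_mapping_eqI) (simp add: lookup_sum lookup_single when_def in_keys_iff)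

lift_definition ga_star :: "('g::ab_group_add \<Rightarrow>\<^sub>0 complex) \<Rightarrow> ('g \<Rightarrow>\<^sub>0 complex)"
  is "\<lambda>f g. cnj (f (- g))"
proof -
  fix f :: "'g \<Rightarrow> complex"
  assume "finite {g. f g \<noteq> 0}"
  then have "finite (uminus ` {g. f g \<noteq> 0})" by (rule finite_imageI)
  moreover have "{g. cnj (f (- g)) \<noteq> 0} \<subseteq> uminus ` {g. f g \<noteq> 0}"
    by (auto intro!: image_eqI[where x = "- _"])
  ultimately show "finite {g. cnj (f (- g)) \<noteq> 0}" by (rule finite_subset[rotated])
qed

definition cstar_seminorm :: "(('g::ab_group_add \<Rightarrow>\<^sub>0 complex) \<Rightarrow> real) \<Rightarrow> bool"
  where "cstar_seminorm \<nu> \<longleftrightarrow>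
    (\<forall>x y. \<nu> (x + y) \<le> \<nu> x + \<nu> y) \<and>
    (\<forall>c x. \<nu> (Poly_Mapping.single 0 c * x) = cmod c * \<nu> x) \<and>
    (\<forall>x y. \<nu> (x * y) \<le> \<nu> x * \<nu> y) \<and>
    (\<forall>x. \<nu> (ga_star x * x) = (\<nu> x)\<^sup>2)"

text \<open>
  The universal norm. A representation \<open>\<pi>\<close> of the group algebra on a Hilbert space gives the
  \<open>C\<^sup>*\<close>-seminorm \<open>x \<mapsto> \<parallel>\<pi>(x)\<parallel>\<close>, and every \<open>C\<^sup>*\<close>-seminorm arises in this way, so this supremum is
  the supremum of \<open>\<parallel>\<pi>(x)\<parallel>\<close> over all representations.
\<close>

definition univ_norm :: "('g::ab_group_add \<Rightarrow>\<^sub>0 complex) \<Rightarrow> real"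
  where "univ_norm x = (SUP \<nu>\<in>Collect cstar_seminorm. \<nu> x)"

lemma ga_star_single: "ga_star (Poly_Mapping.single g c) = Poly_Mapping.single (- g) (cnj c)"
  by (rule poly_mapping_eqI) (auto simp: ga_star.rep_eq lookup_single when_def)

lemma cstar_seminorm_zero: "cstar_seminorm (\<lambda>x. 0)"
  by (simp add: cstar_seminorm_def)

context
  fixes \<nu> :: "('g::ab_group_add \<Rightarrow>\<^sub>0 complex) \<Rightarrow> real"
  assumes \<nu>: "cstar_seminorm \<nu>"
begin

lemma seminorm_add: "\<nu> (x + y) \<le> \<nu> x + \<nu> y"
  and seminorm_scale: "\<nu> (Poly_Mapping.single 0 c * x) = cmod c * \<nu> x"
  and seminorm_mult: "\<nu> (x * y) \<le> \<nu> x * \<nu> y"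
  and seminorm_star: "\<nu> (ga_star x * x) = (\<nu> x)\<^sup>2"
  using \<nu> unfolding cstar_seminorm_def by blast+

lemma seminorm_0: "\<nu> 0 = 0"
  using seminorm_scale[of 0 0] by simp

lemma seminorm_uminus: "\<nu> (- x) = \<nu> x"
proof -
  have "Poly_Mapping.single 0 (- 1) * x = - x"
    by (simp add: single_uminus)
  then show ?thesis using seminorm_scale[of "- 1" x] by simp
qed

lemma seminorm_nonneg: "0 \<le> \<nu> x"
  using seminorm_add[of x "- x"] by (simp add: seminorm_0 seminorm_uminus)

lemma seminorm_single: "\<nu> (Poly_Mapping.single g c) \<le> cmod c"
proof -
  have "ga_star 1 * 1 = (1 :: 'g \<Rightarrow>\<^sub>0 complex)"
    using ga_star_single[of 0 1] by simp
  then have "\<nu> 1 = (\<nu> 1)\<^sup>2" using seminorm_star[of 1] by simp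
  then have one: "\<nu> 1 \<le> 1"
    by (auto simp: power2_eq_square)
  have "(\<nu> (Poly_Mapping.single g 1))\<^sup>2 = \<nu> 1"
    using seminorm_star[of "Poly_Mapping.single g 1"] by (simp add: ga_star_single mult_single)
  then have "\<nu> (Poly_Mapping.single g 1) \<le> 1"
    using one by (metis power2_le_imp_le one_power2 zero_le_one)
  moreover have "Poly_Mapping.single g c = Poly_Mapping.single 0 c * Poly_Mapping.single g 1"
    by (simp add: mult_single)
  ultimately show ?thesis
    by (metis seminorm_scale mult_left_le norm_ge_zero)
qed

lemma seminorm_le_l1: "\<nu> x \<le> (\<Sum>g\<in>Poly_Mapping.keys x. cmod (Poly_Mapping.lookup x g))"
proof -
  have sum: "\<nu> (\<Sum>g\<in>K. Poly_Mapping.single g (f g)) \<le> (\<Sum>g\<in>K. cmod (f g))" if "finite K" for K f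
    using that
  proof (induction K)
    case empty
    then show ?case by (simp add: seminorm_0)
  next
    case (insert a K)
    then show ?case
      using seminorm_add[of "Poly_Mapping.single a (f a)" "\<Sum>g\<in>K. Poly_Mapping.single g (f g)"]
        seminorm_single[of a "f a"] by simp
  qed
  show ?thesis
    using sum[of "Poly_Mapping.keys x" "Poly_Mapping.lookup x"] by (simp add: poly_mapping_decompose)
qed

end

lemma bdd_above_seminorms: "bdd_above ((\<lambda>\<nu>. \<nu> x) ` Collect cstar_seminorm)"
  by (rule bdd_aboveI2[OF seminorm_le_l1]) simp

lemma seminorm_le_univ_norm: "cstar_seminorm \<nu> \<Longrightarrow> \<nu> x \<le> univ_norm x"
  unfolding univ_norm_def by (rule cSUP_upper) (simp_all add: bdd_above_seminorms)

lemma univ_norm_leI: "(\<And>\<nu>. cstar_seminorm \<nu> \<Longrightarrow> \<nu> x \<le> b) \<Longrightarrow> univ_norm x \<le> b"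
  unfolding univ_norm_def by (rule cSUP_least) (use cstar_seminorm_zero in auto)

lemma univ_norm_nonneg: "0 \<le> univ_norm x"
  using seminorm_le_univ_norm[OF cstar_seminorm_zero] .

lemma univ_norm_0 [simp]: "univ_norm 0 = 0"
  by (intro antisym univ_norm_nonneg univ_norm_leI) (simp add: seminorm_0)

lemma univ_norm_add: "univ_norm (x + y) \<le> univ_norm x + univ_norm y"
  by (rule univ_norm_leI) (meson add_mono order_trans seminorm_add seminorm_le_univ_norm)

lemma univ_norm_uminus [simp]: "univ_norm (- x) = univ_norm x"
  by (simp add: univ_norm_def seminorm_uminus cong: SUP_cong_simp)

lemma univ_norm_mult: "univ_norm (x * y) \<le> univ_norm x * univ_norm y"
  by (rule univ_norm_leI)
    (meson mult_mono order_trans seminorm_mult seminorm_le_univ_norm seminorm_nonneg univ_norm_nonneg)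

definition ga_Cauchy :: "(nat \<Rightarrow> ('g::ab_group_add \<Rightarrow>\<^sub>0 complex)) \<Rightarrow> bool"
  where "ga_Cauchy X \<longleftrightarrow> (\<forall>e>0. \<exists>N. \<forall>m\<ge>N. \<forall>n\<ge>N. univ_norm (X m - X n) < e)"

definition ga_null :: "(nat \<Rightarrow> ('g::ab_group_add \<Rightarrow>\<^sub>0 complex)) \<Rightarrow> bool"
  where "ga_null X \<longleftrightarrow> (\<lambda>n. univ_norm (X n)) \<longlonglongrightarrow> 0"

definition ga_rel ::
  "(nat \<Rightarrow> ('g::ab_group_add \<Rightarrow>\<^sub>0 complex)) \<Rightarrow> (nat \<Rightarrow> ('g \<Rightarrow>\<^sub>0 complex)) \<Rightarrow> bool"
  where "ga_rel X Y \<longleftrightarrow> ga_Cauchy X \<and> ga_Cauchy Y \<and> ga_null (\<lambda>n. X n - Y n)"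

lemma ga_null_le:
  assumes "f \<longlonglongrightarrow> 0" and "\<And>n. univ_norm (X n) \<le> f n"
  shows "ga_null X"
  unfolding ga_null_def
  by (rule tendsto_sandwich[OF _ _ tendsto_const assms(1)]) (auto simp: univ_norm_nonneg assms(2))

lemma ga_null_add: "ga_null X \<Longrightarrow> ga_null Y \<Longrightarrow> ga_null (\<lambda>n. X n + Y n)"
  by (rule ga_null_le[of "\<lambda>n. univ_norm (X n) + univ_norm (Y n)"])
    (auto simp: ga_null_def univ_norm_add intro: tendsto_add_zero)

lemma ga_null_uminus: "ga_null X \<Longrightarrow> ga_null (\<lambda>n. - X n)"
  by (simp add: ga_null_def)

lemma ga_Cauchy_const: "ga_Cauchy (\<lambda>n. x)"
  by (simp add: ga_Cauchy_def)

lemma ga_Cauchy_add: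
  assumes "ga_Cauchy X" "ga_Cauchy Y"
  shows "ga_Cauchy (\<lambda>n. X n + Y n)"
  unfolding ga_Cauchy_def
proof (intro allI impI)
  fix e :: real assume "e > 0"
  then have e: "e / 2 > 0" by simp
  obtain M where M: "\<And>m n. m \<ge> M \<Longrightarrow> n \<ge> M \<Longrightarrow> univ_norm (X m - X n) < e / 2"
    using assms(1) e unfolding ga_Cauchy_def by meson
  obtain N where N: "\<And>m n. m \<ge> N \<Longrightarrow> n \<ge> N \<Longrightarrow> univ_norm (Y m - Y n) < e / 2"
    using assms(2) e unfolding ga_Cauchy_def by meson
  have "univ_norm (X m + Y m - (X n + Y n)) < e" if "m \<ge> max M N" "n \<ge> max M N" for m n
    using univ_norm_add[of "X m - X n" "Y m - Y n"] M[of m n] N[of m n] that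
    by (simp add: algebra_simps)
  then show "\<exists>N. \<forall>m\<ge>N. \<forall>n\<ge>N. univ_norm (X m + Y m - (X n + Y n)) < e" by blast
qed

lemma ga_Cauchy_uminus: "ga_Cauchy X \<Longrightarrow> ga_Cauchy (\<lambda>n. - X n)"
  unfolding ga_Cauchy_def minus_diff_minus univ_norm_uminus .

lemma ga_Cauchy_bounded:
  assumes "ga_Cauchy X"
  obtains B where "B > 0" "\<And>n. univ_norm (X n) \<le> B"
proof -
  obtain N where N: "\<And>m n. m \<ge> N \<Longrightarrow> n \<ge> N \<Longrightarrow> univ_norm (X m - X n) < 1"
    using assms unfolding ga_Cauchy_def by (meson zero_less_one)
  define B where "B = 1 + (\<Sum>n\<le>N. univ_norm (X n))"
  have "univ_norm (X n) \<le> B" for n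
  proof (cases "n \<le> N")
    case True
    then have "univ_norm (X n) \<le> (\<Sum>n\<le>N. univ_norm (X n))"
      by (intro member_le_sum) (auto simp: univ_norm_nonneg)
    then show ?thesis by (simp add: B_def)
  next
    case False
    have "univ_norm (X N) \<le> (\<Sum>n\<le>N. univ_norm (X n))"
      by (intro member_le_sum) (auto simp: univ_norm_nonneg)
    moreover have "univ_norm (X n) \<le> univ_norm (X n - X N) + univ_norm (X N)"
      using univ_norm_add[of "X n - X N" "X N"] by simp
    ultimately show ?thesis using N[of n N] False by (simp add: B_def)
  qed
  moreover have "B > 0"
    unfolding B_def by (intro add_pos_nonneg sum_nonneg) (auto simp: univ_norm_nonneg)
  ultimately show thesis using that by blast
qed

lemma ga_Cauchy_mult:
  assumes "ga_Cauchy X" "ga_Cauchy Y"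
  shows "ga_Cauchy (\<lambda>n. X n * Y n)"
  unfolding ga_Cauchy_def
proof (intro allI impI)
  fix e :: real assume "e > 0"
  obtain B where B: "B > 0" "\<And>n. univ_norm (X n) \<le> B" using ga_Cauchy_bounded[OF assms(1)] by blast
  obtain C where C: "C > 0" "\<And>n. univ_norm (Y n) \<le> C" using ga_Cauchy_bounded[OF assms(2)] by blast
  have eC: "e / (2 * C) > 0" and eB: "e / (2 * B) > 0"
    using \<open>e > 0\<close> B(1) C(1) by simp_all
  obtain M where M: "\<And>m n. m \<ge> M \<Longrightarrow> n \<ge> M \<Longrightarrow> univ_norm (X m - X n) < e / (2 * C)"
    using assms(1) eC unfolding ga_Cauchy_def by meson
  obtain N where N: "\<And>m n. m \<ge> N \<Longrightarrow> n \<ge> N \<Longrightarrow> univ_norm (Y m - Y n) < e / (2 * B)"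
    using assms(2) eB unfolding ga_Cauchy_def by meson
  have "univ_norm (X m * Y m - X n * Y n) < e" if "m \<ge> max M N" "n \<ge> max M N" for m n
  proof -
    have "X m * Y m - X n * Y n = (X m - X n) * Y m + X n * (Y m - Y n)"
      by (simp add: algebra_simps)
    then have "univ_norm (X m * Y m - X n * Y n)
        \<le> univ_norm ((X m - X n) * Y m) + univ_norm (X n * (Y m - Y n))"
      using univ_norm_add[of "(X m - X n) * Y m" "X n * (Y m - Y n)"] by simp
    also have "\<dots>
        \<le> univ_norm (X m - X n) * univ_norm (Y m) + univ_norm (X n) * univ_norm (Y m - Y n)"
      by (intro add_mono univ_norm_mult)
    also have "\<dots> \<le> univ_norm (X m - X n) * C + B * univ_norm (Y m - Y n)"
      by (intro add_mono mult_mono) (auto simp: B C univ_norm_nonneg less_imp_le)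
    also have "\<dots> < e / (2 * C) * C + B * (e / (2 * B))"
      by (intro add_strict_mono mult_strict_right_mono mult_strict_left_mono)
        (use M[of m n] N[of m n] that B C in auto)
    also have "\<dots> = e" using B(1) C(1) by simp
    finally show ?thesis .
  qed
  then show "\<exists>N. \<forall>m\<ge>N. \<forall>n\<ge>N. univ_norm (X m * Y m - X n * Y n) < e" by blast
qed

lemma ga_null_mult_right:
  assumes "ga_null X" "ga_Cauchy Y"
  shows "ga_null (\<lambda>n. X n * Y n)"
proof -
  obtain C where C: "C > 0" "\<And>n. univ_norm (Y n) \<le> C" using ga_Cauchy_bounded[OF assms(2)] by blast
  show ?thesis
  proof (rule ga_null_le)
    show "(\<lambda>n. univ_norm (X n) * C) \<longlonglongrightarrow> 0"
      using assms(1) unfolding ga_null_def by (rule tendsto_mult_left_zero)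
    show "univ_norm (X n * Y n) \<le> univ_norm (X n) * C" for n
      using univ_norm_mult[of "X n" "Y n"] mult_left_mono[OF C(2) univ_norm_nonneg]
      by (rule order_trans)
  qed
qed

lemma ga_rel_refl: "ga_Cauchy X \<Longrightarrow> ga_rel X X"
  by (simp add: ga_rel_def ga_null_def)

lemma part_equivp_ga_rel: "part_equivp ga_rel" (is "part_equivp ?R")
proof (rule part_equivpI)
  show "\<exists>X. ?R X X" using ga_rel_refl[OF ga_Cauchy_const] by blast
  show "symp ?R"
    by (rule sympI) (use ga_null_uminus in \<open>fastforce simp: ga_rel_def\<close>)
  show "transp ?R"
  proof (rule transpI)
    fix X Y Z :: "nat \<Rightarrow> ('a \<Rightarrow>\<^sub>0 complex)"
    assume "?R X Y" "?R Y Z"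
    then show "?R X Z"
      using ga_null_add[of "\<lambda>n. X n - Y n" "\<lambda>n. Y n - Z n"] by (simp add: ga_rel_def)
  qed
qed

text \<open>
  \<open>C\<^sup>*(G)\<close>, the completion of the group algebra for the universal norm: Cauchy sequences modulo null
  sequences. Only its ring structure and the induced endomorphisms are needed in what follows.
\<close>

quotient_type (overloaded) 'g cstar =
  "nat \<Rightarrow> ('g::ab_group_add \<Rightarrow>\<^sub>0 complex)" / partial: ga_rel
  by (rule part_equivp_ga_rel)

lemma cstar_cases:
  obtains X where "a = abs_cstar X" "ga_Cauchy X"
proof -
  have "\<exists>X. a = abs_cstar X \<and> ga_Cauchy X"
    by (rule cstar.abs_induct) (auto simp: ga_rel_def)
  then show thesis using that by blast
qed

instantiation cstar :: (ab_group_add) comm_ring_1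
begin

lift_definition zero_cstar :: "'a cstar" is "\<lambda>n. 0"
  by (rule ga_rel_refl[OF ga_Cauchy_const])

lift_definition one_cstar :: "'a cstar" is "\<lambda>n. 1"
  by (rule ga_rel_refl[OF ga_Cauchy_const])

lift_definition plus_cstar :: "'a cstar \<Rightarrow> 'a cstar \<Rightarrow> 'a cstar" is "\<lambda>X Y n. X n + Y n"
  subgoal for X X' Y Y'
    using ga_null_add[of "\<lambda>n. X n - X' n" "\<lambda>n. Y n - Y' n"]
    by (simp add: ga_rel_def ga_Cauchy_add algebra_simps)
  done

lift_definition uminus_cstar :: "'a cstar \<Rightarrow> 'a cstar" is "\<lambda>X n. - X n"
  subgoal for X X'
    using ga_null_uminus[of "\<lambda>n. X n - X' n"]
    by (simp add: ga_rel_def ga_Cauchy_uminus)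
  done

definition minus_cstar :: "'a cstar \<Rightarrow> 'a cstar \<Rightarrow> 'a cstar"
  where "minus_cstar x y = x + (- y)"

lift_definition times_cstar :: "'a cstar \<Rightarrow> 'a cstar \<Rightarrow> 'a cstar" is "\<lambda>X Y n. X n * Y n"
  subgoal for X X' Y Y'
  proof -
    assume a: "ga_rel X X'" "ga_rel Y Y'"
    have "ga_null (\<lambda>n. (X n - X' n) * Y n + (Y n - Y' n) * X' n)"
      using a by (intro ga_null_add ga_null_mult_right) (auto simp: ga_rel_def)
    moreover have "(X n - X' n) * Y n + (Y n - Y' n) * X' n = X n * Y n - X' n * Y' n" for n
      by (simp add: algebra_simps)
    ultimately show ?thesis using a by (simp add: ga_rel_def ga_Cauchy_mult)
  qed
  done

lemma cstar_seminorm_augmentation: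
  "cstar_seminorm (\<lambda>x :: 'a \<Rightarrow>\<^sub>0 complex. cmod (\<Sum>g\<in>Poly_Mapping.keys x. Poly_Mapping.lookup x g))"
proof -
  define \<epsilon> :: "('a \<Rightarrow>\<^sub>0 complex) \<Rightarrow> complex"
    where "\<epsilon> x = (\<Sum>g\<in>Poly_Mapping.keys x. Poly_Mapping.lookup x g)" for x
  have eps: "\<epsilon> x = (\<Sum>g\<in>K. Poly_Mapping.lookup x g)" if "finite K" "Poly_Mapping.keys x \<subseteq> K" for x K
    unfolding \<epsilon>_def using that by (intro sum.mono_neutral_left) (auto simp: in_keys_iff)
  have add: "\<epsilon> (x + y) = \<epsilon> x + \<epsilon> y" for x y
    using keys_add[of x y]
    by (simp add: eps[of "Poly_Mapping.keys x \<union> Poly_Mapping.keys y"] lookup_add sum.distrib)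
  have single: "\<epsilon> (Poly_Mapping.single g c) = c" for g c
    by (simp add: eps[of "{g}"])
  have zero: "\<epsilon> 0 = 0" by (simp add: \<epsilon>_def)
  have dec: "x = (\<Sum>g\<in>Poly_Mapping.keys x. Poly_Mapping.single g (Poly_Mapping.lookup x g))"
    for x :: "'a \<Rightarrow>\<^sub>0 complex"
    by (simp add: poly_mapping_decompose)
  have sum: "\<epsilon> (sum f K) = (\<Sum>k\<in>K. \<epsilon> (f k))" for f :: "'a \<Rightarrow> ('a \<Rightarrow>\<^sub>0 complex)" and K
    by (induction K rule: infinite_finite_induct) (simp_all add: zero add)
  have mult: "\<epsilon> (x * y) = \<epsilon> x * \<epsilon> y" for x y
  proof -
    have "x * y = (\<Sum>g\<in>Poly_Mapping.keys x. \<Sum>h\<in>Poly_Mapping.keys y.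
        Poly_Mapping.single (g + h) (Poly_Mapping.lookup x g * Poly_Mapping.lookup y h))"
      by (subst dec[of x], subst dec[of y]) (simp add: sum_product mult_single)
    then have "\<epsilon> (x * y) = (\<Sum>g\<in>Poly_Mapping.keys x. \<Sum>h\<in>Poly_Mapping.keys y.
        Poly_Mapping.lookup x g * Poly_Mapping.lookup y h)"
      by (simp add: sum single)
    then show ?thesis by (simp add: \<epsilon>_def sum_product)
  qed
  have star: "\<epsilon> (ga_star x) = cnj (\<epsilon> x)" for x
  proof -
    have "Poly_Mapping.keys (ga_star x) \<subseteq> uminus ` Poly_Mapping.keys x"
      by (auto simp: in_keys_iff ga_star.rep_eq intro!: image_eqI[where x = "- _"])
    then have "\<epsilon> (ga_star x) = (\<Sum>g\<in>uminus ` Poly_Mapping.keys x. Poly_Mapping.lookup (ga_star x) g)"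
      by (intro eps) auto
    also have "\<dots> = (\<Sum>g\<in>Poly_Mapping.keys x. cnj (Poly_Mapping.lookup x g))"
      by (subst sum.reindex) (auto simp: ga_star.rep_eq)
    finally show ?thesis by (simp add: \<epsilon>_def)
  qed
  have "cstar_seminorm (\<lambda>x. cmod (\<epsilon> x))"
    unfolding cstar_seminorm_def
    by (auto simp: add mult single star norm_mult power2_eq_square intro: norm_triangle_ineq)
  then show ?thesis by (simp add: \<epsilon>_def)
qed

instance
proof
  fix a b c :: "'a cstar"
  obtain X Y Z where a: "a = abs_cstar X" "ga_Cauchy X" and b: "b = abs_cstar Y" "ga_Cauchy Y"
    and c: "c = abs_cstar Z" "ga_Cauchy Z"
    using cstar_cases by metis
  note simps = a b c times_cstar.abs_eq plus_cstar.abs_eq uminus_cstar.abs_eq zero_cstar_def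
    one_cstar_def ga_rel_refl ga_Cauchy_const ga_Cauchy_add ga_Cauchy_mult ga_Cauchy_uminus
  show "a * b * c = a * (b * c)" by (simp add: simps mult.assoc)
  show "a * b = b * a" by (simp add: simps mult.commute)
  show "1 * a = a" by (simp add: simps)
  show "a + b + c = a + (b + c)" by (simp add: simps add.assoc)
  show "a + b = b + a" by (simp add: simps add.commute)
  show "0 + a = a" by (simp add: simps)
  show "- a + a = 0" by (simp add: simps)
  show "a - b = a + - b" by (rule minus_cstar_def)
  show "(a + b) * c = a * c + b * c" by (simp add: simps distrib_right)
  show "(0 :: 'a cstar) \<noteq> 1"
  proof (transfer, rule notI)
    assume "ga_rel (\<lambda>n. 0 :: 'a \<Rightarrow>\<^sub>0 complex) (\<lambda>n. 1)"
    then have "univ_norm (1 :: 'a \<Rightarrow>\<^sub>0 complex) = 0"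
      by (simp add: ga_rel_def ga_null_def LIMSEQ_const_iff)
    moreover have "1 \<le> univ_norm (1 :: 'a \<Rightarrow>\<^sub>0 complex)"
      using seminorm_le_univ_norm[OF cstar_seminorm_augmentation, of 1] by (simp add: lookup_one)
    ultimately show False by simp
  qed
qed

end

text \<open>The canonical unitary of \<open>C\<^sup>*(G)\<close> belonging to a group element.\<close>

lift_definition cstar_unitary :: "'g::ab_group_add \<Rightarrow> 'g cstar"
  is "\<lambda>g n. Poly_Mapping.single g 1"
  by (rule ga_rel_refl[OF ga_Cauchy_const])

definition ga_map :: "('g \<Rightarrow> 'h) \<Rightarrow> ('g \<Rightarrow>\<^sub>0 complex) \<Rightarrow> ('h \<Rightarrow>\<^sub>0 complex)"
  where "ga_map h x = (\<Sum>g\<in>Poly_Mapping.keys x. Poly_Mapping.single (h g) (Poly_Mapping.lookup x g))"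

text \<open>
  The endomorphism of \<open>C\<^sup>*(G)\<close> induced by an endomorphism \<open>h\<close> of \<open>G\<close> is applied to a representing
  Cauchy sequence; the lemmas below show that the choice of the sequence does not matter.
\<close>

definition cstar_map :: "('g::ab_group_add \<Rightarrow> 'g) \<Rightarrow> 'g cstar \<Rightarrow> 'g cstar"
  where "cstar_map h a = abs_cstar (\<lambda>n. ga_map h (rep_cstar a n))"

lemma ga_map_superset:
  assumes "finite K" "Poly_Mapping.keys x \<subseteq> K"
  shows "ga_map h x = (\<Sum>g\<in>K. Poly_Mapping.single (h g) (Poly_Mapping.lookup x g))"
  unfolding ga_map_def using assms by (intro sum.mono_neutral_left) (auto simp: in_keys_iff)

lemma ga_map_add: "ga_map h (x + y) = ga_map h x + ga_map h y"
  using keys_add[of x y]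
  by (simp add: ga_map_superset[of "Poly_Mapping.keys x \<union> Poly_Mapping.keys y"] lookup_add
      single_add sum.distrib)

lemma ga_map_0 [simp]: "ga_map h 0 = 0"
  by (simp add: ga_map_def)

lemma ga_map_uminus: "ga_map h (- x) = - ga_map h x"
  using ga_map_add[of h x "- x"] by (simp add: eq_neg_iff_add_eq_0 add.commute)

lemma ga_map_diff: "ga_map h (x - y) = ga_map h x - ga_map h y"
  using ga_map_add[of h x "- y"] by (simp add: ga_map_uminus)

lemma ga_map_sum: "ga_map h (sum f K) = (\<Sum>k\<in>K. ga_map h (f k))"
  by (induction K rule: infinite_finite_induct) (simp_all add: ga_map_add)

lemma ga_map_single [simp]: "ga_map h (Poly_Mapping.single g c) = Poly_Mapping.single (h g) c"
  by (simp add: ga_map_superset[of "{g}"])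

lemma ga_star_add: "ga_star (x + y) = ga_star x + ga_star y"
  by (rule poly_mapping_eqI) (simp add: ga_star.rep_eq lookup_add)

lemma ga_star_sum: "ga_star (sum f K) = (\<Sum>k\<in>K. ga_star (f k))"
proof -
  have "ga_star 0 = 0" by (rule poly_mapping_eqI) (simp add: ga_star.rep_eq)
  then show ?thesis
    by (induction K rule: infinite_finite_induct) (simp_all add: ga_star_add)
qed

locale group_endo =
  fixes h :: "'g::ab_group_add \<Rightarrow> 'g"
  assumes hom: "h (x + y) = h x + h y"
begin

sublocale additive h by unfold_locales (rule hom)

lemma ga_map_mult: "ga_map h (x * y) = ga_map h x * ga_map h y"
proof -
  have "x * y = (\<Sum>g\<in>Poly_Mapping.keys x. \<Sum>k\<in>Poly_Mapping.keys y.
      Poly_Mapping.single (g + k) (Poly_Mapping.lookup x g * Poly_Mapping.lookup y k))"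
    by (subst poly_mapping_decompose[of x, symmetric],
        subst poly_mapping_decompose[of y, symmetric]) (simp add: sum_product mult_single)
  then have "ga_map h (x * y) = (\<Sum>g\<in>Poly_Mapping.keys x. \<Sum>k\<in>Poly_Mapping.keys y.
      Poly_Mapping.single (h g + h k) (Poly_Mapping.lookup x g * Poly_Mapping.lookup y k))"
    by (simp add: ga_map_sum hom)
  then show ?thesis by (simp add: ga_map_def sum_product mult_single)
qed

lemma ga_map_1: "ga_map h 1 = 1"
  using ga_map_single[of h 0 1] by (simp add: zero)

lemma ga_map_star: "ga_map h (ga_star x) = ga_star (ga_map h x)"
proof -
  have "ga_star x = (\<Sum>g\<in>Poly_Mapping.keys x. Poly_Mapping.single (- g) (cnj (Poly_Mapping.lookup x g)))"
    by (subst poly_mapping_decompose[of x, symmetric])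
      (simp add: ga_star_sum ga_star_single)
  then show ?thesis
    by (simp add: ga_map_sum ga_map_def[of h x] ga_star_sum
        ga_star_single minus)
qed

lemma univ_norm_ga_map: "univ_norm (ga_map h x) \<le> univ_norm x"
proof (rule univ_norm_leI)
  fix \<nu> :: "('g \<Rightarrow>\<^sub>0 complex) \<Rightarrow> real"
  assume \<nu>: "cstar_seminorm \<nu>"
  have "cstar_seminorm (\<lambda>x. \<nu> (ga_map h x))"
    unfolding cstar_seminorm_def
    using seminorm_add[OF \<nu>] seminorm_scale[OF \<nu>] seminorm_mult[OF \<nu>] seminorm_star[OF \<nu>]
    by (simp add: ga_map_add ga_map_mult ga_map_star zero)
  then show "\<nu> (ga_map h x) \<le> univ_norm x" by (rule seminorm_le_univ_norm)
qed

lemma ga_rel_ga_map: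
  assumes "ga_rel X Y"
  shows "ga_rel (\<lambda>n. ga_map h (X n)) (\<lambda>n. ga_map h (Y n))"
proof -
  have "ga_Cauchy (\<lambda>n. ga_map h (X n))" if "ga_Cauchy X" for X
    using that unfolding ga_Cauchy_def ga_map_diff[symmetric]
    by (meson order_le_less_trans univ_norm_ga_map)
  moreover have "ga_null (\<lambda>n. ga_map h (X n) - ga_map h (Y n))"
    using assms unfolding ga_rel_def ga_map_diff[symmetric]
    by (auto simp: ga_null_def intro: ga_null_le[unfolded ga_null_def] univ_norm_ga_map)
  ultimately show ?thesis using assms by (simp add: ga_rel_def)
qed

lemma cstar_map_abs:
  assumes "ga_Cauchy X"
  shows "cstar_map h (abs_cstar X) = abs_cstar (\<lambda>n. ga_map h (X n))"
proof -
  have "ga_rel (rep_cstar (abs_cstar X)) X"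
    by (rule Quotient3_rep_abs[OF Quotient3_cstar]) (rule ga_rel_refl[OF assms])
  then show ?thesis
    unfolding cstar_map_def by (intro Quotient3_rel_abs[OF Quotient3_cstar] ga_rel_ga_map)
qed

lemma ga_Cauchy_ga_map: "ga_Cauchy X \<Longrightarrow> ga_Cauchy (\<lambda>n. ga_map h (X n))"
  using ga_rel_ga_map[OF ga_rel_refl] by (simp add: ga_rel_def)

lemma cstar_map_unitary: "cstar_map h (cstar_unitary g) = cstar_unitary (h g)"
  unfolding cstar_unitary_def by (simp add: cstar_map_abs ga_Cauchy_const)

lemma cstar_map_1: "cstar_map h 1 = 1"
  unfolding one_cstar_def by (simp add: cstar_map_abs ga_Cauchy_const ga_map_1)

lemma cstar_map_0: "cstar_map h 0 = 0"
  unfolding zero_cstar_def by (simp add: cstar_map_abs ga_Cauchy_const)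

lemma cstar_map_add: "cstar_map h (a + b) = cstar_map h a + cstar_map h b"
  by (cases a rule: cstar_cases; cases b rule: cstar_cases)
    (simp add: plus_cstar.abs_eq cstar_map_abs ga_rel_refl ga_Cauchy_add ga_Cauchy_ga_map ga_map_add)

lemma cstar_map_mult: "cstar_map h (a * b) = cstar_map h a * cstar_map h b"
  by (cases a rule: cstar_cases; cases b rule: cstar_cases)
    (simp add: times_cstar.abs_eq cstar_map_abs ga_rel_refl ga_Cauchy_mult ga_Cauchy_ga_map ga_map_mult)

end


section \<open>Modules over a noncommutative ring\<close>

text \<open>
  The library's \<open>module\<close> locale requires a commutative ring; this is the same notion of left module
  over an arbitrary ring. The ring fields of the library's module record are not used.
\<close>

locale left_module = R?: ring R + M?: abelian_group M for R (structure) and M (structure) +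
  assumes smult_closed [simp, intro]:
      "\<lbrakk>a \<in> carrier R; x \<in> carrier M\<rbrakk> \<Longrightarrow> a \<odot>\<^bsub>M\<^esub> x \<in> carrier M"
    and smult_l_distr:
      "\<lbrakk>a \<in> carrier R; b \<in> carrier R; x \<in> carrier M\<rbrakk>
        \<Longrightarrow> (a \<oplus> b) \<odot>\<^bsub>M\<^esub> x = a \<odot>\<^bsub>M\<^esub> x \<oplus>\<^bsub>M\<^esub> b \<odot>\<^bsub>M\<^esub> x"
    and smult_r_distr:
      "\<lbrakk>a \<in> carrier R; x \<in> carrier M; y \<in> carrier M\<rbrakk>
        \<Longrightarrow> a \<odot>\<^bsub>M\<^esub> (x \<oplus>\<^bsub>M\<^esub> y) = a \<odot>\<^bsub>M\<^esub> x \<oplus>\<^bsub>M\<^esub> a \<odot>\<^bsub>M\<^esub> y"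
    and smult_assoc1:
      "\<lbrakk>a \<in> carrier R; b \<in> carrier R; x \<in> carrier M\<rbrakk>
        \<Longrightarrow> (a \<otimes> b) \<odot>\<^bsub>M\<^esub> x = a \<odot>\<^bsub>M\<^esub> (b \<odot>\<^bsub>M\<^esub> x)"
    and smult_one [simp]: "x \<in> carrier M \<Longrightarrow> \<one> \<odot>\<^bsub>M\<^esub> x = x"

definition linear_maps ::
  "('r, 's) ring_scheme \<Rightarrow> ('r, 'm, 't) module_scheme \<Rightarrow> ('r, 'n, 'u) module_scheme \<Rightarrow> ('m \<Rightarrow> 'n) set"
  where "linear_maps R M N = {f \<in> carrier M \<rightarrow> carrier N.
    (\<forall>x\<in>carrier M. \<forall>y\<in>carrier M. f (x \<oplus>\<^bsub>M\<^esub> y) = f x \<oplus>\<^bsub>N\<^esub> f y) \<and>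
    (\<forall>r\<in>carrier R. \<forall>x\<in>carrier M. f (r \<odot>\<^bsub>M\<^esub> x) = r \<odot>\<^bsub>N\<^esub> f x)}"

definition Hom_group ::
  "('r, 's) ring_scheme \<Rightarrow> ('r, 'm, 't) module_scheme \<Rightarrow> ('r, 'n, 'u) module_scheme
    \<Rightarrow> ('m \<Rightarrow> 'n) monoid"
  where "Hom_group R M N = \<lparr>
    carrier = linear_maps R M N \<inter> extensional (carrier M),
    mult = (\<lambda>f g. \<lambda>x\<in>carrier M. f x \<oplus>\<^bsub>N\<^esub> g x),
    one = (\<lambda>x\<in>carrier M. \<zero>\<^bsub>N\<^esub>)\<rparr>"

definition free_module :: "('r, 's) ring_scheme \<Rightarrow> 'b set \<Rightarrow> ('r, 'b \<Rightarrow> 'r) module"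
  where "free_module R B = \<lparr>
    carrier = {f. (\<forall>b. f b \<in> carrier R) \<and> {b. f b \<noteq> \<zero>\<^bsub>R\<^esub>} \<subseteq> B \<and> finite {b. f b \<noteq> \<zero>\<^bsub>R\<^esub>}},
    mult = undefined, one = undefined,
    zero = (\<lambda>b. \<zero>\<^bsub>R\<^esub>),
    add = (\<lambda>f g b. f b \<oplus>\<^bsub>R\<^esub> g b),
    smult = (\<lambda>r f b. r \<otimes>\<^bsub>R\<^esub> f b)\<rparr>"

definition free_gen :: "('r, 's) ring_scheme \<Rightarrow> 'b \<Rightarrow> 'b \<Rightarrow> 'r"
  where "free_gen R b = (\<lambda>c. if c = b then \<one>\<^bsub>R\<^esub> else \<zero>\<^bsub>R\<^esub>)"

text \<open>The linear combination \<open>\<Sum>\<^sub>b f(b) \<phi>(b)\<close>, i.e. the \<open>R\<close>-linear extension of \<open>b \<mapsto> \<phi>(b)\<close>.\<close>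

definition lin_ext ::
  "('r, 's) ring_scheme \<Rightarrow> ('r, 'm, 't) module_scheme \<Rightarrow> ('b \<Rightarrow> 'm) \<Rightarrow> ('b \<Rightarrow> 'r) \<Rightarrow> 'm"
  where "lin_ext R M \<phi> f = (\<Oplus>\<^bsub>M\<^esub>b\<in>{b. f b \<noteq> \<zero>\<^bsub>R\<^esub>}. f b \<odot>\<^bsub>M\<^esub> \<phi> b)"

definition is_basis :: "('r, 's) ring_scheme \<Rightarrow> ('r, 'm, 't) module_scheme \<Rightarrow> 'm set \<Rightarrow> bool"
  where "is_basis R F B \<longleftrightarrow> B \<subseteq> carrier F \<and>
    (\<forall>x\<in>carrier F. \<exists>!c. c \<in> carrier (free_module R B) \<and> x = lin_ext R F (\<lambda>b. b) c)"

text \<open>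
  \<open>\<cdots> \<rightarrow> F 2 \<rightarrow> F 1 \<rightarrow> F 0 \<rightarrow> M \<rightarrow> 0\<close> is exact with all \<open>F n\<close> free; \<open>d n\<close> is the map from \<open>F (n + 1)\<close>
  to \<open>F n\<close>.
\<close>

definition free_resolution ::
  "('r, 's) ring_scheme \<Rightarrow> ('r, 'm, 't) module_scheme \<Rightarrow> (nat \<Rightarrow> ('r, 'f, 'u) module_scheme)
    \<Rightarrow> (nat \<Rightarrow> 'f \<Rightarrow> 'f) \<Rightarrow> ('f \<Rightarrow> 'm) \<Rightarrow> bool"
  where "free_resolution R M F d \<epsilon> \<longleftrightarrow>
    left_module R M \<and>
    (\<forall>n. left_module R (F n) \<and> (\<exists>B. is_basis R (F n) B)) \<and>
    \<epsilon> \<in> linear_maps R (F 0) M \<and>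
    (\<forall>n. d n \<in> linear_maps R (F (Suc n)) (F n)) \<and>
    \<epsilon> ` carrier (F 0) = carrier M \<and>
    d 0 ` carrier (F (Suc 0)) = a_kernel (F 0) M \<epsilon> \<and>
    (\<forall>n. d (Suc n) ` carrier (F (Suc (Suc n))) = a_kernel (F (Suc n)) (F n) (d n))"

lemma left_module_free_module:
  assumes "ring R"
  shows "left_module R (free_module R B)"
proof -
  interpret ring R by fact
  have fin: "finite {b. h (f b) (g b) \<noteq> \<zero>\<^bsub>R\<^esub>}" "{b. h (f b) (g b) \<noteq> \<zero>\<^bsub>R\<^esub>} \<subseteq> B"
    if "h \<zero>\<^bsub>R\<^esub> \<zero>\<^bsub>R\<^esub> = \<zero>\<^bsub>R\<^esub>" "finite {b. f b \<noteq> \<zero>\<^bsub>R\<^esub>}" "finite {b. g b \<noteq> \<zero>\<^bsub>R\<^esub>}"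
      "{b. f b \<noteq> \<zero>\<^bsub>R\<^esub>} \<subseteq> B" "{b. g b \<noteq> \<zero>\<^bsub>R\<^esub>} \<subseteq> B" for f g h
  proof -
    have sub: "{b. h (f b) (g b) \<noteq> \<zero>\<^bsub>R\<^esub>} \<subseteq> {b. f b \<noteq> \<zero>\<^bsub>R\<^esub>} \<union> {b. g b \<noteq> \<zero>\<^bsub>R\<^esub>}"
      using that(1) by auto
    show "finite {b. h (f b) (g b) \<noteq> \<zero>\<^bsub>R\<^esub>}" using sub that(2,3) by (meson finite_UnI finite_subset)
    show "{b. h (f b) (g b) \<noteq> \<zero>\<^bsub>R\<^esub>} \<subseteq> B" using sub that(4,5) by blast
  qed
  have "abelian_group (free_module R B)"
  proof (rule abelian_groupI)
    fix f g assume "f \<in> carrier (free_module R B)" "g \<in> carrier (free_module R B)"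
    then show "f \<oplus>\<^bsub>free_module R B\<^esub> g \<in> carrier (free_module R B)"
      using fin[of "add R" f g] by (auto simp: free_module_def)
  next
    fix f assume f: "f \<in> carrier (free_module R B)"
    have "(\<lambda>b. \<ominus>\<^bsub>R\<^esub> f b) \<in> carrier (free_module R B)"
      using f fin[of "\<lambda>x y. \<ominus>\<^bsub>R\<^esub> x" f f] by (auto simp: free_module_def)
    moreover have "(\<lambda>b. \<ominus>\<^bsub>R\<^esub> f b) \<oplus>\<^bsub>free_module R B\<^esub> f = \<zero>\<^bsub>free_module R B\<^esub>"
      using f by (auto simp: free_module_def l_neg)
    ultimately show "\<exists>g\<in>carrier (free_module R B). g \<oplus>\<^bsub>free_module R B\<^esub> f = \<zero>\<^bsub>free_module R B\<^esub>"
      by blast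
  qed (auto simp: free_module_def a_ac)
  then interpret M: abelian_group "free_module R B" .
  show ?thesis
  proof unfold_locales
    fix a f assume "a \<in> carrier R" "f \<in> carrier (free_module R B)"
    then show "a \<odot>\<^bsub>free_module R B\<^esub> f \<in> carrier (free_module R B)"
      using fin[of "\<lambda>x y. a \<otimes>\<^bsub>R\<^esub> x" f f] by (auto simp: free_module_def)
  qed (auto simp: free_module_def l_distr r_distr m_assoc)
qed

lemma free_gen_closed:
  assumes "ring R" "b \<in> B"
  shows "free_gen R b \<in> carrier (free_module R B)"
proof -
  interpret ring R by fact
  have "{c. free_gen R b c \<noteq> \<zero>\<^bsub>R\<^esub>} \<subseteq> {b}" by (auto simp: free_gen_def)
  then have "finite {c. free_gen R b c \<noteq> \<zero>\<^bsub>R\<^esub>}" "{c. free_gen R b c \<noteq> \<zero>\<^bsub>R\<^esub>} \<subseteq> B"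
    using assms(2) by (auto intro: finite_subset)
  moreover have "free_gen R b c \<in> carrier R" for c by (simp add: free_gen_def)
  ultimately show ?thesis by (simp add: free_module_def)
qed

context left_module
begin

lemma smult_l_null: "x \<in> carrier M \<Longrightarrow> \<zero> \<odot>\<^bsub>M\<^esub> x = \<zero>\<^bsub>M\<^esub>"
  using smult_l_distr[of \<zero> \<zero> x] M.add.r_cancel_one'[of "\<zero> \<odot>\<^bsub>M\<^esub> x" "\<zero> \<odot>\<^bsub>M\<^esub> x"] by simp

lemma smult_r_null: "a \<in> carrier R \<Longrightarrow> a \<odot>\<^bsub>M\<^esub> \<zero>\<^bsub>M\<^esub> = \<zero>\<^bsub>M\<^esub>"
  using smult_r_distr[of a "\<zero>\<^bsub>M\<^esub>" "\<zero>\<^bsub>M\<^esub>"]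
    M.add.r_cancel_one'[of "a \<odot>\<^bsub>M\<^esub> \<zero>\<^bsub>M\<^esub>" "a \<odot>\<^bsub>M\<^esub> \<zero>\<^bsub>M\<^esub>"] by simp

lemma finsum_smult:
  "finite K \<Longrightarrow> a \<in> carrier R \<Longrightarrow> f \<in> K \<rightarrow> carrier M
    \<Longrightarrow> a \<odot>\<^bsub>M\<^esub> (\<Oplus>\<^bsub>M\<^esub>k\<in>K. f k) = (\<Oplus>\<^bsub>M\<^esub>k\<in>K. a \<odot>\<^bsub>M\<^esub> f k)"
  by (induction K rule: finite_induct) (simp_all add: smult_r_null smult_r_distr Pi_def)

lemma lin_ext_superset:
  assumes "\<phi> \<in> B \<rightarrow> carrier M" "f \<in> carrier (free_module R B)"
    and "finite K" "{b. f b \<noteq> \<zero>} \<subseteq> K" "K \<subseteq> B"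
  shows "lin_ext R M \<phi> f = (\<Oplus>\<^bsub>M\<^esub>b\<in>K. f b \<odot>\<^bsub>M\<^esub> \<phi> b)"
  unfolding lin_ext_def
  by (rule M.add.finprod_mono_neutral_cong_left)
    (use assms in \<open>auto simp: free_module_def smult_l_null Pi_def\<close>)

lemma lin_ext_closed:
  assumes "\<phi> \<in> B \<rightarrow> carrier M" "f \<in> carrier (free_module R B)"
  shows "lin_ext R M \<phi> f \<in> carrier M"
  unfolding lin_ext_def
  by (rule M.finsum_closed) (use assms in \<open>auto simp: free_module_def\<close>)

lemma lin_ext_add:
  assumes "\<phi> \<in> B \<rightarrow> carrier M" "f \<in> carrier (free_module R B)" "g \<in> carrier (free_module R B)"
  shows "lin_ext R M \<phi> (f \<oplus>\<^bsub>free_module R B\<^esub> g) = lin_ext R M \<phi> f \<oplus>\<^bsub>M\<^esub> lin_ext R M \<phi> g"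
proof -
  define K where "K = {b. f b \<noteq> \<zero>} \<union> {b. g b \<noteq> \<zero>}"
  interpret F: left_module R "free_module R B" by (rule left_module_free_module) (rule R.ring_axioms)
  have K: "finite K" "K \<subseteq> B" using assms(2,3) by (auto simp: K_def free_module_def)
  have fg: "f \<oplus>\<^bsub>free_module R B\<^esub> g \<in> carrier (free_module R B)" using assms by simp
  have "{b. (f \<oplus>\<^bsub>free_module R B\<^esub> g) b \<noteq> \<zero>} \<subseteq> K" by (auto simp: K_def free_module_def)
  then have "lin_ext R M \<phi> (f \<oplus>\<^bsub>free_module R B\<^esub> g)
      = (\<Oplus>\<^bsub>M\<^esub>b\<in>K. (f \<oplus>\<^bsub>free_module R B\<^esub> g) b \<odot>\<^bsub>M\<^esub> \<phi> b)"
    by (intro lin_ext_superset[OF assms(1) fg] K)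
  also have "\<dots> = (\<Oplus>\<^bsub>M\<^esub>b\<in>K. f b \<odot>\<^bsub>M\<^esub> \<phi> b \<oplus>\<^bsub>M\<^esub> g b \<odot>\<^bsub>M\<^esub> \<phi> b)"
    by (rule M.finsum_cong') (use assms K in \<open>auto simp: free_module_def smult_l_distr Pi_def subset_iff\<close>)
  also have "\<dots> = (\<Oplus>\<^bsub>M\<^esub>b\<in>K. f b \<odot>\<^bsub>M\<^esub> \<phi> b) \<oplus>\<^bsub>M\<^esub> (\<Oplus>\<^bsub>M\<^esub>b\<in>K. g b \<odot>\<^bsub>M\<^esub> \<phi> b)"
    by (rule M.finsum_addf) (use assms K in \<open>auto simp: free_module_def Pi_def subset_iff\<close>)
  also have "(\<Oplus>\<^bsub>M\<^esub>b\<in>K. f b \<odot>\<^bsub>M\<^esub> \<phi> b) = lin_ext R M \<phi> f"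
    by (rule lin_ext_superset[OF assms(1,2) K(1) _ K(2), symmetric]) (auto simp: K_def)
  also have "(\<Oplus>\<^bsub>M\<^esub>b\<in>K. g b \<odot>\<^bsub>M\<^esub> \<phi> b) = lin_ext R M \<phi> g"
    by (rule lin_ext_superset[OF assms(1,3) K(1) _ K(2), symmetric]) (auto simp: K_def)
  finally show ?thesis .
qed

lemma lin_ext_smult:
  assumes "\<phi> \<in> B \<rightarrow> carrier M" "f \<in> carrier (free_module R B)" "r \<in> carrier R"
  shows "lin_ext R M \<phi> (r \<odot>\<^bsub>free_module R B\<^esub> f) = r \<odot>\<^bsub>M\<^esub> lin_ext R M \<phi> f"
proof -
  define K where "K = {b. f b \<noteq> \<zero>}"
  interpret F: left_module R "free_module R B" by (rule left_module_free_module) (rule R.ring_axioms)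
  have K: "finite K" "K \<subseteq> B" using assms(2) by (auto simp: K_def free_module_def)
  have rf: "r \<odot>\<^bsub>free_module R B\<^esub> f \<in> carrier (free_module R B)" using assms by simp
  have "{b. (r \<odot>\<^bsub>free_module R B\<^esub> f) b \<noteq> \<zero>} \<subseteq> K" using assms(3) by (auto simp: K_def free_module_def)
  then have "lin_ext R M \<phi> (r \<odot>\<^bsub>free_module R B\<^esub> f)
      = (\<Oplus>\<^bsub>M\<^esub>b\<in>K. (r \<odot>\<^bsub>free_module R B\<^esub> f) b \<odot>\<^bsub>M\<^esub> \<phi> b)"
    by (intro lin_ext_superset[OF assms(1) rf] K)
  also have "\<dots> = (\<Oplus>\<^bsub>M\<^esub>b\<in>K. r \<odot>\<^bsub>M\<^esub> (f b \<odot>\<^bsub>M\<^esub> \<phi> b))"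
    by (rule M.finsum_cong') (use assms K in \<open>auto simp: free_module_def smult_assoc1 Pi_def subset_iff\<close>)
  also have "\<dots> = r \<odot>\<^bsub>M\<^esub> (\<Oplus>\<^bsub>M\<^esub>b\<in>K. f b \<odot>\<^bsub>M\<^esub> \<phi> b)"
    by (rule finsum_smult[symmetric]) (use assms K in \<open>auto simp: free_module_def Pi_def subset_iff\<close>)
  finally show ?thesis by (simp add: K_def lin_ext_def)
qed

lemma lin_ext_linear:
  assumes "\<phi> \<in> B \<rightarrow> carrier M"
  shows "lin_ext R M \<phi> \<in> linear_maps R (free_module R B) M"
  using lin_ext_closed[OF assms] lin_ext_add[OF assms] lin_ext_smult[OF assms]
  by (auto simp: linear_maps_def)

lemma lin_ext_gen:
  assumes "\<phi> \<in> B \<rightarrow> carrier M" "b \<in> B"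
  shows "lin_ext R M \<phi> (free_gen R b) = \<phi> b"
proof -
  have "lin_ext R M \<phi> (free_gen R b) = (\<Oplus>\<^bsub>M\<^esub>c\<in>{b}. free_gen R b c \<odot>\<^bsub>M\<^esub> \<phi> c)"
    by (rule lin_ext_superset[OF assms(1) free_gen_closed[OF R.ring_axioms assms(2)]])
      (use assms(2) in \<open>auto simp: free_gen_def\<close>)
  also have "\<dots> = \<phi> b"
  proof -
    have "\<phi> b \<in> carrier M" using assms by auto
    then show ?thesis by (simp add: free_gen_def)
  qed
  finally show ?thesis .
qed

end

lemma free_module_basis:
  fixes R :: "('r, 's) ring_scheme" and B :: "'b set"
  assumes "ring R"
  shows "is_basis R (free_module R B) (free_gen R ` B)"
proof -
  interpret ring R by fact
  interpret F: left_module R "free_module R B" by (rule left_module_free_module) fact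
  let ?F = "free_module R B" and ?B = "free_gen R ` B"
  have gens: "?B \<subseteq> carrier ?F" using free_gen_closed[OF assms] by (rule image_subsetI)
  show ?thesis
  proof (cases "\<one>\<^bsub>R\<^esub> = \<zero>\<^bsub>R\<^esub>")
    case True
    then have z: "x = \<zero>\<^bsub>R\<^esub>" if "x \<in> carrier R" for x using that by (metis l_null l_one)
    have all0: "f = (\<lambda>_. \<zero>\<^bsub>R\<^esub>)" if "f \<in> carrier (free_module R C)" for f :: "'z \<Rightarrow> 'r" and C
      by (rule ext, rule z) (use that in \<open>auto simp: free_module_def\<close>)
    show ?thesis
      unfolding is_basis_def
    proof (intro conjI ballI gens ex1I)
      show zero: "(\<lambda>_. \<zero>\<^bsub>R\<^esub>) \<in> carrier (free_module R ?B)" by (simp add: free_module_def)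
      fix x assume x: "x \<in> carrier ?F"
      have "lin_ext R ?F (\<lambda>b. b) (\<lambda>_. \<zero>\<^bsub>R\<^esub>) \<in> carrier ?F"
        by (rule F.lin_ext_closed[OF _ zero]) (use gens in auto)
      then show "x = lin_ext R ?F (\<lambda>b. b) (\<lambda>_. \<zero>\<^bsub>R\<^esub>)" by (rule all0[OF x, THEN trans, OF all0[symmetric]])
    next
      fix x c assume "c \<in> carrier (free_module R ?B) \<and> x = lin_ext R ?F (\<lambda>b. b) c"
      then show "c = (\<lambda>_. \<zero>\<^bsub>R\<^esub>)" by (rule all0[OF conjunct1])
    qed
  next
    case False
    have inj: "free_gen R b = free_gen R c \<longleftrightarrow> b = c" for b c :: 'b
      using False by (metis free_gen_def)
    have val: "lin_ext R ?F (\<lambda>b. b) c b = c (free_gen R b)" if c: "c \<in> carrier (free_module R ?B)" for c b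
    proof -
      have ev: "(\<Oplus>\<^bsub>?F\<^esub>k\<in>K. f k) b = (\<Oplus>\<^bsub>R\<^esub>k\<in>K. f k b)"
        if "finite K" "f \<in> K \<rightarrow> carrier ?F" for K :: "('b \<Rightarrow> 'r) set" and f
        using that
      proof (induction K rule: finite_induct)
        case (insert k K)
        then have fK: "f \<in> K \<rightarrow> carrier ?F" "f k \<in> carrier ?F" by auto
        then have "(\<lambda>k. f k b) \<in> K \<rightarrow> carrier R" "f k b \<in> carrier R" by (auto simp: free_module_def)
        then have "(\<Oplus>\<^bsub>R\<^esub>k\<in>insert k K. f k b) = f k b \<oplus>\<^bsub>R\<^esub> (\<Oplus>\<^bsub>R\<^esub>k\<in>K. f k b)"
          using insert by (simp add: finsum_insert)
        moreover have "(\<Oplus>\<^bsub>?F\<^esub>k\<in>insert k K. f k) = f k \<oplus>\<^bsub>?F\<^esub> (\<Oplus>\<^bsub>?F\<^esub>k\<in>K. f k)"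
          using insert fK by (simp add: F.M.finsum_insert)
        moreover have "(f k \<oplus>\<^bsub>?F\<^esub> g) b = f k b \<oplus>\<^bsub>R\<^esub> g b" for g by (simp add: free_module_def)
        ultimately show ?case using insert fK by simp
      next
        case empty
        have "\<zero>\<^bsub>?F\<^esub> b = \<zero>\<^bsub>R\<^esub>" by (simp add: free_module_def)
        then show ?case by simp
      qed
      let ?K = "{k. c k \<noteq> \<zero>\<^bsub>R\<^esub>}"
      have K: "finite ?K" "?K \<subseteq> ?B" "\<And>k. c k \<in> carrier R" using c by (auto simp: free_module_def)
      have "lin_ext R ?F (\<lambda>b. b) c b = (\<Oplus>\<^bsub>R\<^esub>k\<in>?K. (c k \<odot>\<^bsub>?F\<^esub> k) b)"
        unfolding lin_ext_def
        by (rule ev[OF K(1)]) (intro funcsetI F.smult_closed K(3), use K(2) gens in blast)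
      also have "\<dots> = (\<Oplus>\<^bsub>R\<^esub>k\<in>?K. if free_gen R b = k then c k else \<zero>\<^bsub>R\<^esub>)"
      proof (rule finsum_cong')
        fix k assume "k \<in> ?K"
        then obtain d where "k = free_gen R d" using K(2) by auto
        then show "(c k \<odot>\<^bsub>?F\<^esub> k) b = (if free_gen R b = k then c k else \<zero>\<^bsub>R\<^esub>)"
          using K(3) by (auto simp: free_module_def inj) (auto simp: free_gen_def)
      qed (use K in auto)
      also have "\<dots> = c (free_gen R b)"
      proof (cases "free_gen R b \<in> ?K")
        case True
        then show ?thesis using add.finprod_singleton[of "free_gen R b" ?K c] K by simp
      next
        case False
        have "(\<Oplus>\<^bsub>R\<^esub>k\<in>?K. if free_gen R b = k then c k else \<zero>\<^bsub>R\<^esub>) = (\<Oplus>\<^bsub>R\<^esub>k\<in>?K. \<zero>\<^bsub>R\<^esub>)"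
          using False by (intro finsum_cong') auto
        then show ?thesis using False by (simp add: finsum_zero)
      qed
      finally show ?thesis .
    qed
    have "\<exists>!c. c \<in> carrier (free_module R ?B) \<and> x = lin_ext R ?F (\<lambda>b. b) c" if x: "x \<in> carrier ?F" for x
    proof
      define c where "c f = (if f \<in> ?B then x (inv_into B (free_gen R) f) else \<zero>\<^bsub>R\<^esub>)" for f
      have inv: "inv_into B (free_gen R) (free_gen R b) = b" if "b \<in> B" for b
        using that inj by (intro inv_into_f_f inj_onI) auto
      have supp: "{f. c f \<noteq> \<zero>\<^bsub>R\<^esub>} \<subseteq> free_gen R ` {b. x b \<noteq> \<zero>\<^bsub>R\<^esub>}"
        using inv by (auto simp: c_def split: if_splits)
      then have "finite {f. c f \<noteq> \<zero>\<^bsub>R\<^esub>}"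
        by (rule finite_surj[rotated]) (use x in \<open>simp add: free_module_def\<close>)
      then have c: "c \<in> carrier (free_module R ?B)"
        using x by (auto simp: free_module_def c_def)
      have "c (free_gen R b) = x b" for b
      proof (cases "b \<in> B")
        case True
        then show ?thesis using inv by (simp add: c_def)
      next
        case False
        then have "x b = \<zero>\<^bsub>R\<^esub>" using x by (auto simp: free_module_def)
        moreover have "free_gen R b \<notin> ?B" using False inj by auto
        ultimately show ?thesis by (simp add: c_def)
      qed
      then have "x = lin_ext R ?F (\<lambda>b. b) c" using val[OF c] by auto
      then show "c \<in> carrier (free_module R ?B) \<and> x = lin_ext R ?F (\<lambda>b. b) c" using c by blast
      fix d assume d: "d \<in> carrier (free_module R ?B) \<and> x = lin_ext R ?F (\<lambda>b. b) d"
      then have eq: "d (free_gen R b) = c (free_gen R b)" for b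
        using val[of d] val[OF c] \<open>x = lin_ext R ?F (\<lambda>b. b) c\<close> by metis
      show "d = c"
      proof
        fix f
        show "d f = c f"
        proof (cases "f \<in> ?B")
          case True
          then show ?thesis using eq by auto
        next
          case False
          then have "c f = \<zero>\<^bsub>R\<^esub>" "d f = \<zero>\<^bsub>R\<^esub>" using c d by (auto simp: free_module_def)
          then show ?thesis by simp
        qed
      qed
    qed
    then show ?thesis using gens by (simp add: is_basis_def)
  qed
qed


section \<open>Cohomology and Ext\<close>

text \<open>The \<open>n\<close>-th cohomology group of \<open>0 \<rightarrow> C 0 \<rightarrow> C 1 \<rightarrow> \<cdots>\<close> with \<open>d n\<close> from \<open>C n\<close> to \<open>C (n + 1)\<close>.\<close>

definition cohomology :: "(nat \<Rightarrow> 'c monoid) \<Rightarrow> (nat \<Rightarrow> 'c \<Rightarrow> 'c) \<Rightarrow> nat \<Rightarrow> 'c set monoid"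
  where "cohomology C d n =
    (C n)\<lparr>carrier := kernel (C n) (C (Suc n)) (d n)\<rparr> Mod
    (case n of 0 \<Rightarrow> {\<one>\<^bsub>C 0\<^esub>} | Suc m \<Rightarrow> d m ` carrier (C m))"

definition Hom_cohomology ::
  "('r, 's) ring_scheme \<Rightarrow> (nat \<Rightarrow> ('r, 'f, 'u) module_scheme) \<Rightarrow> (nat \<Rightarrow> 'f \<Rightarrow> 'f)
    \<Rightarrow> ('r, 'n, 't) module_scheme \<Rightarrow> nat \<Rightarrow> ('f \<Rightarrow> 'n) set monoid"
  where "Hom_cohomology R F d N =
    cohomology (\<lambda>n. Hom_group R (F n) N) (\<lambda>n f. \<lambda>x\<in>carrier (F (Suc n)). f (d n x))"

text \<open>
  To make \<open>Ext\<close> a function of its arguments we take the standard free resolution in which \<open>F 0\<close> is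
  free on the elements of \<open>M\<close> and each further \<open>F n\<close> is free on the elements of the preceding kernel.
  The type below is large enough to contain all the bases: \<open>Gen m\<close> is the generator for the element
  \<open>m\<close> of \<open>M\<close>, and \<open>Syz [(b\<^sub>1, r\<^sub>1), \<dots>]\<close> is a generator for the kernel element \<open>\<Sum> r\<^sub>i b\<^sub>i\<close>.
\<close>

datatype ('m, 'r) syz = Gen (gen_elem: 'm) | Syz (syz_list: "(('m, 'r) syz \<times> 'r) list")

definition coeffs_of :: "('r, 's) ring_scheme \<Rightarrow> ('b \<times> 'r) list \<Rightarrow> 'b \<Rightarrow> 'r"
  where "coeffs_of R l = (\<lambda>b. case map_of l b of None \<Rightarrow> \<zero>\<^bsub>R\<^esub> | Some r \<Rightarrow> r)"

fun syz_basis ::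
  "('r, 's) ring_scheme \<Rightarrow> ('r, 'm, 't) module_scheme \<Rightarrow> nat \<Rightarrow> ('m, 'r) syz set"
  where
    "syz_basis R M 0 = Gen ` carrier M"
  | "syz_basis R M (Suc 0) =
      {Syz l |l. set l \<subseteq> syz_basis R M 0 \<times> carrier R \<and>
        lin_ext R M gen_elem (coeffs_of R l) = \<zero>\<^bsub>M\<^esub>}"
  | "syz_basis R M (Suc (Suc n)) =
      {Syz l |l. set l \<subseteq> syz_basis R M (Suc n) \<times> carrier R \<and>
        lin_ext R (free_module R (syz_basis R M n)) (\<lambda>b. coeffs_of R (syz_list b)) (coeffs_of R l)
          = \<zero>\<^bsub>free_module R (syz_basis R M n)\<^esub>}"

definition syz_module ::
  "('r, 's) ring_scheme \<Rightarrow> ('r, 'm, 't) module_scheme \<Rightarrow> nat \<Rightarrow> ('r, ('m, 'r) syz \<Rightarrow> 'r) module"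
  where "syz_module R M n = free_module R (syz_basis R M n)"

definition syz_diff ::
  "('r, 's) ring_scheme \<Rightarrow> ('r, 'm, 't) module_scheme \<Rightarrow> nat
    \<Rightarrow> (('m, 'r) syz \<Rightarrow> 'r) \<Rightarrow> (('m, 'r) syz \<Rightarrow> 'r)"
  where "syz_diff R M n = lin_ext R (syz_module R M n) (\<lambda>b. coeffs_of R (syz_list b))"

definition syz_aug ::
  "('r, 's) ring_scheme \<Rightarrow> ('r, 'm, 't) module_scheme \<Rightarrow> (('m, 'r) syz \<Rightarrow> 'r) \<Rightarrow> 'm"
  where "syz_aug R M = lin_ext R M gen_elem"

definition Ext ::
  "('r, 's) ring_scheme \<Rightarrow> nat \<Rightarrow> ('r, 'm, 't) module_scheme \<Rightarrow> ('r, 'n, 'u) module_scheme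
    \<Rightarrow> ((('m, 'r) syz \<Rightarrow> 'r) \<Rightarrow> 'n) set monoid"
  where "Ext R n M N = Hom_cohomology R (syz_module R M) (syz_diff R M) N n"

lemma coeffs_of_closed:
  assumes "ring R" "set l \<subseteq> B \<times> carrier R"
  shows "coeffs_of R l \<in> carrier (free_module R B)"
proof -
  interpret ring R by fact
  have "{b. coeffs_of R l b \<noteq> \<zero>\<^bsub>R\<^esub>} \<subseteq> fst ` set l"
    by (force simp: coeffs_of_def split: option.splits dest: map_of_SomeD)
  moreover have "coeffs_of R l b \<in> carrier R" for b
    using assms(2) by (auto simp: coeffs_of_def split: option.splits dest: map_of_SomeD)
  moreover have "fst ` set l \<subseteq> B" using assms(2) by auto
  ultimately show ?thesis unfolding free_module_def
    by (auto intro: finite_subset[of _ "fst ` set l"])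
qed

lemma coeffs_of_surj:
  assumes "f \<in> carrier (free_module R B)"
  obtains l where "set l \<subseteq> B \<times> carrier R" "coeffs_of R l = f"
proof -
  have fin: "finite {b. f b \<noteq> \<zero>\<^bsub>R\<^esub>}" and sub: "{b. f b \<noteq> \<zero>\<^bsub>R\<^esub>} \<subseteq> B" and car: "\<And>b. f b \<in> carrier R"
    using assms by (auto simp: free_module_def)
  obtain bs where bs: "set bs = {b. f b \<noteq> \<zero>\<^bsub>R\<^esub>}" using finite_list[OF fin] by blast
  have "coeffs_of R (map (\<lambda>b. (b, f b)) bs) = f"
    using bs by (auto simp: coeffs_of_def map_of_map_restrict restrict_map_def fun_eq_iff)
  then show thesis using that[of "map (\<lambda>b. (b, f b)) bs"] bs sub car by auto
qed

theorem syz_free_resolution: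
  assumes "left_module R M"
  shows "free_resolution R M (syz_module R M) (syz_diff R M) (syz_aug R M)"
proof -
  interpret M: left_module R M by fact
  note ring = M.R.ring_axioms
  let ?F = "syz_module R M" and ?\<delta> = "\<lambda>b. coeffs_of R (syz_list b)"
  have F: "left_module R (?F n)" for n
    unfolding syz_module_def by (rule left_module_free_module[OF ring])
  have aug: "gen_elem \<in> syz_basis R M 0 \<rightarrow> carrier M" by auto
  have bd: "?\<delta> \<in> syz_basis R M (Suc n) \<rightarrow> carrier (?F n)" for n
    unfolding syz_module_def using coeffs_of_closed[OF ring] by (cases n) auto
  have lin_aug: "syz_aug R M \<in> linear_maps R (?F 0) M"
    unfolding syz_aug_def syz_module_def by (rule M.lin_ext_linear[OF aug])
  have lin: "syz_diff R M n \<in> linear_maps R (?F (Suc n)) (?F n)" for n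
    unfolding syz_diff_def using left_module.lin_ext_linear[OF F bd] by (simp add: syz_module_def)
  have gen: "syz_diff R M n (free_gen R b) = ?\<delta> b" if "b \<in> syz_basis R M (Suc n)" for n b
    unfolding syz_diff_def by (rule left_module.lin_ext_gen[OF F bd that])
  have surj: "syz_aug R M ` carrier (?F 0) = carrier M"
  proof
    show "syz_aug R M ` carrier (?F 0) \<subseteq> carrier M" using lin_aug by (auto simp: linear_maps_def)
    show "carrier M \<subseteq> syz_aug R M ` carrier (?F 0)"
    proof
      fix m assume "m \<in> carrier M"
      then have m: "Gen m \<in> syz_basis R M 0" by simp
      have "syz_aug R M (free_gen R (Gen m)) = m"
        unfolding syz_aug_def using M.lin_ext_gen[OF aug m] by simp
      then show "m \<in> syz_aug R M ` carrier (?F 0)"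
        using free_gen_closed[OF ring m] unfolding syz_module_def by (metis imageI)
    qed
  qed
  have exact: "syz_diff R M n ` carrier (?F (Suc n)) = {x \<in> carrier (?F n). h x = \<zero>\<^bsub>N\<^esub>}"
    if N: "left_module R N" and h: "h \<in> linear_maps R (?F n) N"
      and B: "syz_basis R M (Suc n)
        = {Syz l |l. set l \<subseteq> syz_basis R M n \<times> carrier R \<and> h (coeffs_of R l) = \<zero>\<^bsub>N\<^esub>}"
    for n and N :: "('a, 'z, 'w) module_scheme" and h
  proof
    interpret N: left_module R N by (rule N)
    interpret Fn: left_module R "?F n" by (rule F)
    interpret Fs: left_module R "?F (Suc n)" by (rule F)
    have h_closed: "h x \<in> carrier N" if "x \<in> carrier (?F n)" for x
      using h that by (auto simp: linear_maps_def)
    have h_add: "h (x \<oplus>\<^bsub>?F n\<^esub> y) = h x \<oplus>\<^bsub>N\<^esub> h y" if "x \<in> carrier (?F n)" "y \<in> carrier (?F n)" for x y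
      using h that by (auto simp: linear_maps_def)
    have h_smult: "h (r \<odot>\<^bsub>?F n\<^esub> x) = r \<odot>\<^bsub>N\<^esub> h x" if "r \<in> carrier R" "x \<in> carrier (?F n)" for x r
      using h that by (auto simp: linear_maps_def)
    have h_0: "h \<zero>\<^bsub>?F n\<^esub> = \<zero>\<^bsub>N\<^esub>"
      using h_smult[of "\<zero>\<^bsub>R\<^esub>" "\<zero>\<^bsub>?F n\<^esub>"] h_closed
      by (simp add: Fn.smult_l_null N.smult_l_null)
    have h_sum: "h (\<Oplus>\<^bsub>?F n\<^esub>k\<in>K. f k) = \<zero>\<^bsub>N\<^esub>"
      if "finite K" "\<And>k. k \<in> K \<Longrightarrow> f k \<in> carrier (?F n) \<and> h (f k) = \<zero>\<^bsub>N\<^esub>" for K and f :: "('z2, 'a) syz \<Rightarrow> _"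
      using that by (induction K rule: finite_induct) (simp_all add: h_0 h_add Pi_def)
    show "syz_diff R M n ` carrier (?F (Suc n)) \<subseteq> {x \<in> carrier (?F n). h x = \<zero>\<^bsub>N\<^esub>}"
    proof clarify
      fix x assume x: "x \<in> carrier (?F (Suc n))"
      then have x': "finite {b. x b \<noteq> \<zero>\<^bsub>R\<^esub>}" "{b. x b \<noteq> \<zero>\<^bsub>R\<^esub>} \<subseteq> syz_basis R M (Suc n)"
        "\<And>b. x b \<in> carrier R"
        by (auto simp: syz_module_def free_module_def)
      have "h (\<Oplus>\<^bsub>?F n\<^esub>b\<in>{b. x b \<noteq> \<zero>\<^bsub>R\<^esub>}. x b \<odot>\<^bsub>?F n\<^esub> ?\<delta> b) = \<zero>\<^bsub>N\<^esub>"
      proof (rule h_sum[OF x'(1)])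
        fix b assume "b \<in> {b. x b \<noteq> \<zero>\<^bsub>R\<^esub>}"
        then have b: "b \<in> syz_basis R M (Suc n)" using x'(2) by blast
        then have "h (?\<delta> b) = \<zero>\<^bsub>N\<^esub>" and "?\<delta> b \<in> carrier (?F n)"
          using bd[of n] by (auto simp: B)
        then show "x b \<odot>\<^bsub>?F n\<^esub> ?\<delta> b \<in> carrier (?F n) \<and> h (x b \<odot>\<^bsub>?F n\<^esub> ?\<delta> b) = \<zero>\<^bsub>N\<^esub>"
          using x'(3) by (simp add: h_smult N.smult_r_null)
      qed
      moreover have "syz_diff R M n x \<in> carrier (?F n)" using lin[of n] x by (auto simp: linear_maps_def)
      ultimately show "syz_diff R M n x \<in> carrier (?F n) \<and> h (syz_diff R M n x) = \<zero>\<^bsub>N\<^esub>"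
        by (simp add: syz_diff_def lin_ext_def)
    qed
    show "{x \<in> carrier (?F n). h x = \<zero>\<^bsub>N\<^esub>} \<subseteq> syz_diff R M n ` carrier (?F (Suc n))"
    proof clarify
      fix x assume x: "x \<in> carrier (?F n)" "h x = \<zero>\<^bsub>N\<^esub>"
      obtain l where l: "set l \<subseteq> syz_basis R M n \<times> carrier R" "coeffs_of R l = x"
        using coeffs_of_surj x(1) unfolding syz_module_def by metis
      then have b: "Syz l \<in> syz_basis R M (Suc n)" using x(2) by (auto simp: B)
      have "syz_diff R M n (free_gen R (Syz l)) = x" using gen[OF b] l(2) by simp
      then show "x \<in> syz_diff R M n ` carrier (?F (Suc n))"
        using free_gen_closed[OF ring b] unfolding syz_module_def by (metis imageI)
    qed
  qed
  show ?thesis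
    unfolding free_resolution_def a_kernel_def'
  proof (intro conjI allI)
    show "left_module R M" by fact
    show "left_module R (?F n)" for n by (rule F)
    show "\<exists>B. is_basis R (?F n) B" for n
      using free_module_basis[OF ring] unfolding syz_module_def by blast
    show "syz_diff R M 0 ` carrier (?F (Suc 0)) = {x \<in> carrier (?F 0). syz_aug R M x = \<zero>\<^bsub>M\<^esub>}"
      by (rule exact[OF assms lin_aug]) (simp only: syz_basis.simps syz_aug_def)
    show "syz_diff R M (Suc n) ` carrier (?F (Suc (Suc n)))
        = {x \<in> carrier (?F (Suc n)). syz_diff R M n x = \<zero>\<^bsub>?F n\<^esub>}" for n
      by (rule exact[OF F lin]) (simp only: syz_basis.simps syz_diff_def syz_module_def)
  qed (fact lin_aug lin surj)+
qed


section \<open>The ring of a product system and its cohomology\<close>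

text \<open>
  The semigroup \<open>P\<close> with identity is a type of class \<^class>\<open>monoid_mult\<close>, so \<open>e\<close> is \<open>1\<close>. An element
  \<open>\<Sum>\<^sub>p a\<^sub>p \<one>\<^sub>p\<close> of \<open>\<Oplus>\<^sub>p X\<^sub>p\<close> is the finitely supported function \<open>p \<mapsto> a\<^sub>p\<close>; in particular \<open>a \<one>\<^sub>p\<close> is
  \<^term>\<open>Poly_Mapping.single p a\<close>.
\<close>

definition skew_mult ::
  "('p::monoid_mult \<Rightarrow> 'g::ab_group_add \<Rightarrow> 'g)
    \<Rightarrow> ('p \<Rightarrow>\<^sub>0 'g cstar) \<Rightarrow> ('p \<Rightarrow>\<^sub>0 'g cstar) \<Rightarrow> ('p \<Rightarrow>\<^sub>0 'g cstar)"
  where "skew_mult \<theta> x y = (\<Sum>p\<in>Poly_Mapping.keys x. \<Sum>q\<in>Poly_Mapping.keys y.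
    Poly_Mapping.single (p * q) (Poly_Mapping.lookup x p * cstar_map (\<theta> p) (Poly_Mapping.lookup y q)))"

definition skew_ring :: "('p::monoid_mult \<Rightarrow> 'g::ab_group_add \<Rightarrow> 'g) \<Rightarrow> ('p \<Rightarrow>\<^sub>0 'g cstar) ring"
  where "skew_ring \<theta> = \<lparr>carrier = UNIV, mult = skew_mult \<theta>, one = Poly_Mapping.single 1 1,
    zero = 0, add = (+)\<rparr>"

definition Psi :: "('p \<Rightarrow>\<^sub>0 'g::ab_group_add cstar) \<Rightarrow> 'g cstar"
  where "Psi x = (\<Sum>p\<in>Poly_Mapping.keys x. Poly_Mapping.lookup x p)"

definition coeff_module ::
  "('p::monoid_mult \<Rightarrow> 'g::ab_group_add \<Rightarrow> 'g) \<Rightarrow> ('p \<Rightarrow>\<^sub>0 'g cstar, 'g cstar) module"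
  where "coeff_module \<theta> = \<lparr>carrier = UNIV, mult = undefined, one = undefined, zero = 0, add = (+),
    smult = (\<lambda>x a. Psi (skew_mult \<theta> x (Poly_Mapping.single 1 a)))\<rparr>"

definition H_Psi ::
  "('p::monoid_mult \<Rightarrow> 'g::ab_group_add \<Rightarrow> 'g) \<Rightarrow> nat
    \<Rightarrow> ((('g cstar, 'p \<Rightarrow>\<^sub>0 'g cstar) syz \<Rightarrow> ('p \<Rightarrow>\<^sub>0 'g cstar)) \<Rightarrow> 'g cstar) set monoid"
  where "H_Psi \<theta> n = Ext (skew_ring \<theta>) n (coeff_module \<theta>) (coeff_module \<theta>)"

locale endo_action =
  fixes \<theta> :: "'p::monoid_mult \<Rightarrow> 'g::ab_group_add \<Rightarrow> 'g"
  assumes action_hom: "\<theta> p (x + y) = \<theta> p x + \<theta> p y"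
    and action_one: "\<theta> 1 = id"
    and action_mult: "\<theta> (p * q) = \<theta> p \<circ> \<theta> q"
begin

sublocale endo: group_endo "\<theta> p" for p
  by unfold_locales (rule action_hom)

lemma cstar_map_action_one: "cstar_map (\<theta> 1) a = a"
proof -
  have "ga_map (\<theta> 1) x = x" for x
    using poly_mapping_decompose[of x] by (simp add: ga_map_def action_one)
  then show ?thesis
    by (cases a rule: cstar_cases) (simp add: endo.cstar_map_abs)
qed

lemma cstar_map_action_mult: "cstar_map (\<theta> (p * q)) a = cstar_map (\<theta> p) (cstar_map (\<theta> q) a)"
proof -
  have "ga_map (\<theta> (p * q)) x = ga_map (\<theta> p) (ga_map (\<theta> q) x)" for x
    unfolding ga_map_def[of "\<theta> q"] by (simp add: ga_map_sum action_mult ga_map_def[of "\<theta> p \<circ> \<theta> q"])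
  then show ?thesis
    by (cases a rule: cstar_cases) (simp add: endo.cstar_map_abs endo.ga_Cauchy_ga_map)
qed

lemma skew_mult_superset:
  assumes "finite K" "Poly_Mapping.keys x \<subseteq> K" "finite L" "Poly_Mapping.keys y \<subseteq> L"
  shows "skew_mult \<theta> x y = (\<Sum>p\<in>K. \<Sum>q\<in>L.
    Poly_Mapping.single (p * q) (Poly_Mapping.lookup x p * cstar_map (\<theta> p) (Poly_Mapping.lookup y q)))"
proof -
  have "skew_mult \<theta> x y = (\<Sum>p\<in>Poly_Mapping.keys x. \<Sum>q\<in>L.
      Poly_Mapping.single (p * q) (Poly_Mapping.lookup x p * cstar_map (\<theta> p) (Poly_Mapping.lookup y q)))"
    unfolding skew_mult_def using assms
    by (intro sum.cong sum.mono_neutral_left) (auto simp: in_keys_iff endo.cstar_map_0)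
  also have "\<dots> = (\<Sum>p\<in>K. \<Sum>q\<in>L.
      Poly_Mapping.single (p * q) (Poly_Mapping.lookup x p * cstar_map (\<theta> p) (Poly_Mapping.lookup y q)))"
    using assms by (intro sum.mono_neutral_left) (auto simp: in_keys_iff)
  finally show ?thesis .
qed

lemma skew_mult_single:
  "skew_mult \<theta> (Poly_Mapping.single p a) (Poly_Mapping.single q b)
    = Poly_Mapping.single (p * q) (a * cstar_map (\<theta> p) b)"
  by (subst skew_mult_superset[of "{p}" _ "{q}"]) auto

lemma skew_mult_add_left: "skew_mult \<theta> (x + y) z = skew_mult \<theta> x z + skew_mult \<theta> y z"
  using keys_add[of x y]
  by (simp add: skew_mult_superset[of "Poly_Mapping.keys x \<union> Poly_Mapping.keys y" _
        "Poly_Mapping.keys z"] lookup_add distrib_right single_add sum.distrib)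

lemma skew_mult_add_right: "skew_mult \<theta> z (x + y) = skew_mult \<theta> z x + skew_mult \<theta> z y"
  using keys_add[of x y]
  by (simp add: skew_mult_superset[of "Poly_Mapping.keys z" _
        "Poly_Mapping.keys x \<union> Poly_Mapping.keys y"] lookup_add distrib_left endo.cstar_map_add
      single_add sum.distrib)

lemma skew_mult_0_left: "skew_mult \<theta> 0 z = 0"
  and skew_mult_0_right: "skew_mult \<theta> z 0 = 0"
  by (simp_all add: skew_mult_def)

lemma poly_mapping_additive_induct:
  assumes "Q 0" "\<And>x y. Q x \<Longrightarrow> Q y \<Longrightarrow> Q (x + y)" "\<And>p a. Q (Poly_Mapping.single p a)"
  shows "Q (x :: 'p \<Rightarrow>\<^sub>0 'g cstar)"
proof -
  have "Q (\<Sum>p\<in>K. Poly_Mapping.single p (f p))" for K f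
    by (induction K rule: infinite_finite_induct) (auto intro: assms)
  from this[of "Poly_Mapping.lookup x" "Poly_Mapping.keys x"] show ?thesis
    by (simp add: poly_mapping_decompose)
qed

lemma skew_mult_assoc: "skew_mult \<theta> (skew_mult \<theta> x y) z = skew_mult \<theta> x (skew_mult \<theta> y z)"
proof (induction x rule: poly_mapping_additive_induct)
  case (3 p a)
  show ?case
  proof (induction y rule: poly_mapping_additive_induct)
    case (3 q b)
    show ?case
    proof (induction z rule: poly_mapping_additive_induct)
      case (3 r c)
      show ?case
        by (simp add: skew_mult_single endo.cstar_map_mult cstar_map_action_mult mult.assoc)
    qed (simp_all add: skew_mult_0_right skew_mult_add_right)
  qed (simp_all add: skew_mult_0_right skew_mult_0_left skew_mult_add_left skew_mult_add_right)
qed (simp_all add: skew_mult_0_left skew_mult_add_left)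

lemma skew_mult_one_left: "skew_mult \<theta> (Poly_Mapping.single 1 1) x = x"
  by (induction x rule: poly_mapping_additive_induct)
    (simp_all add: skew_mult_0_right skew_mult_add_right skew_mult_single cstar_map_action_one)

lemma skew_mult_one_right: "skew_mult \<theta> x (Poly_Mapping.single 1 1) = x"
  by (induction x rule: poly_mapping_additive_induct)
    (simp_all add: skew_mult_0_left skew_mult_add_left skew_mult_single endo.cstar_map_1)

lemma ring_skew_ring: "ring (skew_ring \<theta>)"
proof (rule ringI)
  show "abelian_group (skew_ring \<theta>)"
    by (rule abelian_groupI) (auto simp: skew_ring_def algebra_simps intro: exI[of _ "- _"])
  show "Group.monoid (skew_ring \<theta>)"
    by (rule monoidI)
      (simp_all add: skew_ring_def skew_mult_assoc skew_mult_one_left skew_mult_one_right)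
qed (simp_all add: skew_ring_def skew_mult_add_left skew_mult_add_right)

lemma Psi_superset:
  "finite K \<Longrightarrow> Poly_Mapping.keys x \<subseteq> K \<Longrightarrow> Psi x = (\<Sum>p\<in>K. Poly_Mapping.lookup x p)"
  unfolding Psi_def by (intro sum.mono_neutral_left) (auto simp: in_keys_iff)

lemma Psi_add: "Psi (x + y) = Psi x + Psi y"
  using keys_add[of x y]
  by (simp add: Psi_superset[of "Poly_Mapping.keys x \<union> Poly_Mapping.keys y"] lookup_add sum.distrib)

lemma Psi_single: "Psi (Poly_Mapping.single p a) = a"
  by (simp add: Psi_superset[of "{p}"])

lemma coeff_module_action:
  "Poly_Mapping.single p a \<odot>\<^bsub>coeff_module \<theta>\<^esub> b = a * cstar_map (\<theta> p) b"
  by (simp add: coeff_module_def skew_mult_single Psi_single)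

lemma Psi_skew_mult: "Psi (skew_mult \<theta> x (Poly_Mapping.single 1 (Psi y))) = Psi (skew_mult \<theta> x y)"
proof (induction x rule: poly_mapping_additive_induct)
  case (3 p a)
  show ?case
  proof (induction y rule: poly_mapping_additive_induct)
    case 1
    then show ?case by (simp add: Psi_def skew_mult_0_right)
  qed (simp_all add: Psi_add single_add skew_mult_add_right skew_mult_single Psi_single)
qed (simp_all add: skew_mult_0_left skew_mult_add_left Psi_add)

lemma left_module_coeff_module: "left_module (skew_ring \<theta>) (coeff_module \<theta>)"
proof -
  interpret ring "skew_ring \<theta>" by (rule ring_skew_ring)
  have "abelian_group (coeff_module \<theta>)"
    by (rule abelian_groupI) (auto simp: coeff_module_def algebra_simps intro: exI[of _ "- _"])
  then interpret M: abelian_group "coeff_module \<theta>" .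
  show ?thesis
    by unfold_locales
      (simp_all add: skew_ring_def coeff_module_def skew_mult_add_left skew_mult_add_right Psi_add
        single_add skew_mult_assoc skew_mult_one_left Psi_single Psi_skew_mult)
qed

end

text \<open>
  The tuple \<open>(p\<^sub>1, \<dots>, p\<^sub>n)\<close> is a list of length \<open>n\<close>, so that \<open>p\<^sub>i\<close> is \<^term>\<open>ps ! (i - 1)\<close> and \<open>P\<^sup>0\<close> has the
  empty list as its only element. The next function replaces the two entries \<open>p\<^sub>i, p\<^sub>i\<^sub>+\<^sub>1\<close> by their
  product, for \<open>1 \<le> i < n\<close>.
\<close>

definition contract :: "nat \<Rightarrow> 'p::monoid_mult list \<Rightarrow> 'p list"
  where "contract i ps = take (i - 1) ps @ [ps ! (i - 1) * ps ! i] @ drop (i + 1) ps"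

definition bar ::
  "('p::monoid_mult \<Rightarrow> 'g::ab_group_add \<Rightarrow> 'g) \<Rightarrow> nat
    \<Rightarrow> ('p \<Rightarrow>\<^sub>0 'g cstar, 'p list \<Rightarrow> ('p \<Rightarrow>\<^sub>0 'g cstar)) module"
  where "bar \<theta> n = free_module (skew_ring \<theta>) {ps. length ps = n}"

text \<open>
  The value of the differential at a basis element \<open>[p\<^sub>1, \<dots>, p\<^sub>n]\<close> with \<open>n \<ge> 1\<close>. For \<open>n = 1\<close> the sum is
  empty and the value is \<open>\<one>\<^sub>p[] - []\<close>.
\<close>

definition bar_boundary ::
  "('p::monoid_mult \<Rightarrow> 'g::ab_group_add \<Rightarrow> 'g) \<Rightarrow> 'p list \<Rightarrow> 'p list \<Rightarrow> ('p \<Rightarrow>\<^sub>0 'g cstar)"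
  where "bar_boundary \<theta> ps =
    (let n = length ps; F = bar \<theta> (n - 1); gen = free_gen (skew_ring \<theta>);
         sgn = (\<lambda>i. Poly_Mapping.single 1 ((- 1) ^ i))
     in Poly_Mapping.single (hd ps) 1 \<odot>\<^bsub>F\<^esub> gen (tl ps)
        \<oplus>\<^bsub>F\<^esub> (\<Oplus>\<^bsub>F\<^esub>i\<in>{1..<n}. sgn i \<odot>\<^bsub>F\<^esub> gen (contract i ps))
        \<oplus>\<^bsub>F\<^esub> sgn n \<odot>\<^bsub>F\<^esub> gen (butlast ps))"

definition bar_diff ::
  "('p::monoid_mult \<Rightarrow> 'g::ab_group_add \<Rightarrow> 'g) \<Rightarrow> nat
    \<Rightarrow> ('p list \<Rightarrow> ('p \<Rightarrow>\<^sub>0 'g cstar)) \<Rightarrow> ('p list \<Rightarrow> ('p \<Rightarrow>\<^sub>0 'g cstar))"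
  where "bar_diff \<theta> n = lin_ext (skew_ring \<theta>) (bar \<theta> n) (bar_boundary \<theta>)"

definition bar_aug ::
  "('p::monoid_mult \<Rightarrow> 'g::ab_group_add \<Rightarrow> 'g) \<Rightarrow> ('p list \<Rightarrow> ('p \<Rightarrow>\<^sub>0 'g cstar)) \<Rightarrow> 'g cstar"
  where "bar_aug \<theta> = lin_ext (skew_ring \<theta>) (coeff_module \<theta>) (\<lambda>_. 1)"

definition cochains :: "nat \<Rightarrow> ('p list \<Rightarrow> 'g::ab_group_add cstar) monoid"
  where "cochains n = \<lparr>
    carrier = extensional {ps. length ps = n},
    mult = (\<lambda>\<xi> \<eta>. \<lambda>ps\<in>{ps. length ps = n}. \<xi> ps + \<eta> ps),
    one = (\<lambda>ps\<in>{ps. length ps = n}. 0)\<rparr>"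

text \<open>For \<open>n = 0\<close> the cochain \<open>\<xi>\<close> is the element \<open>a = \<xi> []\<close>, and the formula reads \<open>\<theta>\<^sub>p(a) - a\<close>.\<close>

definition coboundary ::
  "('p::monoid_mult \<Rightarrow> 'g::ab_group_add \<Rightarrow> 'g) \<Rightarrow> nat
    \<Rightarrow> ('p list \<Rightarrow> 'g cstar) \<Rightarrow> ('p list \<Rightarrow> 'g cstar)"
  where "coboundary \<theta> n \<xi> = (\<lambda>ps\<in>{ps. length ps = Suc n}.
    cstar_map (\<theta> (hd ps)) (\<xi> (tl ps))
    + (\<Sum>i = 1..n. (- 1) ^ i * \<xi> (contract i ps))
    + (- 1) ^ (n + 1) * \<xi> (butlast ps))"

context endo_action
begin

lemma left_module_bar: "left_module (skew_ring \<theta>) (bar \<theta> n)"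
  unfolding bar_def by (rule left_module_free_module[OF ring_skew_ring])

lemma bar_gen_closed: "length ps = n \<Longrightarrow> free_gen (skew_ring \<theta>) ps \<in> carrier (bar \<theta> n)"
  unfolding bar_def by (rule free_gen_closed[OF ring_skew_ring]) simp

lemma length_contract: "1 \<le> i \<Longrightarrow> i < length ps \<Longrightarrow> length (contract i ps) = length ps - 1"
  by (simp add: contract_def)

lemma bar_boundary_closed: "ps \<noteq> [] \<Longrightarrow> bar_boundary \<theta> ps \<in> carrier (bar \<theta> (length ps - 1))"
proof -
  assume ps: "ps \<noteq> []"
  interpret F: left_module "skew_ring \<theta>" "bar \<theta> (length ps - 1)" by (rule left_module_bar)
  have c: "x \<in> carrier (skew_ring \<theta>)" for x by (simp add: skew_ring_def)
  have "(\<Oplus>\<^bsub>bar \<theta> (length ps - 1)\<^esub>i\<in>{1..<length ps}. Poly_Mapping.single 1 ((- 1) ^ i)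
      \<odot>\<^bsub>bar \<theta> (length ps - 1)\<^esub> free_gen (skew_ring \<theta>) (contract i ps))
      \<in> carrier (bar \<theta> (length ps - 1))"
    by (rule F.M.finsum_closed) (intro funcsetI F.smult_closed c bar_gen_closed, simp add: length_contract)
  then show ?thesis
    unfolding bar_boundary_def Let_def
    by (intro F.M.add.m_closed F.smult_closed c bar_gen_closed) simp_all
qed

lemma bar_diff_gen:
  assumes "length ps = Suc n"
  shows "bar_diff \<theta> n (free_gen (skew_ring \<theta>) ps) = bar_boundary \<theta> ps"
  unfolding bar_diff_def
proof (rule left_module.lin_ext_gen[OF left_module_bar])
  show "bar_boundary \<theta> \<in> {ps. length ps = Suc n} \<rightarrow> carrier (bar \<theta> n)"
  proof
    fix qs :: "'p list" assume "qs \<in> {ps. length ps = Suc n}"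
    then show "bar_boundary \<theta> qs \<in> carrier (bar \<theta> n)" using bar_boundary_closed[of qs] by fastforce
  qed
qed (simp add: assms)

lemma bar_diff_0_gen:
  "bar_diff \<theta> 0 (free_gen (skew_ring \<theta>) [p])
    = (Poly_Mapping.single p 1 - Poly_Mapping.single 1 1) \<odot>\<^bsub>bar \<theta> 0\<^esub> free_gen (skew_ring \<theta>) []"
proof -
  interpret F: left_module "skew_ring \<theta>" "bar \<theta> 0" by (rule left_module_bar)
  have c: "x \<in> carrier (skew_ring \<theta>)" for x by (simp add: skew_ring_def)
  note gen = bar_gen_closed[of "[]" 0, simplified]
  have "Poly_Mapping.single p 1 \<odot>\<^bsub>bar \<theta> 0\<^esub> free_gen (skew_ring \<theta>) []
      \<oplus>\<^bsub>bar \<theta> 0\<^esub> Poly_Mapping.single 1 (- 1) \<odot>\<^bsub>bar \<theta> 0\<^esub> free_gen (skew_ring \<theta>) []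
      = (Poly_Mapping.single p 1 - Poly_Mapping.single 1 1) \<odot>\<^bsub>bar \<theta> 0\<^esub> free_gen (skew_ring \<theta>) []"
    by (subst F.smult_l_distr[OF c c gen, symmetric]) (simp add: skew_ring_def single_uminus)
  then show ?thesis
    by (simp add: bar_diff_gen bar_boundary_def gen c)
qed

lemma bar_aug_gen: "bar_aug \<theta> (free_gen (skew_ring \<theta>) []) = 1"
  unfolding bar_aug_def
  by (rule left_module.lin_ext_gen[OF left_module_coeff_module, of _ "{[]}"])
    (simp_all add: coeff_module_def)

end

end

theory Submission
  imports Defs
begin

text \<open>
  As a complex of left \<open>A\<close>-modules the augmented bar complex is contractible: the \<open>A\<close>-linear map
  \<open>a \<one>\<^sub>p [p\<^sub>1, \<dots>, p\<^sub>n] \<mapsto> a [p, p\<^sub>1, \<dots>, p\<^sub>n]\<close> is a contracting homotopy, and since its image contains all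
  generators it also forces \<open>\<partial>\<partial> = 0\<close>. Any two free resolutions are homotopy equivalent, so \<open>Ext\<close>, defined
  by the standard resolution, may be computed from the bar complex; an \<open>\<RR>\<close>-linear map from the free
  module on \<open>P\<^sup>n\<close> to \<open>\<MM>\<close> is a function on \<open>P\<^sup>n\<close>, and precomposition with \<open>\<partial>\<close> becomes the coboundary.
\<close>

section \<open>Linear maps and free resolutions\<close>

text \<open>The contraction is the classical one for the bar resolution of a monoid: the ring is
  free as a left A-module on the elements \<open>\<one>\<^sub>p\<close>, just as a monoid ring is
  free over its scalars. It does not commute with left multiplication by
  \<open>\<one>\<^sub>q\<close>, which moves \<open>\<one>\<^sub>p\<close> to another fibre, whereas
  the contraction turns p into an entry of the tuple. Hence two kinds of argument alternate.
  Identities that involve the contraction are checked on the additive generators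
  \<open>a \<one>\<^sub>p [p\<^sub>1, \<dots>, p\<^sub>n]\<close> and rest on its additivity;
  identities between module homomorphisms, such as \<partial>\<partial> = 0, are checked on the
  basis. The standard resolution and the bar resolution have bases in unrelated types, so the
  comparison is developed for arbitrary free resolutions and draws on freeness through the lifting
  property alone.\<close>

lemma linear_closed: "f \<in> linear_maps R M N \<Longrightarrow> x \<in> carrier M \<Longrightarrow> f x \<in> carrier N"
  and linear_add: "f \<in> linear_maps R M N \<Longrightarrow> x \<in> carrier M \<Longrightarrow> y \<in> carrier M
    \<Longrightarrow> f (x \<oplus>\<^bsub>M\<^esub> y) = f x \<oplus>\<^bsub>N\<^esub> f y"
  and linear_smult: "f \<in> linear_maps R M N \<Longrightarrow> r \<in> carrier R \<Longrightarrow> x \<in> carrier M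
    \<Longrightarrow> f (r \<odot>\<^bsub>M\<^esub> x) = r \<odot>\<^bsub>N\<^esub> f x"
  by (auto simp: linear_maps_def)

lemma linear_mapsI:
  assumes "\<And>x. x \<in> carrier M \<Longrightarrow> f x \<in> carrier N"
    and "\<And>x y. x \<in> carrier M \<Longrightarrow> y \<in> carrier M \<Longrightarrow> f (x \<oplus>\<^bsub>M\<^esub> y) = f x \<oplus>\<^bsub>N\<^esub> f y"
    and "\<And>r x. r \<in> carrier R \<Longrightarrow> x \<in> carrier M \<Longrightarrow> f (r \<odot>\<^bsub>M\<^esub> x) = r \<odot>\<^bsub>N\<^esub> f x"
  shows "f \<in> linear_maps R M N"
  using assms by (auto simp: linear_maps_def)

lemma linear_comp:
  "f \<in> linear_maps R M N \<Longrightarrow> g \<in> linear_maps R N P \<Longrightarrow> (\<lambda>x. g (f x)) \<in> linear_maps R M P"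
  by (auto simp: linear_maps_def Pi_iff)

lemma linear_id: "(\<lambda>x. x) \<in> linear_maps R M M"
  by (auto simp: linear_maps_def)

lemma linear_abelian_group_hom:
  assumes "left_module R M" "left_module R N" "f \<in> linear_maps R M N"
  shows "abelian_group_hom M N f"
proof -
  interpret M: left_module R M by fact
  interpret N: left_module R N by fact
  have "f \<in> hom (add_monoid M) (add_monoid N)"
    using assms(3) by (auto simp: hom_def linear_maps_def)
  then show ?thesis
    by (intro abelian_group_homI group_hom.intro group_hom_axioms.intro M.M.a_group N.M.a_group
        M.M.abelian_group_axioms N.M.abelian_group_axioms)
qed

lemma (in abelian_group_hom) hom_a_minus:
  "x \<in> carrier G \<Longrightarrow> y \<in> carrier G \<Longrightarrow> h (x \<ominus>\<^bsub>G\<^esub> y) = h x \<ominus>\<^bsub>H\<^esub> h y"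
  by (simp add: a_minus_def)

lemma (in abelian_group_hom) hom_finsum:
  "f \<in> K \<rightarrow> carrier G \<Longrightarrow> h (\<Oplus>\<^bsub>G\<^esub>k\<in>K. f k) = (\<Oplus>\<^bsub>H\<^esub>k\<in>K. h (f k))"
  by (induction K rule: infinite_finite_induct) (auto simp: Pi_def)

context left_module
begin

lemma smult_a_inv: "r \<in> carrier R \<Longrightarrow> x \<in> carrier M \<Longrightarrow> r \<odot>\<^bsub>M\<^esub> (\<ominus>\<^bsub>M\<^esub> x) = \<ominus>\<^bsub>M\<^esub> (r \<odot>\<^bsub>M\<^esub> x)"
  using smult_r_distr[of r x "\<ominus>\<^bsub>M\<^esub> x"]
  by (metis M.a_inv_closed M.minus_unique M.r_neg M.a_comm smult_closed smult_r_null)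

lemma linear_plus:
  assumes "f \<in> linear_maps R L M" "g \<in> linear_maps R L M"
  shows "(\<lambda>x. f x \<oplus>\<^bsub>M\<^esub> g x) \<in> linear_maps R L M"
  by (rule linear_mapsI)
    (simp_all add: assms[THEN linear_closed] assms[THEN linear_add] assms[THEN linear_smult]
      smult_r_distr M.a_ac)

lemma linear_a_inv:
  assumes "f \<in> linear_maps R L M"
  shows "(\<lambda>x. \<ominus>\<^bsub>M\<^esub> f x) \<in> linear_maps R L M"
  by (rule linear_mapsI)
    (simp_all add: assms[THEN linear_closed] assms[THEN linear_add] assms[THEN linear_smult]
      smult_a_inv M.minus_add)

lemma linear_minus:
  "f \<in> linear_maps R L M \<Longrightarrow> g \<in> linear_maps R L M \<Longrightarrow> (\<lambda>x. f x \<ominus>\<^bsub>M\<^esub> g x) \<in> linear_maps R L M"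
  unfolding a_minus_def by (intro linear_plus linear_a_inv)

lemma linear_zero: "(\<lambda>x. \<zero>\<^bsub>M\<^esub>) \<in> linear_maps R L M"
  by (rule linear_mapsI) (simp_all add: smult_r_null)

end

section \<open>Homomorphisms out of a module with an abstract basis\<close>

lemma linear_lin_ext:
  assumes M: "left_module R M" and N: "left_module R N" and h: "h \<in> linear_maps R M N"
    and \<phi>: "\<phi> \<in> B \<rightarrow> carrier M" and c: "c \<in> carrier (free_module R B)"
  shows "h (lin_ext R M \<phi> c) = lin_ext R N (\<lambda>b. h (\<phi> b)) c"
proof -
  interpret M: left_module R M by fact
  interpret N: left_module R N by fact
  interpret h: abelian_group_hom M N h by (rule linear_abelian_group_hom) fact+
  have c': "c b \<in> carrier R" "c b \<noteq> \<zero>\<^bsub>R\<^esub> \<Longrightarrow> b \<in> B" for b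
    using c by (auto simp: free_module_def)
  have \<phi>': "b \<in> B \<Longrightarrow> \<phi> b \<in> carrier M" for b using \<phi> by auto
  have "h (lin_ext R M \<phi> c) = (\<Oplus>\<^bsub>N\<^esub>b\<in>{b. c b \<noteq> \<zero>\<^bsub>R\<^esub>}. h (c b \<odot>\<^bsub>M\<^esub> \<phi> b))"
    unfolding lin_ext_def by (subst h.hom_finsum) (auto simp: c' \<phi>')
  also have "\<dots> = lin_ext R N (\<lambda>b. h (\<phi> b)) c"
    unfolding lin_ext_def
    by (rule N.M.finsum_cong') (auto simp: c' \<phi>' linear_smult[OF h] linear_closed[OF h])
  finally show ?thesis .
qed

lemma linear_eq_on_basis:
  assumes "left_module R F" "left_module R P" and B: "is_basis R F B"
    and h: "h \<in> linear_maps R F P" and k: "k \<in> linear_maps R F P"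
    and eq: "\<And>b. b \<in> B \<Longrightarrow> h b = k b" and x: "x \<in> carrier F"
  shows "h x = k x"
proof -
  interpret P: left_module R P by fact
  obtain c where c: "c \<in> carrier (free_module R B)" "x = lin_ext R F (\<lambda>b. b) c"
    using B x unfolding is_basis_def by blast
  have BF: "(\<lambda>b. b) \<in> B \<rightarrow> carrier F" using B unfolding is_basis_def by auto
  have "lin_ext R P h c = lin_ext R P k c"
    unfolding lin_ext_def
    by (rule P.M.finsum_cong')
      (use c eq BF in \<open>auto simp: free_module_def subset_iff Pi_iff linear_closed[OF k]\<close>)
  then show ?thesis
    unfolding c(2) using linear_lin_ext[OF assms(1,2) h BF c(1)] linear_lin_ext[OF assms(1,2) k BF c(1)]
    by simp
qed

text \<open>Coordinates with respect to an abstract basis are unique and therefore depend linearly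
  on the element; following them by \<open>lin_ext\<close> reduces the universal property to that of
  \<open>free_module\<close>.\<close>

lemma is_basis_extend:
  assumes "left_module R F" "left_module R P" and B: "is_basis R F B" and g: "g \<in> B \<rightarrow> carrier P"
  obtains k where "k \<in> linear_maps R F P" "\<And>b. b \<in> B \<Longrightarrow> k b = g b"
proof -
  interpret F: left_module R F by fact
  interpret P: left_module R P by fact
  let ?FB = "free_module R B"
  interpret FB: left_module R ?FB by (rule left_module_free_module) (rule F.R.ring_axioms)
  have BF: "(\<lambda>b. b) \<in> B \<rightarrow> carrier F" using B unfolding is_basis_def by auto
  have un: "\<exists>!c. c \<in> carrier ?FB \<and> x = lin_ext R F (\<lambda>b. b) c" if "x \<in> carrier F" for x
    using B that unfolding is_basis_def by blast
  define c where "c x = (THE c. c \<in> carrier ?FB \<and> x = lin_ext R F (\<lambda>b. b) c)" for x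
  have c: "c x \<in> carrier ?FB" "lin_ext R F (\<lambda>b. b) (c x) = x" if "x \<in> carrier F" for x
    using theI'[OF un[OF that]] unfolding c_def by auto
  have c_eq: "c x = e" if "x \<in> carrier F" "e \<in> carrier ?FB" "lin_ext R F (\<lambda>b. b) e = x" for x e
    unfolding c_def by (rule the1_equality[OF un[OF that(1)]]) (use that in simp)
  have "c \<in> linear_maps R F ?FB"
  proof (rule linear_mapsI)
    show "c x \<in> carrier ?FB" if "x \<in> carrier F" for x using c that by blast
    show "c (x \<oplus>\<^bsub>F\<^esub> y) = c x \<oplus>\<^bsub>?FB\<^esub> c y" if "x \<in> carrier F" "y \<in> carrier F" for x y
      using that by (intro c_eq) (simp_all add: F.lin_ext_add[OF BF] c)
    show "c (r \<odot>\<^bsub>F\<^esub> x) = r \<odot>\<^bsub>?FB\<^esub> c x" if "r \<in> carrier R" "x \<in> carrier F" for r x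
      using that by (intro c_eq) (simp_all add: F.lin_ext_smult[OF BF] c)
  qed
  then have "(\<lambda>x. lin_ext R P g (c x)) \<in> linear_maps R F P"
    by (rule linear_comp) (rule P.lin_ext_linear[OF g])
  moreover have "lin_ext R P g (c b) = g b" if "b \<in> B" for b
  proof -
    have "c b = free_gen R b"
      by (rule c_eq[OF _ free_gen_closed[OF F.R.ring_axioms that] F.lin_ext_gen[OF BF that]])
        (use BF that in auto)
    then show ?thesis by (simp add: P.lin_ext_gen[OF g that])
  qed
  ultimately show thesis by (rule that)
qed

text \<open>Projectivity of free modules: choose preimages of the values on the basis and extend.
  The hypothesis asks that the values of \<open>h\<close> lie in the image of \<open>g\<close>, not
  that \<open>g\<close> be surjective, so that exactness can supply it when \<open>g\<close> is a
  differential.\<close>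

lemma linear_lift:
  assumes "left_module R F" "left_module R P" "left_module R Q" and B: "is_basis R F B"
    and h: "h \<in> linear_maps R F Q" and g: "g \<in> linear_maps R P Q"
    and sub: "\<And>x. x \<in> carrier F \<Longrightarrow> h x \<in> g ` carrier P"
  shows "\<exists>k\<in>linear_maps R F P. \<forall>x\<in>carrier F. g (k x) = h x"
proof -
  define u where "u b = (SOME y. y \<in> carrier P \<and> g y = h b)" for b
  have BF: "B \<subseteq> carrier F" using B unfolding is_basis_def by auto
  have u: "u b \<in> carrier P \<and> g (u b) = h b" if "b \<in> B" for b
    unfolding u_def by (rule someI_ex) (use sub[OF subsetD[OF BF that]] in \<open>auto simp: image_iff\<close>)
  then have "u \<in> B \<rightarrow> carrier P" by auto
  then obtain k where k: "k \<in> linear_maps R F P" "\<And>b. b \<in> B \<Longrightarrow> k b = u b"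
    using is_basis_extend[OF assms(1,2) B] by blast
  have "g (k x) = h x" if "x \<in> carrier F" for x
    by (rule linear_eq_on_basis[OF assms(1,3) B linear_comp[OF k(1) g] h _ that]) (simp add: k(2) u)
  then show ?thesis using k(1) by blast
qed

section \<open>Comparison of free resolutions\<close>

lemma free_resolutionD:
  assumes "free_resolution R M F d \<epsilon>"
  shows "left_module R M" "left_module R (F n)" "\<exists>B. is_basis R (F n) B"
    "\<epsilon> \<in> linear_maps R (F 0) M" "d n \<in> linear_maps R (F (Suc n)) (F n)"
    "\<epsilon> ` carrier (F 0) = carrier M"
    "d 0 ` carrier (F (Suc 0)) = {x \<in> carrier (F 0). \<epsilon> x = \<zero>\<^bsub>M\<^esub>}"
    "d (Suc n) ` carrier (F (Suc (Suc n))) = {x \<in> carrier (F (Suc n)). d n x = \<zero>\<^bsub>F n\<^esub>}"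
proof -
  note * = assms[unfolded free_resolution_def a_kernel_def']
  note ** = *[THEN conjunct2, THEN conjunct2, THEN conjunct2]
  show "left_module R M" by (rule *[THEN conjunct1])
  show "left_module R (F n)" "\<exists>B. is_basis R (F n) B"
    by (rule *[THEN conjunct2, THEN conjunct1, THEN spec, THEN conjunct1]
        *[THEN conjunct2, THEN conjunct1, THEN spec, THEN conjunct2])+
  show "\<epsilon> \<in> linear_maps R (F 0) M" by (rule *[THEN conjunct2, THEN conjunct2, THEN conjunct1])
  show "d n \<in> linear_maps R (F (Suc n)) (F n)" by (rule **[THEN conjunct1, THEN spec])
  note *** = **[THEN conjunct2]
  show "\<epsilon> ` carrier (F 0) = carrier M" by (rule ***[THEN conjunct1])
  show "d 0 ` carrier (F (Suc 0)) = {x \<in> carrier (F 0). \<epsilon> x = \<zero>\<^bsub>M\<^esub>}"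
    by (rule ***[THEN conjunct2, THEN conjunct1])
  show "d (Suc n) ` carrier (F (Suc (Suc n))) = {x \<in> carrier (F (Suc n)). d n x = \<zero>\<^bsub>F n\<^esub>}"
    by (rule ***[THEN conjunct2, THEN conjunct2, THEN spec])
qed

lemma free_resolution_dd:
  assumes "free_resolution R M F d \<epsilon>"
  shows "x \<in> carrier (F (Suc (Suc n))) \<Longrightarrow> d n (d (Suc n) x) = \<zero>\<^bsub>F n\<^esub>"
    and "y \<in> carrier (F (Suc 0)) \<Longrightarrow> \<epsilon> (d 0 y) = \<zero>\<^bsub>M\<^esub>"
  using imageI[of x "carrier (F (Suc (Suc n)))" "d (Suc n)"] imageI[of y "carrier (F (Suc 0))" "d 0"]
  unfolding free_resolutionD(7,8)[OF assms] by simp_all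

text \<open>These are the lifts of the identity of the resolved module: compatibility with the
  augmentations is built in, because it is what starts a homotopy between two of them in degree
  0.\<close>

definition chain_map ::
  "('r, 's) ring_scheme \<Rightarrow> (nat \<Rightarrow> ('r, 'f, 'u) module_scheme) \<Rightarrow> (nat \<Rightarrow> 'f \<Rightarrow> 'f) \<Rightarrow> ('f \<Rightarrow> 'm)
    \<Rightarrow> (nat \<Rightarrow> ('r, 'g, 'v) module_scheme) \<Rightarrow> (nat \<Rightarrow> 'g \<Rightarrow> 'g) \<Rightarrow> ('g \<Rightarrow> 'm)
    \<Rightarrow> (nat \<Rightarrow> 'f \<Rightarrow> 'g) \<Rightarrow> bool"
  where "chain_map R F d \<epsilon> G d' \<epsilon>' \<phi> \<longleftrightarrow>
    (\<forall>n. \<phi> n \<in> linear_maps R (F n) (G n)) \<and>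
    (\<forall>x\<in>carrier (F 0). \<epsilon>' (\<phi> 0 x) = \<epsilon> x) \<and>
    (\<forall>n. \<forall>x\<in>carrier (F (Suc n)). d' n (\<phi> (Suc n) x) = \<phi> n (d n x))"

lemma chain_map_id: "chain_map R F d \<epsilon> F d \<epsilon> (\<lambda>n x. x)"
  by (simp add: chain_map_def linear_id)

lemma chain_map_comp:
  "chain_map R F d \<epsilon> G d' \<epsilon>' \<phi> \<Longrightarrow> chain_map R G d' \<epsilon>' H d'' \<epsilon>'' \<psi>
    \<Longrightarrow> chain_map R F d \<epsilon> H d'' \<epsilon>'' (\<lambda>n x. \<psi> n (\<phi> n x))"
  unfolding chain_map_def
  by (intro conjI allI ballI) (blast intro: linear_comp, metis linear_closed, metis linear_closed)

lemma comparison_map_exists: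
  assumes F: "free_resolution R M F d \<epsilon>" and G: "free_resolution R M G d' \<epsilon>'"
  shows "\<exists>\<phi>. chain_map R F d \<epsilon> G d' \<epsilon>' \<phi>"
proof -
  note F' = free_resolutionD[OF F] and G' = free_resolutionD[OF G]
  \<comment> \<open>\<open>P\<close> records that boundaries go to boundaries, since exactly this
    permits the next lift. The augmentation condition is guarded by \<open>n = 0\<close> because
    dependent choice uses one predicate for all degrees.\<close>
  define P where "P n \<phi> \<longleftrightarrow> \<phi> \<in> linear_maps R (F n) (G n) \<and>
    (\<forall>y\<in>carrier (F (Suc n)). \<phi> (d n y) \<in> d' n ` carrier (G (Suc n))) \<and>
    (n = 0 \<longrightarrow> (\<forall>x\<in>carrier (F 0). \<epsilon>' (\<phi> x) = \<epsilon> x))" for n \<phi>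
  define Q where "Q n \<phi> \<phi>' \<longleftrightarrow> (\<forall>x\<in>carrier (F (Suc n)). d' n (\<phi>' x) = \<phi> (d n x))" for n \<phi> \<phi>'
  have "\<exists>\<phi>. \<forall>n. P n (\<phi> n) \<and> Q n (\<phi> n) (\<phi> (Suc n))"
  proof (rule dependent_nat_choice)
    obtain B where B: "is_basis R (F 0) B" using F'(3) by blast
    obtain \<phi> where \<phi>: "\<phi> \<in> linear_maps R (F 0) (G 0)" "\<forall>x\<in>carrier (F 0). \<epsilon>' (\<phi> x) = \<epsilon> x"
      using linear_lift[OF F'(2) G'(2) F'(1) B F'(4) G'(4)] linear_closed[OF F'(4)] G'(6) by blast
    have "P 0 \<phi>"
      unfolding P_def G'(7)
      using \<phi> linear_closed[OF F'(5)] linear_closed[OF \<phi>(1)] free_resolution_dd(2)[OF F] by auto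
    then show "\<exists>\<phi>. P 0 \<phi>" by blast
  next
    fix \<phi> n assume "P n \<phi>"
    then have \<phi>: "\<phi> \<in> linear_maps R (F n) (G n)"
      and im: "\<And>y. y \<in> carrier (F (Suc n)) \<Longrightarrow> \<phi> (d n y) \<in> d' n ` carrier (G (Suc n))"
      unfolding P_def by auto
    obtain B where B: "is_basis R (F (Suc n)) B" using F'(3) by blast
    obtain \<phi>' where \<phi>': "\<phi>' \<in> linear_maps R (F (Suc n)) (G (Suc n))"
      "\<forall>x\<in>carrier (F (Suc n)). d' n (\<phi>' x) = \<phi> (d n x)"
      using linear_lift[OF F'(2) G'(2) G'(2) B linear_comp[OF F'(5) \<phi>] G'(5)] im by blast
    interpret \<phi>: abelian_group_hom "F n" "G n" \<phi>
      by (rule linear_abelian_group_hom[OF F'(2) G'(2) \<phi>])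
    \<comment> \<open>By exactness it is enough that the image of a boundary is a cycle, and d'
      \<phi>' d = \<phi> d d = 0.\<close>
    have "P (Suc n) \<phi>'"
      unfolding P_def G'(8)
      using \<phi>' linear_closed[OF F'(5)] linear_closed[OF \<phi>'(1)] free_resolution_dd(1)[OF F] by auto
    moreover have "Q n \<phi> \<phi>'" using \<phi>' unfolding Q_def by auto
    ultimately show "\<exists>\<phi>'. P (Suc n) \<phi>' \<and> Q n \<phi> \<phi>'" by blast
  qed
  then obtain \<phi> where "\<forall>n. P n (\<phi> n) \<and> Q n (\<phi> n) (\<phi> (Suc n))" ..
  then have "chain_map R F d \<epsilon> G d' \<epsilon>' \<phi>" unfolding chain_map_def P_def Q_def by blast
  then show ?thesis by blast
qed

lemma chain_homotopy_exists:
  assumes F: "free_resolution R M F d \<epsilon>" and G: "free_resolution R M G d' \<epsilon>'"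
    and \<phi>: "chain_map R F d \<epsilon> G d' \<epsilon>' \<phi>" and \<chi>: "chain_map R F d \<epsilon> G d' \<epsilon>' \<chi>"
  shows "\<exists>s. (\<forall>n. s n \<in> linear_maps R (F n) (G (Suc n))) \<and>
    (\<forall>x\<in>carrier (F 0). d' 0 (s 0 x) = \<phi> 0 x \<ominus>\<^bsub>G 0\<^esub> \<chi> 0 x) \<and>
    (\<forall>n. \<forall>x\<in>carrier (F (Suc n)).
      d' (Suc n) (s (Suc n) x) = \<phi> (Suc n) x \<ominus>\<^bsub>G (Suc n)\<^esub> \<chi> (Suc n) x \<ominus>\<^bsub>G (Suc n)\<^esub> s n (d n x))"
proof -
  note F' = free_resolutionD[OF F] and G' = free_resolutionD[OF G]
  interpret G: left_module R "G n" for n by (rule G')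
  interpret M: left_module R M by (rule G')
  interpret \<epsilon>': abelian_group_hom "G 0" M \<epsilon>' by (rule linear_abelian_group_hom[OF G'(2,1,4)])
  interpret d': abelian_group_hom "G (Suc n)" "G n" "d' n" for n
    by (rule linear_abelian_group_hom[OF G'(2,2,5)])
  have l\<phi>: "\<phi> n \<in> linear_maps R (F n) (G n)" and l\<chi>: "\<chi> n \<in> linear_maps R (F n) (G n)" for n
    using \<phi> \<chi> unfolding chain_map_def by auto
  note cl = linear_closed[OF l\<phi>] linear_closed[OF l\<chi>] linear_closed[OF F'(5)]
  \<comment> \<open>The clause on \<open>d n y\<close> is the homotopy identity on boundaries, where
    the term with the preceding component of the homotopy vanishes. It thus has the same form in all
    degrees and speaks of \<open>s\<close> alone, as dependent choice demands.\<close>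
  define P where "P n s \<longleftrightarrow> s \<in> linear_maps R (F n) (G (Suc n)) \<and>
    (\<forall>y\<in>carrier (F (Suc n)). d' n (s (d n y)) = \<phi> n (d n y) \<ominus>\<^bsub>G n\<^esub> \<chi> n (d n y)) \<and>
    (n = 0 \<longrightarrow> (\<forall>x\<in>carrier (F 0). d' 0 (s x) = \<phi> 0 x \<ominus>\<^bsub>G 0\<^esub> \<chi> 0 x))" for n s
  define Q where "Q n s s' \<longleftrightarrow> (\<forall>x\<in>carrier (F (Suc n)).
      d' (Suc n) (s' x) = \<phi> (Suc n) x \<ominus>\<^bsub>G (Suc n)\<^esub> \<chi> (Suc n) x \<ominus>\<^bsub>G (Suc n)\<^esub> s (d n x))" for n s s'
  have "\<exists>s. \<forall>n. P n (s n) \<and> Q n (s n) (s (Suc n))"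
  proof (rule dependent_nat_choice)
    obtain B where B: "is_basis R (F 0) B" using F'(3) by blast
    have "\<phi> 0 x \<ominus>\<^bsub>G 0\<^esub> \<chi> 0 x \<in> d' 0 ` carrier (G (Suc 0))" if "x \<in> carrier (F 0)" for x
      using that \<phi> \<chi> linear_closed[OF F'(4)] cl unfolding G'(7) chain_map_def
      by (simp add: \<epsilon>'.hom_a_minus M.M.r_neg a_minus_def)
    then obtain s where s: "s \<in> linear_maps R (F 0) (G (Suc 0))"
        "\<forall>x\<in>carrier (F 0). d' 0 (s x) = \<phi> 0 x \<ominus>\<^bsub>G 0\<^esub> \<chi> 0 x"
      using linear_lift[OF F'(2) G'(2) G'(2) B G.linear_minus[OF l\<phi> l\<chi>] G'(5)] by blast
    then have "P 0 s" unfolding P_def using cl by auto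
    then show "\<exists>s. P 0 s" by blast
  next
    fix s n assume "P n s"
    then have s: "s \<in> linear_maps R (F n) (G (Suc n))"
      and ds: "\<And>y. y \<in> carrier (F (Suc n)) \<Longrightarrow> d' n (s (d n y)) = \<phi> n (d n y) \<ominus>\<^bsub>G n\<^esub> \<chi> n (d n y)"
      unfolding P_def by auto
    obtain B where B: "is_basis R (F (Suc n)) B" using F'(3) by blast
    let ?h = "\<lambda>x. \<phi> (Suc n) x \<ominus>\<^bsub>G (Suc n)\<^esub> \<chi> (Suc n) x \<ominus>\<^bsub>G (Suc n)\<^esub> s (d n x)"
    \<comment> \<open>The boundary clause makes \<open>?h x\<close> a cycle: its differential is
      \<phi> d x - \<chi> d x - d' s d x = 0. Exactness of \<open>G\<close> then makes it a
      boundary.\<close>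
    have "?h x \<in> d' (Suc n) ` carrier (G (Suc (Suc n)))" if x: "x \<in> carrier (F (Suc n))" for x
    proof -
      have c: "\<phi> n (d n x) \<ominus>\<^bsub>G n\<^esub> \<chi> n (d n x) \<in> carrier (G n)" using x cl by simp
      have "d' n (\<phi> (Suc n) x) = \<phi> n (d n x)" "d' n (\<chi> (Suc n) x) = \<chi> n (d n x)"
        using \<phi> \<chi> x unfolding chain_map_def by auto
      then have "d' n (?h x) = \<zero>\<^bsub>G n\<^esub>"
        using x cl linear_closed[OF s] c by (simp add: d'.hom_a_minus ds) (simp add: a_minus_def G.M.r_neg)
      then show ?thesis unfolding G'(8) using x cl linear_closed[OF s] by simp
    qed
    then obtain s' where s': "s' \<in> linear_maps R (F (Suc n)) (G (Suc (Suc n)))"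
      "\<forall>x\<in>carrier (F (Suc n)). d' (Suc n) (s' x) = ?h x"
      using linear_lift[OF F'(2) G'(2) G'(2) B
          G.linear_minus[OF G.linear_minus[OF l\<phi> l\<chi>] linear_comp[OF F'(5) s]] G'(5)] by blast
    interpret s: abelian_group_hom "F n" "G (Suc n)" s
      by (rule linear_abelian_group_hom[OF F'(2) G'(2) s])
    have "P (Suc n) s'"
      unfolding P_def
      using s' cl free_resolution_dd(1)[OF F] by (auto simp: a_minus_def)
    moreover have "Q n s s'" using s' unfolding Q_def by auto
    ultimately show "\<exists>s'. P (Suc n) s' \<and> Q n s s'" by blast
  qed
  then obtain s where s: "\<forall>n. P n (s n) \<and> Q n (s n) (s (Suc n))" ..
  then have "\<forall>n. s n \<in> linear_maps R (F n) (G (Suc n))"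
    and "\<forall>x\<in>carrier (F 0). d' 0 (s 0 x) = \<phi> 0 x \<ominus>\<^bsub>G 0\<^esub> \<chi> 0 x"
    and "\<forall>n. Q n (s n) (s (Suc n))"
    unfolding P_def by blast+
  then show ?thesis unfolding Q_def by (intro exI[of _ s] conjI)
qed

section \<open>Cohomology of cochain complexes\<close>

text \<open>The isomorphism is induced by \<open>f\<close>. If \<open>f z\<close> lies in
  \<open>B'\<close>, then \<open>g (f z)\<close> lies in \<open>B\<close> and differs from
  \<open>z\<close> by an element of \<open>B\<close>, so the kernel is \<open>B\<close>; and
  \<open>g z\<close> represents a preimage of the coset of \<open>z\<close>. Hence \<open>g\<close>
  may be a mere map of sets that sends \<open>B'\<close> into \<open>B\<close>.\<close>

lemma quotient_iso:
  assumes "comm_group Z" "comm_group Z'" and B: "subgroup B Z" and B': "subgroup B' Z'"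
    and f: "f \<in> hom Z Z'" and g: "g \<in> carrier Z' \<rightarrow> carrier Z"
    and fB: "f ` B \<subseteq> B'" and gB: "g ` B' \<subseteq> B"
    and gf: "\<And>z. z \<in> carrier Z \<Longrightarrow> g (f z) \<in> B #>\<^bsub>Z\<^esub> z"
    and fg: "\<And>z. z \<in> carrier Z' \<Longrightarrow> f (g z) \<in> B' #>\<^bsub>Z'\<^esub> z"
  shows "Z Mod B \<cong> Z' Mod B'"
proof -
  interpret Z: comm_group Z by fact
  interpret Z': comm_group Z' by fact
  interpret B: subgroup B Z by fact
  interpret N': normal B' Z' by (rule Z'.subgroup_imp_normal) fact
  let ?h = "\<lambda>z. B' #>\<^bsub>Z'\<^esub> f z"
  have f_closed: "f z \<in> carrier Z'" if "z \<in> carrier Z" for z using f that by (auto simp: hom_def)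
  have "?h \<in> hom Z (Z' Mod B')"
    using hom_compose[OF f N'.r_coset_hom_Mod] by (simp add: o_def)
  then interpret h: group_hom Z "Z' Mod B'" ?h
    by (intro group_hom.intro group_hom_axioms.intro Z.group_axioms N'.factorgroup_is_group)
  have "kernel Z (Z' Mod B') ?h = B"
  proof (intro subset_antisym subsetI)
    fix z assume "z \<in> kernel Z (Z' Mod B') ?h"
    then have z: "z \<in> carrier Z" "B' #>\<^bsub>Z'\<^esub> f z = B'" by (auto simp: kernel_def FactGroup_def)
    then have "f z \<in> B'" using Z'.coset_join1[OF _ f_closed B'] by blast
    then have "g (f z) \<in> B" using gB by blast
    moreover obtain b where b: "b \<in> B" "g (f z) = b \<otimes>\<^bsub>Z\<^esub> z" using gf[OF z(1)] by (auto simp: r_coset_def)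
    ultimately have "inv\<^bsub>Z\<^esub> b \<otimes>\<^bsub>Z\<^esub> (b \<otimes>\<^bsub>Z\<^esub> z) \<in> B" by simp
    moreover have "inv\<^bsub>Z\<^esub> b \<otimes>\<^bsub>Z\<^esub> (b \<otimes>\<^bsub>Z\<^esub> z) = z"
      using b(1) z(1) by (simp add: Z.m_assoc[symmetric])
    ultimately show "z \<in> B" by simp
  next
    fix z assume "z \<in> B"
    then show "z \<in> kernel Z (Z' Mod B') ?h"
      using fB Z'.coset_join2[OF f_closed B'] by (auto simp: kernel_def FactGroup_def)
  qed
  moreover have "?h ` carrier Z = carrier (Z' Mod B')"
  proof (intro subset_antisym subsetI)
    fix X assume "X \<in> carrier (Z' Mod B')"
    then obtain z where z: "z \<in> carrier Z'" "X = B' #>\<^bsub>Z'\<^esub> z"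
      by (auto simp: FactGroup_def RCOSETS_def)
    have "X = ?h (g z)" unfolding z(2) by (rule Z'.repr_independence[OF fg[OF z(1)] z(1) B'])
    then show "X \<in> ?h ` carrier Z" using g z(1) by auto
  qed auto
  ultimately show ?thesis using h.FactGroup_iso by simp
qed

text \<open>The denominator in \<open>cohomology\<close>, isolated so that statements can say by
  what two cocycles differ.\<close>

definition coboundaries :: "(nat \<Rightarrow> 'c monoid) \<Rightarrow> (nat \<Rightarrow> 'c \<Rightarrow> 'c) \<Rightarrow> nat \<Rightarrow> 'c set"
  where "coboundaries C d n = (case n of 0 \<Rightarrow> {\<one>\<^bsub>C 0\<^esub>} | Suc m \<Rightarrow> d m ` carrier (C m))"

locale cochain_complex =
  fixes C :: "nat \<Rightarrow> 'c monoid" and d :: "nat \<Rightarrow> 'c \<Rightarrow> 'c"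
  assumes comm_group_C: "comm_group (C n)"
    and d_hom: "d n \<in> hom (C n) (C (Suc n))"
    and d_d: "x \<in> carrier (C n) \<Longrightarrow> d (Suc n) (d n x) = \<one>\<^bsub>C (Suc (Suc n))\<^esub>"
begin

sublocale C: comm_group "C n" for n by (rule comm_group_C)

sublocale d: group_hom "C n" "C (Suc n)" "d n" for n
  by (intro group_hom.intro group_hom_axioms.intro C.group_axioms d_hom)

abbreviation cocycles :: "nat \<Rightarrow> 'c monoid"
  where "cocycles n \<equiv> (C n)\<lparr>carrier := kernel (C n) (C (Suc n)) (d n)\<rparr>"

lemma comm_group_cocycles: "comm_group (cocycles n)"
proof -
  have "group (cocycles n)" by (rule subgroup.subgroup_is_group[OF d.subgroup_kernel C.group_axioms])
  then show ?thesis by (rule group.group_comm_groupI) (auto simp: kernel_def intro: C.m_comm)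
qed

lemma subgroup_coboundaries: "subgroup (coboundaries C d n) (cocycles n)"
proof (rule C.subgroup_incl[OF _ d.subgroup_kernel])
  show "subgroup (coboundaries C d n) (C n)"
    by (cases n) (auto simp: coboundaries_def C.triv_subgroup d.img_is_subgroup)
  show "coboundaries C d n \<subseteq> kernel (C n) (C (Suc n)) (d n)"
    by (cases n) (auto simp: coboundaries_def kernel_def d_d)
qed

end

text \<open>A homotopy equivalence enters only through its effect in the single degree
  \<open>n\<close>: each composite moves a cocycle within its coset of coboundaries.\<close>

lemma cohomology_iso:
  fixes C :: "nat \<Rightarrow> 'c monoid" and D :: "nat \<Rightarrow> 'e monoid" and n :: nat
  assumes C: "cochain_complex C d" and D: "cochain_complex D \<delta>"
    and f: "\<And>n. f n \<in> hom (C n) (D n)" and g: "\<And>n. g n \<in> hom (D n) (C n)"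
    and fd: "\<And>n x. x \<in> carrier (C n) \<Longrightarrow> \<delta> n (f n x) = f (Suc n) (d n x)"
    and gd: "\<And>n x. x \<in> carrier (D n) \<Longrightarrow> d n (g n x) = g (Suc n) (\<delta> n x)"
    and gf: "\<And>x. x \<in> kernel (C n) (C (Suc n)) (d n) \<Longrightarrow> g n (f n x) \<in> coboundaries C d n #>\<^bsub>C n\<^esub> x"
    and fg: "\<And>x. x \<in> kernel (D n) (D (Suc n)) (\<delta> n) \<Longrightarrow> f n (g n x) \<in> coboundaries D \<delta> n #>\<^bsub>D n\<^esub> x"
  shows "cohomology C d n \<cong> cohomology D \<delta> n"
proof -
  interpret C: cochain_complex C d by fact
  interpret D: cochain_complex D \<delta> by fact
  interpret f: group_hom "C k" "D k" "f k" for k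
    by (intro group_hom.intro group_hom_axioms.intro C.C.group_axioms D.C.group_axioms f)
  interpret g: group_hom "D k" "C k" "g k" for k
    by (intro group_hom.intro group_hom_axioms.intro C.C.group_axioms D.C.group_axioms g)
  have fB: "f n ` coboundaries C d n \<subseteq> coboundaries D \<delta> n"
    by (cases n) (auto simp: coboundaries_def fd[symmetric])
  have gB: "g n ` coboundaries D \<delta> n \<subseteq> coboundaries C d n"
    by (cases n) (auto simp: coboundaries_def gd[symmetric])
  have fZ: "f n \<in> hom (C.cocycles n) (D.cocycles n)"
    by (auto simp: hom_def kernel_def fd)
  have gZ: "g n \<in> carrier (D.cocycles n) \<rightarrow> carrier (C.cocycles n)"
    by (auto simp: kernel_def gd)
  have gf': "g n (f n z) \<in> coboundaries C d n #>\<^bsub>C.cocycles n\<^esub> z" if "z \<in> carrier (C.cocycles n)" for z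
  proof -
    have "H #>\<^bsub>C.cocycles n\<^esub> z = H #>\<^bsub>C n\<^esub> z" for H by (simp add: r_coset_def)
    then show ?thesis using gf[of z] that by simp
  qed
  have fg': "f n (g n z) \<in> coboundaries D \<delta> n #>\<^bsub>D.cocycles n\<^esub> z" if "z \<in> carrier (D.cocycles n)" for z
  proof -
    have "H #>\<^bsub>D.cocycles n\<^esub> z = H #>\<^bsub>D n\<^esub> z" for H by (simp add: r_coset_def)
    then show ?thesis using fg[of z] that by simp
  qed
  have "C.cocycles n Mod coboundaries C d n \<cong> D.cocycles n Mod coboundaries D \<delta> n"
    by (rule quotient_iso[OF C.comm_group_cocycles D.comm_group_cocycles C.subgroup_coboundaries
          D.subgroup_coboundaries fZ gZ fB gB gf' fg'])
  then show ?thesis by (simp add: cohomology_def coboundaries_def)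
qed

section \<open>The complex of homomorphisms into a fixed module\<close>

lemma Hom_group_carrier:
  "f \<in> carrier (Hom_group R M N) \<longleftrightarrow> f \<in> linear_maps R M N \<and> f \<in> extensional (carrier M)"
  and Hom_group_mult: "f \<otimes>\<^bsub>Hom_group R M N\<^esub> g = (\<lambda>x\<in>carrier M. f x \<oplus>\<^bsub>N\<^esub> g x)"
  and Hom_group_one: "\<one>\<^bsub>Hom_group R M N\<^esub> = (\<lambda>x\<in>carrier M. \<zero>\<^bsub>N\<^esub>)"
  by (simp_all add: Hom_group_def)

lemma (in left_module) linear_restrict: "f \<in> linear_maps R M N \<Longrightarrow> restrict f (carrier M) \<in> linear_maps R M N"
  by (auto simp: linear_maps_def)

lemma comm_group_Hom_group:
  assumes "left_module R M" "left_module R N"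
  shows "comm_group (Hom_group R M N)"
proof -
  interpret M: left_module R M by fact
  interpret N: left_module R N by fact
  have cl: "x \<in> carrier M \<Longrightarrow> f x \<in> carrier N" if "f \<in> carrier (Hom_group R M N)" for f x
    using that by (auto simp: Hom_group_carrier linear_closed)
  show ?thesis
  proof (rule comm_groupI)
    fix f g assume "f \<in> carrier (Hom_group R M N)" "g \<in> carrier (Hom_group R M N)"
    then show "f \<otimes>\<^bsub>Hom_group R M N\<^esub> g \<in> carrier (Hom_group R M N)"
      unfolding Hom_group_carrier Hom_group_mult using N.linear_plus M.linear_restrict by blast
  next
    show "\<one>\<^bsub>Hom_group R M N\<^esub> \<in> carrier (Hom_group R M N)"
      unfolding Hom_group_carrier Hom_group_one using N.linear_zero M.linear_restrict by blast
  next
    fix f assume f: "f \<in> carrier (Hom_group R M N)"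
    let ?g = "\<lambda>x\<in>carrier M. \<ominus>\<^bsub>N\<^esub> f x"
    have "?g \<in> carrier (Hom_group R M N)"
      using f unfolding Hom_group_carrier using N.linear_a_inv M.linear_restrict by blast
    moreover have "?g \<otimes>\<^bsub>Hom_group R M N\<^esub> f = \<one>\<^bsub>Hom_group R M N\<^esub>"
      unfolding Hom_group_mult Hom_group_one by (rule restrict_ext) (simp add: cl[OF f] N.M.l_neg)
    ultimately show "\<exists>g\<in>carrier (Hom_group R M N). g \<otimes>\<^bsub>Hom_group R M N\<^esub> f = \<one>\<^bsub>Hom_group R M N\<^esub>"
      by blast
  next
    fix f assume f: "f \<in> carrier (Hom_group R M N)"
    then have e: "f \<in> extensional (carrier M)" by (simp add: Hom_group_carrier)
    show "\<one>\<^bsub>Hom_group R M N\<^esub> \<otimes>\<^bsub>Hom_group R M N\<^esub> f = f"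
      unfolding Hom_group_mult Hom_group_one
      by (rule extensionalityI[OF restrict_extensional e]) (simp add: cl[OF f])
  next
    fix f g h
    assume "f \<in> carrier (Hom_group R M N)" "g \<in> carrier (Hom_group R M N)" "h \<in> carrier (Hom_group R M N)"
    then show "f \<otimes>\<^bsub>Hom_group R M N\<^esub> g \<otimes>\<^bsub>Hom_group R M N\<^esub> h
        = f \<otimes>\<^bsub>Hom_group R M N\<^esub> (g \<otimes>\<^bsub>Hom_group R M N\<^esub> h)"
      unfolding Hom_group_mult by (intro restrict_ext) (simp add: cl N.M.a_assoc)
  next
    fix f g
    assume "f \<in> carrier (Hom_group R M N)" "g \<in> carrier (Hom_group R M N)"
    then show "f \<otimes>\<^bsub>Hom_group R M N\<^esub> g = g \<otimes>\<^bsub>Hom_group R M N\<^esub> f"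
      unfolding Hom_group_mult by (intro restrict_ext) (simp add: cl N.M.a_comm)
  qed
qed

lemma pullback_carrier:
  assumes "left_module R M" "\<phi> \<in> linear_maps R M L" "f \<in> carrier (Hom_group R L N)"
  shows "(\<lambda>x\<in>carrier M. f (\<phi> x)) \<in> carrier (Hom_group R M N)"
  using assms linear_comp left_module.linear_restrict unfolding Hom_group_carrier by blast

lemma pullback_hom:
  assumes "left_module R M" and \<phi>: "\<phi> \<in> linear_maps R M L"
  shows "(\<lambda>f. \<lambda>x\<in>carrier M. f (\<phi> x)) \<in> hom (Hom_group R L N) (Hom_group R M N)"
proof (rule homI)
  show "(\<lambda>x\<in>carrier M. f (\<phi> x)) \<in> carrier (Hom_group R M N)" if "f \<in> carrier (Hom_group R L N)" for f
    by (rule pullback_carrier[OF assms that])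
  show "(\<lambda>x\<in>carrier M. (f \<otimes>\<^bsub>Hom_group R L N\<^esub> g) (\<phi> x))
      = (\<lambda>x\<in>carrier M. f (\<phi> x)) \<otimes>\<^bsub>Hom_group R M N\<^esub> (\<lambda>x\<in>carrier M. g (\<phi> x))" for f g
    unfolding Hom_group_mult by (rule restrict_ext) (simp add: linear_closed[OF \<phi>])
qed

lemma Hom_cochain_complex:
  assumes F: "free_resolution R M F d \<epsilon>" and N: "left_module R N"
  shows "cochain_complex (\<lambda>n. Hom_group R (F n) N) (\<lambda>n f. \<lambda>x\<in>carrier (F (Suc n)). f (d n x))"
proof -
  note F' = free_resolutionD[OF F]
  show ?thesis
  proof (rule cochain_complex.intro)
    show "comm_group (Hom_group R (F n) N)" for n by (rule comm_group_Hom_group[OF F'(2) N])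
    show "(\<lambda>f. \<lambda>x\<in>carrier (F (Suc n)). f (d n x)) \<in> hom (Hom_group R (F n) N) (Hom_group R (F (Suc n)) N)"
      for n by (rule pullback_hom[OF F'(2) F'(5)])
    fix f n assume "f \<in> carrier (Hom_group R (F n) N)"
    then have "f \<in> linear_maps R (F n) N" by (simp add: Hom_group_carrier)
    then interpret f: abelian_group_hom "F n" N f by (rule linear_abelian_group_hom[OF F'(2) N])
    show "(\<lambda>x\<in>carrier (F (Suc (Suc n))). (\<lambda>x\<in>carrier (F (Suc n)). f (d n x)) (d (Suc n) x))
        = \<one>\<^bsub>Hom_group R (F (Suc (Suc n))) N\<^esub>"
      unfolding Hom_group_one
      by (rule restrict_ext) (simp add: linear_closed[OF F'(5)] free_resolution_dd(1)[OF F])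
  qed
qed

lemma (in abelian_group) a_minus_eq_zero_iff:
  "x \<in> carrier G \<Longrightarrow> y \<in> carrier G \<Longrightarrow> x \<ominus> y = \<zero> \<longleftrightarrow> x = y"
  by (metis a_inv_closed a_minus_def minus_equality minus_minus r_neg)

text \<open>Let \<open>s\<close> be a homotopy with d s + s d = \<chi> - id. A cocycle
  \<open>z\<close> kills the part z d s, so z \<chi> - z = z s d, which is the coboundary of the
  composite of \<open>z\<close> and \<open>s\<close>. In degree 0 the term s d is absent and z
  \<chi> = z.\<close>

lemma pullback_cohomologous:
  assumes F: "free_resolution R M F d \<epsilon>" and N: "left_module R N"
    and \<chi>: "chain_map R F d \<epsilon> F d \<epsilon> \<chi>"
    and z: "z \<in> carrier (Hom_group R (F n) N)" "\<And>x. x \<in> carrier (F (Suc n)) \<Longrightarrow> z (d n x) = \<zero>\<^bsub>N\<^esub>"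
  shows "(\<lambda>x\<in>carrier (F n). z (\<chi> n x)) \<in>
    coboundaries (\<lambda>n. Hom_group R (F n) N) (\<lambda>n f. \<lambda>x\<in>carrier (F (Suc n)). f (d n x)) n #>\<^bsub>Hom_group R (F n) N\<^esub> z"
proof -
  note F' = free_resolutionD[OF F]
  interpret N: left_module R N by fact
  have zl: "z \<in> linear_maps R (F n) N" using z(1) by (simp add: Hom_group_carrier)
  interpret z: abelian_group_hom "F n" N z by (rule linear_abelian_group_hom[OF F'(2) N zl])
  have \<chi>l: "\<chi> n \<in> linear_maps R (F n) (F n)" for n using \<chi> unfolding chain_map_def by blast
  obtain s where s: "\<And>n. s n \<in> linear_maps R (F n) (F (Suc n))"
    and s0: "\<And>x. x \<in> carrier (F 0) \<Longrightarrow> d 0 (s 0 x) = \<chi> 0 x \<ominus>\<^bsub>F 0\<^esub> x"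
    and s1: "\<And>n x. x \<in> carrier (F (Suc n)) \<Longrightarrow>
      d (Suc n) (s (Suc n) x) = \<chi> (Suc n) x \<ominus>\<^bsub>F (Suc n)\<^esub> x \<ominus>\<^bsub>F (Suc n)\<^esub> s n (d n x)"
    using chain_homotopy_exists[OF F F \<chi> chain_map_id] by metis
  show ?thesis
  proof (cases n)
    case 0
    have "z (\<chi> 0 x) = z x" if x: "x \<in> carrier (F 0)" for x
    proof -
      have "z (\<chi> 0 x \<ominus>\<^bsub>F 0\<^esub> x) = \<zero>\<^bsub>N\<^esub>"
        using z(2)[of "s 0 x"] linear_closed[OF s[of 0] x] s0[OF x] 0 by simp
      then show ?thesis
        using x linear_closed[OF \<chi>l x] 0 z.hom_a_minus[of "\<chi> 0 x" x]
          N.M.a_minus_eq_zero_iff[of "z (\<chi> 0 x)" "z x"] by simp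
    qed
    then have "(\<lambda>x\<in>carrier (F n). z (\<chi> n x)) = \<one>\<^bsub>Hom_group R (F n) N\<^esub> \<otimes>\<^bsub>Hom_group R (F n) N\<^esub> z"
      unfolding Hom_group_mult Hom_group_one 0
      by (intro restrict_ext) (use z.hom_closed 0 in simp)
    then show ?thesis by (auto simp: coboundaries_def r_coset_def 0)
  next
    case (Suc m)
    let ?y = "\<lambda>x\<in>carrier (F m). z (s m x)"
    have y: "?y \<in> carrier (Hom_group R (F m) N)"
      by (rule pullback_carrier[OF F'(2) s]) (use z(1) Suc in simp)
    have eq: "z (\<chi> n x) = z (s m (d m x)) \<oplus>\<^bsub>N\<^esub> z x" if x: "x \<in> carrier (F n)" for x
    proof -
      have c: "\<chi> n x \<in> carrier (F n)" "s m (d m x) \<in> carrier (F n)"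
        using x linear_closed[OF \<chi>l] linear_closed[OF s] linear_closed[OF F'(5)] Suc by auto
      have "z (\<chi> n x \<ominus>\<^bsub>F n\<^esub> x \<ominus>\<^bsub>F n\<^esub> s m (d m x)) = \<zero>\<^bsub>N\<^esub>"
        using z(2)[of "s n x"] linear_closed[OF s x] s1[of x m] x Suc by simp
      moreover have "z (\<chi> n x \<ominus>\<^bsub>F n\<^esub> x \<ominus>\<^bsub>F n\<^esub> s m (d m x)) = z (\<chi> n x) \<ominus>\<^bsub>N\<^esub> z x \<ominus>\<^bsub>N\<^esub> z (s m (d m x))"
        using c x by (simp add: z.hom_a_minus)
      ultimately have "z (\<chi> n x) \<ominus>\<^bsub>N\<^esub> z x = z (s m (d m x))"
        using c x by (simp add: N.M.a_minus_eq_zero_iff)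
      then have "z (s m (d m x)) \<oplus>\<^bsub>N\<^esub> z x = z (\<chi> n x) \<ominus>\<^bsub>N\<^esub> z x \<oplus>\<^bsub>N\<^esub> z x" by simp
      also have "\<dots> = z (\<chi> n x)" using c x by (simp add: a_minus_def N.M.a_assoc N.M.l_neg)
      finally show ?thesis by simp
    qed
    define w where "w = (\<lambda>x\<in>carrier (F (Suc m)). ?y (d m x))"
    have "w \<in> coboundaries (\<lambda>n. Hom_group R (F n) N) (\<lambda>n f. \<lambda>x\<in>carrier (F (Suc n)). f (d n x)) n"
      unfolding coboundaries_def w_def Suc nat.case using y by (rule rev_image_eqI) (rule refl)
    moreover have "(\<lambda>x\<in>carrier (F n). z (\<chi> n x)) = w \<otimes>\<^bsub>Hom_group R (F n) N\<^esub> z"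
      unfolding Hom_group_mult
      by (intro restrict_ext) (use eq linear_closed[OF F'(5)] Suc in \<open>simp add: w_def\<close>)
    ultimately show ?thesis unfolding r_coset_def by blast
  qed
qed

text \<open>The comparison maps in the two directions need not be inverse in any degree, but both
  composites lift the identity and are therefore homotopic to it;
  \<open>pullback_cohomologous\<close> is applied with \<chi> such a composite.\<close>

theorem Hom_cohomology_unique:
  assumes F: "free_resolution R M F d \<epsilon>" and G: "free_resolution R M G d' \<epsilon>'" and N: "left_module R N"
  shows "Hom_cohomology R F d N n \<cong> Hom_cohomology R G d' N n"
proof -
  note F' = free_resolutionD[OF F] and G' = free_resolutionD[OF G]
  obtain \<phi> where \<phi>: "chain_map R F d \<epsilon> G d' \<epsilon>' \<phi>" using comparison_map_exists[OF F G] by blast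
  obtain \<psi> where \<psi>: "chain_map R G d' \<epsilon>' F d \<epsilon> \<psi>" using comparison_map_exists[OF G F] by blast
  have \<phi>l: "\<phi> n \<in> linear_maps R (F n) (G n)" and \<psi>l: "\<psi> n \<in> linear_maps R (G n) (F n)" for n
    using \<phi> \<psi> unfolding chain_map_def by auto
  have \<phi>d: "d' n (\<phi> (Suc n) x) = \<phi> n (d n x)" if "x \<in> carrier (F (Suc n))" for n x
    using \<phi> that unfolding chain_map_def by blast
  have \<psi>d: "d n (\<psi> (Suc n) x) = \<psi> n (d' n x)" if "x \<in> carrier (G (Suc n))" for n x
    using \<psi> that unfolding chain_map_def by blast
  show ?thesis
    unfolding Hom_cohomology_def
  \<comment> \<open>Pulling back reverses arrows: \<psi>, which goes from \<open>G\<close> to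
    \<open>F\<close>, gives the map from homomorphisms on \<open>F\<close> to homomorphisms on
    \<open>G\<close>.\<close>
  proof (rule cohomology_iso[OF Hom_cochain_complex[OF F N] Hom_cochain_complex[OF G N]
        pullback_hom[OF G'(2) \<psi>l] pullback_hom[OF F'(2) \<phi>l]])
    show "(\<lambda>x\<in>carrier (G (Suc n)). (\<lambda>x\<in>carrier (G n). f (\<psi> n x)) (d' n x))
        = (\<lambda>x\<in>carrier (G (Suc n)). (\<lambda>x\<in>carrier (F (Suc n)). f (d n x)) (\<psi> (Suc n) x))" for n f
      by (rule restrict_ext) (simp add: linear_closed[OF G'(5)] linear_closed[OF \<psi>l] \<psi>d)
    show "(\<lambda>x\<in>carrier (F (Suc n)). (\<lambda>x\<in>carrier (F n). f (\<phi> n x)) (d n x))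
        = (\<lambda>x\<in>carrier (F (Suc n)). (\<lambda>x\<in>carrier (G (Suc n)). f (d' n x)) (\<phi> (Suc n) x))" for n f
      by (rule restrict_ext) (simp add: linear_closed[OF F'(5)] linear_closed[OF \<phi>l] \<phi>d)
  next
    fix f assume "f \<in> kernel (Hom_group R (F n) N) (Hom_group R (F (Suc n)) N) (\<lambda>f. \<lambda>x\<in>carrier (F (Suc n)). f (d n x))"
    then have f: "f \<in> carrier (Hom_group R (F n) N)" "x \<in> carrier (F (Suc n)) \<Longrightarrow> f (d n x) = \<zero>\<^bsub>N\<^esub>" for x
      by (auto simp: kernel_def Hom_group_one fun_eq_iff restrict_def split: if_splits)
    have "(\<lambda>x\<in>carrier (F n). (\<lambda>x\<in>carrier (G n). f (\<psi> n x)) (\<phi> n x)) = (\<lambda>x\<in>carrier (F n). f (\<psi> n (\<phi> n x)))"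
      by (rule restrict_ext) (simp add: linear_closed[OF \<phi>l])
    then show "(\<lambda>x\<in>carrier (F n). (\<lambda>x\<in>carrier (G n). f (\<psi> n x)) (\<phi> n x))
        \<in> coboundaries (\<lambda>n. Hom_group R (F n) N) (\<lambda>n f. \<lambda>x\<in>carrier (F (Suc n)). f (d n x)) n #>\<^bsub>Hom_group R (F n) N\<^esub> f"
      using pullback_cohomologous[OF F N chain_map_comp[OF \<phi> \<psi>] f] by simp
  next
    fix f assume "f \<in> kernel (Hom_group R (G n) N) (Hom_group R (G (Suc n)) N) (\<lambda>f. \<lambda>x\<in>carrier (G (Suc n)). f (d' n x))"
    then have f: "f \<in> carrier (Hom_group R (G n) N)" "x \<in> carrier (G (Suc n)) \<Longrightarrow> f (d' n x) = \<zero>\<^bsub>N\<^esub>" for x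
      by (auto simp: kernel_def Hom_group_one fun_eq_iff restrict_def split: if_splits)
    have "(\<lambda>x\<in>carrier (G n). (\<lambda>x\<in>carrier (F n). f (\<phi> n x)) (\<psi> n x)) = (\<lambda>x\<in>carrier (G n). f (\<phi> n (\<psi> n x)))"
      by (rule restrict_ext) (simp add: linear_closed[OF \<psi>l])
    then show "(\<lambda>x\<in>carrier (G n). (\<lambda>x\<in>carrier (F n). f (\<phi> n x)) (\<psi> n x))
        \<in> coboundaries (\<lambda>n. Hom_group R (G n) N) (\<lambda>n f. \<lambda>x\<in>carrier (G (Suc n)). f (d' n x)) n #>\<^bsub>Hom_group R (G n) N\<^esub> f"
      using pullback_cohomologous[OF G N chain_map_comp[OF \<psi> \<phi>] f] by simp
  qed
qed

text \<open>A levelwise isomorphism forces \<delta> to be the transport of \<open>d\<close> on the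
  carriers. That \<delta> is a homomorphism with \<delta>\<delta> = 0 is thus derived, which spares
  a direct computation with the coboundary formula.\<close>

lemma cohomology_iso_transport:
  assumes C: "cochain_complex C d" and D: "\<And>n. comm_group (D n)"
    and f: "\<And>n. f n \<in> hom (C n) (D n)" and g: "\<And>n. g n \<in> hom (D n) (C n)"
    and gf: "\<And>n x. x \<in> carrier (C n) \<Longrightarrow> g n (f n x) = x"
    and fg: "\<And>n y. y \<in> carrier (D n) \<Longrightarrow> f n (g n y) = y"
    and fd: "\<And>n x. x \<in> carrier (C n) \<Longrightarrow> \<delta> n (f n x) = f (Suc n) (d n x)"
  shows "cohomology C d k \<cong> cohomology D \<delta> k"
proof -
  interpret C: cochain_complex C d by fact
  interpret D: comm_group "D n" for n by (rule D)
  have fc: "f n x \<in> carrier (D n)" if "x \<in> carrier (C n)" for n x using f that by (auto simp: hom_def)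
  have gc: "g n x \<in> carrier (C n)" if "x \<in> carrier (D n)" for n x using g that by (auto simp: hom_def)
  interpret f: group_hom "C n" "D n" "f n" for n
    by (intro group_hom.intro group_hom_axioms.intro C.C.group_axioms D.group_axioms f)
  have \<delta>: "\<delta> n y = f (Suc n) (d n (g n y))" if "y \<in> carrier (D n)" for n y
    using fd[OF gc[OF that]] fg[OF that] by simp
  have "cochain_complex D \<delta>"
  proof (rule cochain_complex.intro)
    show "comm_group (D n)" for n by (rule D)
    have "(f (Suc n) \<circ> d n) \<circ> g n \<in> hom (D n) (D (Suc n))" for n
      by (intro hom_compose[OF g] hom_compose[OF C.d_hom f])
    then show "\<delta> n \<in> hom (D n) (D (Suc n))" for n
      by (rule D.hom_restrict) (simp add: \<delta>)
    show "\<delta> (Suc n) (\<delta> n y) = \<one>\<^bsub>D (Suc (Suc n))\<^esub>" if "y \<in> carrier (D n)" for n y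
      using that by (simp add: \<delta> gc fc gf C.d_d)
  qed
  then show ?thesis
  proof (rule cohomology_iso[OF C _ f g fd])
    show "d n (g n y) = g (Suc n) (\<delta> n y)" if "y \<in> carrier (D n)" for n y
      using that by (simp add: \<delta> gf gc)
    show "g k (f k x) \<in> coboundaries C d k #>\<^bsub>C k\<^esub> x" if "x \<in> kernel (C k) (C (Suc k)) (d k)" for x
    proof -
      have x: "x \<in> carrier (C k)" using that by (simp add: kernel_def)
      have "\<one>\<^bsub>C k\<^esub> \<in> coboundaries C d k" using subgroup.one_closed[OF C.subgroup_coboundaries] by simp
      then show ?thesis unfolding gf[OF x] using x by (force simp: r_coset_def)
    qed
    show "f k (g k y) \<in> coboundaries D \<delta> k #>\<^bsub>D k\<^esub> y" if "y \<in> kernel (D k) (D (Suc k)) (\<delta> k)" for y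
    proof -
      have y: "y \<in> carrier (D k)" using that by (simp add: kernel_def)
      have "\<one>\<^bsub>D k\<^esub> \<in> coboundaries D \<delta> k"
        using subgroup.one_closed[OF cochain_complex.subgroup_coboundaries[OF \<open>cochain_complex D \<delta>\<close>]] by simp
      then show ?thesis unfolding fg[OF y] using y by (force simp: r_coset_def)
    qed
  qed
qed

section \<open>The bar resolution\<close>

context endo_action
begin

sublocale bar: left_module "skew_ring \<theta>" "bar \<theta> n" for n by (rule left_module_bar)

sublocale coeff: left_module "skew_ring \<theta>" "coeff_module \<theta>" by (rule left_module_coeff_module)

abbreviation gen :: "'p list \<Rightarrow> 'p list \<Rightarrow> ('p \<Rightarrow>\<^sub>0 'g cstar)"
  where "gen \<equiv> free_gen (skew_ring \<theta>)"

lemma skew_carrier [simp]: "x \<in> carrier (skew_ring \<theta>)"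
  by (simp add: skew_ring_def)

lemma coeff_simps [simp]: "a \<in> carrier (coeff_module \<theta>)" "\<zero>\<^bsub>coeff_module \<theta>\<^esub> = 0" "a \<oplus>\<^bsub>coeff_module \<theta>\<^esub> b = a + b"
  by (simp_all add: coeff_module_def)

lemma carrier_bar: "f \<in> carrier (bar \<theta> n) \<longleftrightarrow> (\<forall>ps. f ps \<noteq> 0 \<longrightarrow> length ps = n) \<and> finite {ps. f ps \<noteq> 0}"
  and zero_bar: "\<zero>\<^bsub>bar \<theta> n\<^esub> = (\<lambda>ps. 0)"
  and add_bar: "f \<oplus>\<^bsub>bar \<theta> n\<^esub> g = (\<lambda>ps. f ps + g ps)"
  and smult_bar: "r \<odot>\<^bsub>bar \<theta> n\<^esub> f = (\<lambda>ps. skew_mult \<theta> r (f ps))"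
  by (auto simp: bar_def free_module_def skew_ring_def)

lemma bar_add_closed:
  "x \<in> carrier (bar \<theta> n) \<Longrightarrow> y \<in> carrier (bar \<theta> n) \<Longrightarrow> (\<lambda>ps. x ps + y ps) \<in> carrier (bar \<theta> n)"
  using bar.M.a_closed unfolding add_bar .

lemma gen_apply: "gen ps qs = (if qs = ps then Poly_Mapping.single 1 1 else 0)"
  by (simp add: free_gen_def skew_ring_def)

lemma bar_term_apply: "(r \<odot>\<^bsub>bar \<theta> n\<^esub> gen ps) qs = (if qs = ps then r else 0)"
  by (simp add: smult_bar gen_apply skew_mult_one_right skew_mult_0_right)

lemma bar_term_closed: "length ps = n \<Longrightarrow> r \<odot>\<^bsub>bar \<theta> n\<^esub> gen ps \<in> carrier (bar \<theta> n)"
  by (simp add: bar_gen_closed)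

lemma bar_finsum_apply:
  "finite K \<Longrightarrow> f \<in> K \<rightarrow> carrier (bar \<theta> n) \<Longrightarrow> (\<Oplus>\<^bsub>bar \<theta> n\<^esub>k\<in>K. f k) qs = (\<Sum>k\<in>K. f k qs)"
  by (induction K rule: finite_induct) (simp_all add: zero_bar add_bar Pi_def)

text \<open>The computations are done on coefficients. Different faces of one tuple may coincide, so
  every face contributes its own conditional and the contributions add up.\<close>

lemma bar_boundary_apply:
  assumes "length ps = Suc n"
  shows "bar_boundary \<theta> ps qs =
    (if qs = tl ps then Poly_Mapping.single (hd ps) 1 else 0)
    + (\<Sum>i\<in>{1..n}. if qs = contract i ps then Poly_Mapping.single 1 ((- 1) ^ i) else 0)
    + (if qs = butlast ps then Poly_Mapping.single 1 ((- 1) ^ Suc n) else 0)"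
proof -
  have "bar_boundary \<theta> ps = Poly_Mapping.single (hd ps) 1 \<odot>\<^bsub>bar \<theta> n\<^esub> gen (tl ps)
      \<oplus>\<^bsub>bar \<theta> n\<^esub> (\<Oplus>\<^bsub>bar \<theta> n\<^esub>i\<in>{1..n}. Poly_Mapping.single 1 ((- 1) ^ i) \<odot>\<^bsub>bar \<theta> n\<^esub> gen (contract i ps))
      \<oplus>\<^bsub>bar \<theta> n\<^esub> Poly_Mapping.single 1 ((- 1) ^ Suc n) \<odot>\<^bsub>bar \<theta> n\<^esub> gen (butlast ps)"
    using assms by (simp add: bar_boundary_def Let_def atLeastLessThanSuc_atLeastAtMost)
  moreover have "(\<Oplus>\<^bsub>bar \<theta> n\<^esub>i\<in>{1..n}. Poly_Mapping.single 1 ((- 1) ^ i) \<odot>\<^bsub>bar \<theta> n\<^esub> gen (contract i ps)) qs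
      = (\<Sum>i\<in>{1..n}. if qs = contract i ps then Poly_Mapping.single 1 ((- 1) ^ i) else 0)"
    by (subst bar_finsum_apply) (auto simp: bar_term_apply length_contract assms intro!: bar_term_closed)
  ultimately show ?thesis
    by (simp only: add_bar bar_term_apply)
qed

lemma bar_boundary_range: "bar_boundary \<theta> \<in> {ps. length ps = Suc n} \<rightarrow> carrier (bar \<theta> n)"
proof
  fix ps :: "'p list" assume "ps \<in> {ps. length ps = Suc n}"
  then show "bar_boundary \<theta> ps \<in> carrier (bar \<theta> n)" using bar_boundary_closed[of ps] by fastforce
qed

lemma bar_diff_linear: "bar_diff \<theta> n \<in> linear_maps (skew_ring \<theta>) (bar \<theta> (Suc n)) (bar \<theta> n)"
  using bar.lin_ext_linear[OF bar_boundary_range] by (simp add: bar_diff_def bar_def)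

lemma bar_aug_linear: "bar_aug \<theta> \<in> linear_maps (skew_ring \<theta>) (bar \<theta> 0) (coeff_module \<theta>)"
  using coeff.lin_ext_linear[of "\<lambda>_. 1" "{ps. length ps = 0}"] by (simp add: bar_aug_def bar_def)

lemma bar_diff_add:
  "x \<in> carrier (bar \<theta> (Suc n)) \<Longrightarrow> y \<in> carrier (bar \<theta> (Suc n))
    \<Longrightarrow> bar_diff \<theta> n (\<lambda>ps. x ps + y ps) = (\<lambda>ps. bar_diff \<theta> n x ps + bar_diff \<theta> n y ps)"
  using linear_add[OF bar_diff_linear] unfolding add_bar .

lemma bar_aug_add:
  "x \<in> carrier (bar \<theta> 0) \<Longrightarrow> y \<in> carrier (bar \<theta> 0)
    \<Longrightarrow> bar_aug \<theta> (\<lambda>ps. x ps + y ps) = bar_aug \<theta> x + bar_aug \<theta> y"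
  using linear_add[OF bar_aug_linear] by (simp add: add_bar)

lemma bar_diff_zero: "bar_diff \<theta> n (\<lambda>ps. 0) = (\<lambda>ps. 0)"
proof -
  interpret h: abelian_group_hom "bar \<theta> (Suc n)" "bar \<theta> n" "bar_diff \<theta> n"
    by (rule linear_abelian_group_hom[OF left_module_bar left_module_bar bar_diff_linear])
  show ?thesis using h.hom_zero by (simp add: zero_bar)
qed

lemma bar_aug_zero: "bar_aug \<theta> (\<lambda>ps. 0) = 0"
  by (simp add: bar_aug_def lin_ext_def skew_ring_def)

lemma bar_diff_term_apply:
  assumes "length ps = Suc n"
  shows "bar_diff \<theta> n (Poly_Mapping.single p a \<odot>\<^bsub>bar \<theta> (Suc n)\<^esub> gen ps) qs =
    (if qs = tl ps then Poly_Mapping.single (p * hd ps) a else 0)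
    + (\<Sum>i\<in>{1..n}. if qs = contract i ps then Poly_Mapping.single p (a * (- 1) ^ i) else 0)
    + (if qs = butlast ps then Poly_Mapping.single p (a * (- 1) ^ Suc n) else 0)"
proof -
  \<comment> \<open>Signs are fixed by a unital endomorphism, so they pass through the twisted
    product unchanged. Only the leading face changes the fibre, from \<open>p\<close> to
    \<open>p * hd ps\<close>.\<close>
  have m1: "cstar_map (\<theta> p) ((- 1) ^ i) = (- 1) ^ i" for i
  proof (induction i)
    case (Suc i)
    have "cstar_map (\<theta> p) (- 1) = - 1"
      using endo.cstar_map_add[of p 1 "- 1"] by (simp add: endo.cstar_map_0 endo.cstar_map_1 eq_neg_iff_add_eq_0 add.commute)
    then show ?case using Suc by (simp only: power_Suc endo.cstar_map_mult)
  qed (simp add: endo.cstar_map_1)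
  have sum: "skew_mult \<theta> r (\<Sum>i\<in>K. h i) = (\<Sum>i\<in>K. skew_mult \<theta> r (h i))" if "finite K" for r h and K :: "nat set"
    using that by (induction K rule: finite_induct) (simp_all add: skew_mult_0_right skew_mult_add_right)
  have "bar_diff \<theta> n (Poly_Mapping.single p a \<odot>\<^bsub>bar \<theta> (Suc n)\<^esub> gen ps)
      = Poly_Mapping.single p a \<odot>\<^bsub>bar \<theta> n\<^esub> bar_boundary \<theta> ps"
    using linear_smult[OF bar_diff_linear] bar_gen_closed[OF assms] bar_diff_gen[OF assms] by simp
  moreover have "skew_mult \<theta> (Poly_Mapping.single p a) (if b then Poly_Mapping.single q c else 0)
      = (if b then Poly_Mapping.single (p * q) (a * cstar_map (\<theta> p) c) else 0)" for b q c
    by (simp add: skew_mult_single skew_mult_0_right)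
  ultimately show ?thesis
    by (simp only: smult_bar bar_boundary_apply[OF assms] skew_mult_add_right sum finite_atLeastAtMost m1
        endo.cstar_map_1 mult_1_right)
qed

lemma bar_aug_term: "bar_aug \<theta> (Poly_Mapping.single p a \<odot>\<^bsub>bar \<theta> 0\<^esub> gen []) = a"
  using linear_smult[OF bar_aug_linear] bar_gen_closed[of "[]" 0] bar_aug_gen
  by (simp add: coeff_module_action endo.cstar_map_1)

text \<open>The contraction is not a homomorphism over \<open>skew_ring \<theta>\<close>, so for
  identities that involve it checking on the basis is not enough. Additivity still reduces them to
  terms with one fibre and one tuple.\<close>

lemma bar_induct [consumes 1, case_names zero add single]:
  assumes x: "x \<in> carrier (bar \<theta> n)"
    and zero: "Q (\<lambda>ps. 0)"
    and add: "\<And>x y. x \<in> carrier (bar \<theta> n) \<Longrightarrow> y \<in> carrier (bar \<theta> n) \<Longrightarrow> Q x \<Longrightarrow> Q y \<Longrightarrow> Q (\<lambda>ps. x ps + y ps)"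
    and trm: "\<And>p a ps. length ps = n \<Longrightarrow> Q (Poly_Mapping.single p a \<odot>\<^bsub>bar \<theta> n\<^esub> gen ps)"
  shows "Q x"
proof -
  have r: "Q (r \<odot>\<^bsub>bar \<theta> n\<^esub> gen ps)" if ps: "length ps = n" for r ps
  proof (induction r rule: poly_mapping_additive_induct)
    case 1
    then show ?case using zero by (simp add: smult_bar skew_mult_0_left)
  next
    case (2 r s)
    have "(r + s) \<odot>\<^bsub>bar \<theta> n\<^esub> gen ps = (\<lambda>qs. (r \<odot>\<^bsub>bar \<theta> n\<^esub> gen ps) qs + (s \<odot>\<^bsub>bar \<theta> n\<^esub> gen ps) qs)"
      by (simp add: smult_bar skew_mult_add_left)
    then show ?case using add[OF bar_term_closed[OF ps] bar_term_closed[OF ps] 2] by simp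
  next
    case (3 p a)
    then show ?case by (rule trm[OF ps])
  qed
  have x': "finite {ps. x ps \<noteq> 0}" "x ps \<noteq> 0 \<Longrightarrow> length ps = n" for ps using x by (auto simp: carrier_bar)
  \<comment> \<open>\<open>x\<close> is built up from its truncations to finite sets of tuples.
    Membership of the truncation in the carrier is proved along with \<open>Q\<close>, because
    \<open>add\<close> asks for it.\<close>
  have "(\<lambda>ps. if ps \<in> K then x ps else 0) \<in> carrier (bar \<theta> n) \<and> Q (\<lambda>ps. if ps \<in> K then x ps else 0)"
    if "finite K" "K \<subseteq> {ps. length ps = n}" for K
    using that
  proof (induction K rule: finite_induct)
    case empty
    then show ?case using zero by (simp add: carrier_bar)
  next
    case (insert k K)
    have eq: "(\<lambda>ps. if ps \<in> insert k K then x ps else 0)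
        = (\<lambda>ps. (x k \<odot>\<^bsub>bar \<theta> n\<^esub> gen k) ps + (if ps \<in> K then x ps else 0))"
      using insert(2) by (auto simp: bar_term_apply)
    have k: "length k = n" using insert by simp
    have "Q (\<lambda>ps. if ps \<in> insert k K then x ps else 0)"
      unfolding eq using insert by (intro add bar_term_closed[OF k] r[OF k]) auto
    moreover have "(\<lambda>ps. if ps \<in> insert k K then x ps else 0) \<in> carrier (bar \<theta> n)"
      unfolding eq using insert by (intro bar_add_closed bar_term_closed[OF k]) auto
    ultimately show ?case by blast
  qed
  from this[OF x'(1)] x'(2) have "Q (\<lambda>ps. if ps \<in> {ps. x ps \<noteq> 0} then x ps else 0)" by blast
  moreover have "(\<lambda>ps. if ps \<in> {ps. x ps \<noteq> 0} then x ps else 0) = x" by auto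
  ultimately show ?thesis by simp
qed

text \<open>The contraction in terms of coefficients: the tuple \<open>q # ps\<close> arises only
  from the component in fibre \<open>q\<close> of the coefficient of \<open>ps\<close>, and its own
  coefficient lies in the unit fibre. The empty tuple is not hit, hence the value 0 there. In this
  form additivity is immediate and one function serves all degrees.\<close>

definition bar_contraction :: "('p list \<Rightarrow> ('p \<Rightarrow>\<^sub>0 'g cstar)) \<Rightarrow> 'p list \<Rightarrow> ('p \<Rightarrow>\<^sub>0 'g cstar)"
  where "bar_contraction f = (\<lambda>qs. case qs of [] \<Rightarrow> 0 | q # ps \<Rightarrow> Poly_Mapping.single 1 (Poly_Mapping.lookup (f ps) q))"

lemma bar_contraction_zero: "bar_contraction (\<lambda>ps. 0) = (\<lambda>ps. 0)"
  by (auto simp: bar_contraction_def split: list.split)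

lemma bar_contraction_add:
  "bar_contraction (\<lambda>ps. f ps + g ps) = (\<lambda>qs. bar_contraction f qs + bar_contraction g qs)"
  by (auto simp: bar_contraction_def lookup_add single_add split: list.split)

lemma bar_contraction_term:
  "bar_contraction (Poly_Mapping.single p a \<odot>\<^bsub>bar \<theta> n\<^esub> gen ps)
    = Poly_Mapping.single 1 a \<odot>\<^bsub>bar \<theta> (Suc n)\<^esub> gen (p # ps)"
  by (auto simp: bar_contraction_def bar_term_apply lookup_single when_def split: list.split)

lemma bar_contraction_closed:
  assumes "f \<in> carrier (bar \<theta> n)"
  shows "bar_contraction f \<in> carrier (bar \<theta> (Suc n))"
  using assms
proof (induction rule: bar_induct)
  case zero
  then show ?case by (simp add: bar_contraction_zero carrier_bar)
next
  case (add x y)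
  then show ?case unfolding bar_contraction_add by (intro bar_add_closed)
next
  case (single p a ps)
  then show ?case unfolding bar_contraction_term by (intro bar_term_closed) simp
qed

text \<open>In degree 0 the second half of the homotopy is the section a \<mapsto> a[] of the
  augmentation: the differential sends a[p] to \<open>a \<one>\<^sub>p [] - a[]\<close>, and the
  section restores a[].\<close>

lemma bar_homotopy_0:
  assumes "x \<in> carrier (bar \<theta> 0)"
  shows "(\<lambda>ps. bar_diff \<theta> 0 (bar_contraction x) ps
    + (Poly_Mapping.single 1 (bar_aug \<theta> x) \<odot>\<^bsub>bar \<theta> 0\<^esub> gen []) ps) = x"
  using assms
proof (induction rule: bar_induct)
  case zero
  then show ?case by (simp add: bar_contraction_zero bar_diff_zero bar_aug_zero bar_term_apply)
next
  case (add x y)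
  \<comment> \<open>The induction hypotheses are read from right to left: they expand
    \<open>x\<close> and \<open>y\<close> on the right-hand side, and additivity of the maps on the
    left closes the case.\<close>
  note IH = add(3,4)[THEN fun_cong, symmetric]
  show ?case
    by (rule ext, subst IH(1), subst IH(2))
      (simp add: bar_contraction_add bar_diff_add bar_contraction_closed bar_aug_add add(1,2) smult_bar
        single_add skew_mult_add_left algebra_simps)
next
  case (single p a ps)
  then have ps: "ps = []" by simp
  show ?case
    unfolding ps bar_contraction_term bar_aug_term
    by (rule ext, subst bar_diff_term_apply) (simp_all add: bar_term_apply single_uminus)
qed

text \<open>The combinatorics of the homotopy is contained in this and the next fact. Prefixing
  \<open>p\<close> shifts the inner faces by one position, and the new first face multiplies
  \<open>p\<close> into the head, as a coefficient \<open>\<one>\<^sub>p\<close> does when it meets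
  the leading face of \<open>ps\<close>.\<close>

lemma contract_1: "ps \<noteq> [] \<Longrightarrow> contract (Suc 0) (p # ps) = (p * hd ps) # tl ps"
  by (cases ps) (simp_all add: contract_def)

lemma contract_Suc: "1 \<le> i \<Longrightarrow> contract (Suc i) (p # ps) = p # contract i ps"
  by (cases i) (simp_all add: contract_def)

text \<open>On \<open>a \<one>\<^sub>p [ps]\<close> the leading face of the prefixed tuple gives
  back the term itself. Its remaining faces are the contracted faces of \<open>ps\<close> with the
  index raised by one, hence with the opposite sign, and cancel against the second summand.\<close>

lemma bar_homotopy_Suc:
  assumes "x \<in> carrier (bar \<theta> (Suc n))"
  shows "(\<lambda>ps. bar_diff \<theta> (Suc n) (bar_contraction x) ps + bar_contraction (bar_diff \<theta> n x) ps) = x"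
  using assms
proof (induction rule: bar_induct)
  case zero
  then show ?case by (simp add: bar_contraction_zero bar_diff_zero)
next
  case (add x y)
  note IH = add(3,4)[THEN fun_cong, symmetric]
  show ?case
    by (rule ext, subst IH(1), subst IH(2))
      (simp add: bar_contraction_add bar_diff_add bar_contraction_closed add(1,2) algebra_simps)
next
  case (single p a ps)
  let ?x = "Poly_Mapping.single p a \<odot>\<^bsub>bar \<theta> (Suc n)\<^esub> gen ps"
  have ps: "ps \<noteq> []" "length (p # ps) = Suc (Suc n)" using single by auto
  \<comment> \<open>The contracted inner faces of \<open>ps\<close>; up to sign these are the faces
    of index 2 to n + 1 of \<open>p # ps\<close>. The sum occurs negatively in \<open>ds\<close> and
    positively in \<open>sd\<close>.\<close>
  let ?S = "\<lambda>qs. \<Sum>i\<in>{1..n}. if qs = p # contract i ps then Poly_Mapping.single (1::'p) (a * (- 1) ^ i) else 0"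
  have ds: "bar_diff \<theta> (Suc n) (bar_contraction ?x) qs =
      (if qs = ps then Poly_Mapping.single p a else 0)
      + (- (if qs = (p * hd ps) # tl ps then Poly_Mapping.single 1 a else 0) - ?S qs)
      - (if qs = p # butlast ps then Poly_Mapping.single 1 (a * (- 1) ^ Suc n) else 0)" for qs
  proof -
    let ?t = "\<lambda>i. if qs = contract i (p # ps) then Poly_Mapping.single (1::'p) (a * (- 1) ^ i) else 0"
    have "(\<Sum>i\<in>{1..Suc n}. t i) = t (Suc 0) + (\<Sum>i\<in>{1..n}. t (Suc i))" for t :: "nat \<Rightarrow> 'p \<Rightarrow>\<^sub>0 'g cstar"
      using sum.atLeast_Suc_atMost[of 1 "Suc n" t] sum.shift_bounds_cl_Suc_ivl[of t 1 n] by simp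
    then have "(\<Sum>i\<in>{1..Suc n}. ?t i) = ?t (Suc 0) + (\<Sum>i\<in>{1..n}. ?t (Suc i))" .
    also have "(\<Sum>i\<in>{1..n}. ?t (Suc i)) = - ?S qs"
      unfolding sum_negf[symmetric] by (rule sum.cong) (auto simp: contract_Suc single_uminus)
    finally show ?thesis
      unfolding bar_contraction_term bar_diff_term_apply[OF ps(2)]
      using ps(1) by (simp add: contract_1 single_uminus)
  qed
  have sd: "bar_contraction (bar_diff \<theta> n ?x) qs =
      (if qs = (p * hd ps) # tl ps then Poly_Mapping.single 1 a else 0) + ?S qs
      + (if qs = p # butlast ps then Poly_Mapping.single 1 (a * (- 1) ^ Suc n) else 0)" for qs
  proof (cases qs)
    case Nil
    then show ?thesis by (simp add: bar_contraction_def)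
  next
    case (Cons q r)
    have sum: "Poly_Mapping.single 1 (\<Sum>i\<in>K. h i) = (\<Sum>i\<in>K. Poly_Mapping.single 1 (h i))"
      if "finite K" for K :: "nat set" and h :: "nat \<Rightarrow> 'g cstar"
      using that by (induction K rule: finite_induct) (simp_all add: single_add)
    \<comment> \<open>Contraction carries one conditional to one conditional: an entry in fibre
      \<open>b\<close> at the tuple \<open>c\<close> becomes an entry in the unit fibre at
      \<open>b # c\<close>. This is applied to each face in turn.\<close>
    have s: "Poly_Mapping.single 1 (Poly_Mapping.lookup (if r = c then Poly_Mapping.single b e else 0) q)
      = (if qs = b # c then Poly_Mapping.single 1 e else 0)" for b c e
      by (auto simp: Cons lookup_single when_def)
    show ?thesis
      unfolding bar_contraction_def bar_diff_term_apply[OF single]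
      by (simp only: Cons list.case lookup_add single_add lookup_sum sum finite_atLeastAtMost
          s[unfolded Cons])
  qed
  show ?case unfolding ds sd by (rule ext) (simp add: bar_term_apply)
qed

section \<open>The complex property and exactness\<close>

lemma bar_basis: "is_basis (skew_ring \<theta>) (bar \<theta> n) (gen ` {ps. length ps = n})"
  unfolding bar_def by (rule free_module_basis[OF ring_skew_ring])

lemma bar_gen_Cons: "gen (p # ps) = bar_contraction (Poly_Mapping.single p 1 \<odot>\<^bsub>bar \<theta> n\<^esub> gen ps)"
  unfolding bar_contraction_term by (rule ext) (simp add: bar_term_apply gen_apply)

text \<open>
  That \<open>\<partial>\<partial> = 0\<close> needs no computation with faces: it follows from the homotopy identities on the image
  of the contraction, which contains all generators of positive degree.
\<close>

lemma bar_aug_diff: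
  assumes "x \<in> carrier (bar \<theta> (Suc 0))"
  shows "bar_aug \<theta> (bar_diff \<theta> 0 x) = 0"
proof (rule linear_eq_on_basis[OF left_module_bar left_module_coeff_module bar_basis
      linear_comp[OF bar_diff_linear bar_aug_linear] _ _ assms])
  show "(\<lambda>x. 0) \<in> linear_maps (skew_ring \<theta>) (bar \<theta> (Suc 0)) (coeff_module \<theta>)"
    using coeff.linear_zero by simp
  fix b assume "b \<in> gen ` {ps. length ps = Suc 0}"
  then obtain p where b: "b = gen [p]" by (auto simp: length_Suc_conv)
  let ?y = "Poly_Mapping.single p 1 \<odot>\<^bsub>bar \<theta> 0\<^esub> gen []"
  have y: "?y \<in> carrier (bar \<theta> 0)" by (rule bar_term_closed) simp
  let ?e = "Poly_Mapping.single 1 (bar_aug \<theta> ?y) \<odot>\<^bsub>bar \<theta> 0\<^esub> gen []"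
  have e: "?e \<in> carrier (bar \<theta> 0)" by (rule bar_term_closed) simp
  have b': "b = bar_contraction ?y" unfolding b by (rule bar_gen_Cons)
  \<comment> \<open>The augmentation is applied to the homotopy identity at \<open>?y\<close>. It
    sends a[] to a, so \<open>bar_aug \<theta> ?y\<close> appears on both sides and cancels.\<close>
  have "bar_aug \<theta> (bar_diff \<theta> 0 b) + bar_aug \<theta> ?e = bar_aug \<theta> (\<lambda>qs. bar_diff \<theta> 0 b qs + ?e qs)"
    unfolding b' by (rule bar_aug_add[symmetric]) (intro e linear_closed[OF bar_diff_linear] bar_contraction_closed y)+
  also have "\<dots> = bar_aug \<theta> ?y"
    unfolding b' bar_homotopy_0[OF y] ..
  finally show "bar_aug \<theta> (bar_diff \<theta> 0 b) = 0" by (simp only: bar_aug_term) simp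
qed

text \<open>Writing s for the contraction, a generator in this degree is s y, and
  \<partial>\<partial>s y = \<partial>(y - s\<partial>y) = \<partial>y - \<partial>s\<partial>y. The
  hypothesis is precisely the vanishing of this difference.\<close>

lemma bar_diff_diff_if_retract:
  assumes retract: "\<And>y. y \<in> carrier (bar \<theta> (Suc n)) \<Longrightarrow> bar_diff \<theta> n (bar_contraction (bar_diff \<theta> n y)) = bar_diff \<theta> n y"
    and x: "x \<in> carrier (bar \<theta> (Suc (Suc n)))"
  shows "bar_diff \<theta> n (bar_diff \<theta> (Suc n) x) = (\<lambda>ps. 0)"
proof (rule linear_eq_on_basis[OF left_module_bar left_module_bar bar_basis
      linear_comp[OF bar_diff_linear bar_diff_linear] _ _ x])
  show "(\<lambda>x ps. 0) \<in> linear_maps (skew_ring \<theta>) (bar \<theta> (Suc (Suc n))) (bar \<theta> n)"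
    using bar.linear_zero by (simp add: zero_bar)
  fix b assume "b \<in> gen ` {ps. length ps = Suc (Suc n)}"
  then obtain p ps where b: "b = gen (p # ps)" and ps: "length ps = Suc n"
    by (auto simp: length_Suc_conv)
  define y where "y = Poly_Mapping.single p 1 \<odot>\<^bsub>bar \<theta> (Suc n)\<^esub> gen ps"
  have y: "y \<in> carrier (bar \<theta> (Suc n))" unfolding y_def by (rule bar_term_closed[OF ps])
  have b': "b = bar_contraction y" unfolding b y_def by (rule bar_gen_Cons)
  have db: "bar_diff \<theta> (Suc n) b \<in> carrier (bar \<theta> (Suc n))"
    unfolding b' by (intro linear_closed[OF bar_diff_linear] bar_contraction_closed y)
  have "(\<lambda>qs. bar_diff \<theta> n (bar_diff \<theta> (Suc n) b) qs + bar_diff \<theta> n (bar_contraction (bar_diff \<theta> n y)) qs)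
      = bar_diff \<theta> n (\<lambda>qs. bar_diff \<theta> (Suc n) b qs + bar_contraction (bar_diff \<theta> n y) qs)"
    by (rule bar_diff_add[symmetric]) (intro db bar_contraction_closed linear_closed[OF bar_diff_linear y])+
  also have "\<dots> = bar_diff \<theta> n y"
    unfolding b' bar_homotopy_Suc[OF y] ..
  finally show "bar_diff \<theta> n (bar_diff \<theta> (Suc n) b) = (\<lambda>ps. 0)"
    unfolding retract[OF y] by (simp add: fun_eq_iff)
qed

text \<open>The identity \<open>retract\<close> comes from the homotopy identity at \<partial>y: its
  other summand vanishes by \<open>bar_aug_diff\<close> at the start and by the induction hypothesis
  afterwards.\<close>

lemma bar_diff_diff:
  "x \<in> carrier (bar \<theta> (Suc (Suc n))) \<Longrightarrow> bar_diff \<theta> n (bar_diff \<theta> (Suc n) x) = (\<lambda>ps. 0)"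
proof (induction n arbitrary: x)
  case (0 x)
  show ?case
  proof (rule bar_diff_diff_if_retract[OF _ 0])
    fix y assume y: "y \<in> carrier (bar \<theta> (Suc 0))"
    show "bar_diff \<theta> 0 (bar_contraction (bar_diff \<theta> 0 y)) = bar_diff \<theta> 0 y"
      using bar_homotopy_0[OF linear_closed[OF bar_diff_linear y]]
      by (simp add: bar_aug_diff[OF y] bar_term_apply)
  qed
next
  case (Suc n x)
  show ?case
  proof (rule bar_diff_diff_if_retract[OF _ Suc.prems])
    fix y assume y: "y \<in> carrier (bar \<theta> (Suc (Suc n)))"
    show "bar_diff \<theta> (Suc n) (bar_contraction (bar_diff \<theta> (Suc n) y)) = bar_diff \<theta> (Suc n) y"
      using bar_homotopy_Suc[OF linear_closed[OF bar_diff_linear y]]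
      by (simp add: Suc.IH[OF y] bar_contraction_zero)
  qed
qed

text \<open>At a cycle x the second summand of the homotopy identity disappears, leaving x as the
  differential of its contraction; so the contraction itself supplies the preimages for
  exactness.\<close>

theorem bar_free_resolution:
  "free_resolution (skew_ring \<theta>) (coeff_module \<theta>) (bar \<theta>) (bar_diff \<theta>) (bar_aug \<theta>)"
  unfolding free_resolution_def a_kernel_def'
proof (intro conjI allI)
  show "left_module (skew_ring \<theta>) (coeff_module \<theta>)" by (rule left_module_coeff_module)
  show "left_module (skew_ring \<theta>) (bar \<theta> n)" for n by (rule left_module_bar)
  show "\<exists>B. is_basis (skew_ring \<theta>) (bar \<theta> n) B" for n using bar_basis by blast
  show "bar_aug \<theta> \<in> linear_maps (skew_ring \<theta>) (bar \<theta> 0) (coeff_module \<theta>)" by (rule bar_aug_linear)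
  show "bar_diff \<theta> n \<in> linear_maps (skew_ring \<theta>) (bar \<theta> (Suc n)) (bar \<theta> n)" for n by (rule bar_diff_linear)
  have "a \<in> bar_aug \<theta> ` carrier (bar \<theta> 0)" for a
    using bar_aug_term[of 1 a] bar_term_closed[of "[]" 0 "Poly_Mapping.single 1 a"] by (metis imageI list.size(3))
  then show "bar_aug \<theta> ` carrier (bar \<theta> 0) = carrier (coeff_module \<theta>)" by auto
  show "bar_diff \<theta> 0 ` carrier (bar \<theta> (Suc 0)) = {x \<in> carrier (bar \<theta> 0). bar_aug \<theta> x = \<zero>\<^bsub>coeff_module \<theta>\<^esub>}"
  proof (intro subset_antisym subsetI)
    fix x assume "x \<in> {x \<in> carrier (bar \<theta> 0). bar_aug \<theta> x = \<zero>\<^bsub>coeff_module \<theta>\<^esub>}"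
    then have x: "x \<in> carrier (bar \<theta> 0)" "bar_aug \<theta> x = 0" by simp_all
    have "bar_diff \<theta> 0 (bar_contraction x) = x"
      using bar_homotopy_0[OF x(1)] by (simp add: x(2) bar_term_apply)
    then show "x \<in> bar_diff \<theta> 0 ` carrier (bar \<theta> (Suc 0))"
      using bar_contraction_closed[OF x(1)] by (metis imageI)
  qed (auto simp: bar_aug_diff linear_closed[OF bar_diff_linear])
  show "bar_diff \<theta> (Suc n) ` carrier (bar \<theta> (Suc (Suc n)))
      = {x \<in> carrier (bar \<theta> (Suc n)). bar_diff \<theta> n x = \<zero>\<^bsub>bar \<theta> n\<^esub>}" for n
  proof (intro subset_antisym subsetI)
    fix x assume "x \<in> {x \<in> carrier (bar \<theta> (Suc n)). bar_diff \<theta> n x = \<zero>\<^bsub>bar \<theta> n\<^esub>}"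
    then have x: "x \<in> carrier (bar \<theta> (Suc n))" "bar_diff \<theta> n x = (\<lambda>ps. 0)" by (simp_all add: zero_bar)
    have "bar_diff \<theta> (Suc n) (bar_contraction x) = x"
      using bar_homotopy_Suc[OF x(1)] by (simp add: x(2) bar_contraction_zero)
    then show "x \<in> bar_diff \<theta> (Suc n) ` carrier (bar \<theta> (Suc (Suc n)))"
      using bar_contraction_closed[OF x(1)] by (metis imageI)
  qed (auto simp: bar_diff_diff zero_bar linear_closed[OF bar_diff_linear])
qed

section \<open>Inhomogeneous cochains as homomorphisms on the bar modules\<close>

lemma comm_group_cochains: "comm_group (cochains n :: ('p list \<Rightarrow> 'g cstar) monoid)"
proof (rule comm_groupI)
  fix \<xi> :: "'p list \<Rightarrow> 'g cstar" assume "\<xi> \<in> carrier (cochains n)"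
  then have \<xi>: "\<xi> \<in> extensional {ps. length ps = n}" by (simp add: cochains_def)
  show "\<one>\<^bsub>cochains n\<^esub> \<otimes>\<^bsub>cochains n\<^esub> \<xi> = \<xi>"
    using \<xi> by (auto simp: cochains_def extensional_def)
  have "(\<lambda>ps\<in>{ps. length ps = n}. - \<xi> ps) \<otimes>\<^bsub>cochains n\<^esub> \<xi> = \<one>\<^bsub>cochains n\<^esub>"
    by (auto simp: cochains_def)
  moreover have "(\<lambda>ps\<in>{ps. length ps = n}. - \<xi> ps) \<in> carrier (cochains n)"
    by (simp add: cochains_def)
  ultimately show "\<exists>\<eta>\<in>carrier (cochains n). \<eta> \<otimes>\<^bsub>cochains n\<^esub> \<xi> = \<one>\<^bsub>cochains n\<^esub>" by blast
qed (auto simp: cochains_def algebra_simps)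

lemma Hom_bar_eqI:
  assumes "h \<in> carrier (Hom_group (skew_ring \<theta>) (bar \<theta> n) (coeff_module \<theta>))"
    and "k \<in> carrier (Hom_group (skew_ring \<theta>) (bar \<theta> n) (coeff_module \<theta>))"
    and "\<And>ps. length ps = n \<Longrightarrow> h (gen ps) = k (gen ps)"
  shows "h = k"
proof (rule extensionalityI)
  show "h \<in> extensional (carrier (bar \<theta> n))" "k \<in> extensional (carrier (bar \<theta> n))"
    using assms by (auto simp: Hom_group_carrier)
  fix x assume "x \<in> carrier (bar \<theta> n)"
  then show "h x = k x"
    by (rule linear_eq_on_basis[OF left_module_bar left_module_coeff_module bar_basis, rotated 3])
      (use assms in \<open>auto simp: Hom_group_carrier\<close>)
qed

definition cochain_of :: "nat \<Rightarrow> (('p list \<Rightarrow> ('p \<Rightarrow>\<^sub>0 'g cstar)) \<Rightarrow> 'g cstar) \<Rightarrow> 'p list \<Rightarrow> 'g cstar"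
  where "cochain_of n h = (\<lambda>ps\<in>{ps. length ps = n}. h (gen ps))"

definition hom_of :: "nat \<Rightarrow> ('p list \<Rightarrow> 'g cstar) \<Rightarrow> ('p list \<Rightarrow> ('p \<Rightarrow>\<^sub>0 'g cstar)) \<Rightarrow> 'g cstar"
  where "hom_of n \<xi> = (\<lambda>x\<in>carrier (bar \<theta> n). lin_ext (skew_ring \<theta>) (coeff_module \<theta>) \<xi> x)"

lemma hom_of_closed: "hom_of n \<xi> \<in> carrier (Hom_group (skew_ring \<theta>) (bar \<theta> n) (coeff_module \<theta>))"
proof -
  have "lin_ext (skew_ring \<theta>) (coeff_module \<theta>) \<xi> \<in> linear_maps (skew_ring \<theta>) (bar \<theta> n) (coeff_module \<theta>)"
    unfolding bar_def by (rule coeff.lin_ext_linear) simp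
  then show ?thesis
    unfolding hom_of_def Hom_group_carrier using bar.linear_restrict by blast
qed

lemma hom_of_gen: "length ps = n \<Longrightarrow> hom_of n \<xi> (gen ps) = \<xi> ps"
  unfolding hom_of_def using bar_gen_closed[of ps n] coeff.lin_ext_gen[of \<xi> "{ps. length ps = n}" ps] by simp

text \<open>The coefficient of the leading face acts on the values of \<open>h\<close> through
  \<theta>, whereas the signs lie in the unit fibre, which acts by plain multiplication. This is the
  origin of the twisted first term of the coboundary.\<close>

lemma coboundary_cochain_of:
  assumes "h \<in> carrier (Hom_group (skew_ring \<theta>) (bar \<theta> n) (coeff_module \<theta>))"
  shows "coboundary \<theta> n (cochain_of n h) = cochain_of (Suc n) (\<lambda>x\<in>carrier (bar \<theta> (Suc n)). h (bar_diff \<theta> n x))"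
  unfolding coboundary_def cochain_of_def
proof (rule restrict_ext)
  have h: "h \<in> linear_maps (skew_ring \<theta>) (bar \<theta> n) (coeff_module \<theta>)"
    using assms by (simp add: Hom_group_carrier)
  interpret h: abelian_group_hom "bar \<theta> n" "coeff_module \<theta>" h
    by (rule linear_abelian_group_hom[OF left_module_bar left_module_coeff_module h])
  fix ps :: "'p list" assume "ps \<in> {ps. length ps = Suc n}"
  then have ps: "length ps = Suc n" by simp
  have gc: "gen qs \<in> carrier (bar \<theta> n)" if "length qs = n" for qs by (rule bar_gen_closed[OF that])
  have t: "h (Poly_Mapping.single p a \<odot>\<^bsub>bar \<theta> n\<^esub> gen qs) = a * cstar_map (\<theta> p) (h (gen qs))"
    if "length qs = n" for p a qs
    using linear_smult[OF h _ gc[OF that]] by (simp add: coeff_module_action)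
  have fs: "(\<Oplus>\<^bsub>coeff_module \<theta>\<^esub>i\<in>K. e i) = sum e K" if "finite K" for e and K :: "nat set"
    using that by (induction K rule: finite_induct) simp_all
  let ?S = "\<Oplus>\<^bsub>bar \<theta> n\<^esub>i\<in>{1..n}. Poly_Mapping.single 1 ((- 1) ^ i) \<odot>\<^bsub>bar \<theta> n\<^esub> gen (contract i ps)"
  have cl: "(\<lambda>i. Poly_Mapping.single 1 ((- 1) ^ i) \<odot>\<^bsub>bar \<theta> n\<^esub> gen (contract i ps)) \<in> {1..n} \<rightarrow> carrier (bar \<theta> n)"
    by (auto intro!: bar_term_closed simp: length_contract ps)
  have hS: "h ?S = (\<Sum>i = 1..n. (- 1) ^ i * h (gen (contract i ps)))"
    by (subst h.hom_finsum[OF cl], subst fs)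
      (auto intro!: sum.cong simp: t length_contract ps cstar_map_action_one)
  have Sc: "?S \<in> carrier (bar \<theta> n)" by (rule bar.M.finsum_closed[OF cl])
  have "bar_diff \<theta> n (gen ps) = Poly_Mapping.single (hd ps) 1 \<odot>\<^bsub>bar \<theta> n\<^esub> gen (tl ps)
      \<oplus>\<^bsub>bar \<theta> n\<^esub> ?S
      \<oplus>\<^bsub>bar \<theta> n\<^esub> Poly_Mapping.single 1 ((- 1) ^ Suc n) \<odot>\<^bsub>bar \<theta> n\<^esub> gen (butlast ps)"
    using ps by (simp add: bar_diff_gen bar_boundary_def Let_def atLeastLessThanSuc_atLeastAtMost)
  then have "h (bar_diff \<theta> n (gen ps)) = cstar_map (\<theta> (hd ps)) (h (gen (tl ps)))
      + (\<Sum>i = 1..n. (- 1) ^ i * h (gen (contract i ps))) + (- 1) ^ Suc n * h (gen (butlast ps))"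
    using Sc ps hS by (simp add: gc t cstar_map_action_one)
  \<comment> \<open>The restriction to n-tuples in \<open>cochain_of\<close> is harmless, since
    every face of \<open>ps\<close> has length n.\<close>
  moreover have "(\<Sum>i = 1..n. (- 1) ^ i * (\<lambda>ps\<in>{ps. length ps = n}. h (gen ps)) (contract i ps))
      = (\<Sum>i = 1..n. (- 1) ^ i * h (gen (contract i ps)))"
    by (rule sum.cong) (simp_all add: length_contract ps)
  ultimately show "cstar_map (\<theta> (hd ps)) ((\<lambda>ps\<in>{ps. length ps = n}. h (gen ps)) (tl ps))
      + (\<Sum>i = 1..n. (- 1) ^ i * (\<lambda>ps\<in>{ps. length ps = n}. h (gen ps)) (contract i ps))
      + (- 1) ^ (n + 1) * (\<lambda>ps\<in>{ps. length ps = n}. h (gen ps)) (butlast ps)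
      = (\<lambda>x\<in>carrier (bar \<theta> (Suc n)). h (bar_diff \<theta> n x)) (gen ps)"
    using ps by (simp add: bar_gen_closed)
qed

theorem Hom_cohomology_bar:
  "Hom_cohomology (skew_ring \<theta>) (bar \<theta>) (bar_diff \<theta>) (coeff_module \<theta>) n
    \<cong> cohomology cochains (coboundary \<theta>) n"
  unfolding Hom_cohomology_def
proof (rule cohomology_iso_transport[OF Hom_cochain_complex[OF bar_free_resolution left_module_coeff_module]
      comm_group_cochains])
  let ?H = "\<lambda>n. Hom_group (skew_ring \<theta>) (bar \<theta> n) (coeff_module \<theta>)"
  interpret H: comm_group "?H n" for n by (rule comm_group_Hom_group[OF left_module_bar left_module_coeff_module])
  show "cochain_of n \<in> hom (?H n) (cochains n)" for n
    by (rule homI) (auto simp: cochain_of_def cochains_def Hom_group_mult bar_gen_closed)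
  show "hom_of n \<in> hom (cochains n) (?H n)" for n
  proof (rule homI)
    fix \<xi> \<eta> :: "'p list \<Rightarrow> 'g cstar"
    show "hom_of n (\<xi> \<otimes>\<^bsub>cochains n\<^esub> \<eta>) = hom_of n \<xi> \<otimes>\<^bsub>?H n\<^esub> hom_of n \<eta>"
      by (rule Hom_bar_eqI[OF hom_of_closed H.m_closed[OF hom_of_closed hom_of_closed]])
        (simp add: hom_of_gen Hom_group_mult bar_gen_closed cochains_def)
  qed (rule hom_of_closed)
  show "hom_of n (cochain_of n h) = h" if "h \<in> carrier (?H n)" for n h
    by (rule Hom_bar_eqI[OF hom_of_closed that]) (simp add: hom_of_gen cochain_of_def)
  show "cochain_of n (hom_of n \<xi>) = \<xi>" if "\<xi> \<in> carrier (cochains n)" for n \<xi>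
    using that by (auto simp: cochain_of_def hom_of_gen cochains_def extensional_def)
  show "coboundary \<theta> n (cochain_of n h)
      = cochain_of (Suc n) (\<lambda>x\<in>carrier (bar \<theta> (Suc n)). h (bar_diff \<theta> n x))"
    if "h \<in> carrier (?H n)" for n h
    by (rule coboundary_cochain_of[OF that])
qed

end

theorem mainTheorem3:
  fixes \<theta> :: "'p::monoid_mult \<Rightarrow> 'g::{ab_group_add, countable} \<Rightarrow> 'g"
  assumes "\<And>p x y. \<theta> p (x + y) = \<theta> p x + \<theta> p y"
    and "\<And>p. inj (\<theta> p)"
    and "\<theta> 1 = id"
    and "\<And>p q. \<theta> (p * q) = \<theta> p \<circ> \<theta> q"
  shows "free_resolution (skew_ring \<theta>) (coeff_module \<theta>) (bar \<theta>) (bar_diff \<theta>) (bar_aug \<theta>)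
    \<and> (\<forall>n. H_Psi \<theta> n \<cong> cohomology cochains (coboundary \<theta>) n)"
proof -
  interpret endo_action \<theta> by unfold_locales (use assms in auto)
  \<comment> \<open>The first isomorphism exchanges the syzygy resolution, on which
    \<open>Ext\<close> is built, for the bar resolution; the second evaluates homomorphisms on
    generators.\<close>
  have "H_Psi \<theta> n \<cong> cohomology cochains (coboundary \<theta>) n" for n
    unfolding H_Psi_def Ext_def
    by (rule iso_trans[OF Hom_cohomology_unique[OF syz_free_resolution[OF left_module_coeff_module]
            bar_free_resolution left_module_coeff_module] Hom_cohomology_bar])
  then show ?thesis using bar_free_resolution by blast
qed

end
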